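(* Let $E\in\mathcal M$ be infinite with $\emptyset\in E$. Then $\Vdash\forall i^{\gimel2}(i\neq0\to$ there exists an injection from $\mathbb N$ into $\gimel_iE)$.
   Context: Realizability algebra $\mathcal A$ (terms $\Lambda$, stacks $\Pi$, instructions $B,C,I,K,W,\mathrm{cc}$, continuations $k_\pi$, execution $\succ$ given by $(\xi)\eta\star\pi\succ\xi\star\eta\cdot\pi$, $I\star\xi\cdot\pi\succ\xi\star\pi$, $K\star\xi\cdot\eta\cdot\pi\succ\xi\star\pi$, $W\star\xi\cdot\eta\cdot\pi\succ\xi\star\eta\cdot\eta\cdot\pi$, $C\star\xi\cdot\eta\cdot\zeta\cdot\pi\succ\xi\star\zeta\cdot\eta\cdot\pi$, $B\star\xi\cdot\eta\cdot\zeta\cdot\pi\succ\xi\star(\eta)\zeta\cdot\pi$, $\mathrm{cc}\star\xi\cdot\pi\succ\xi\star k_\pi\cdot\pi$, $k_\pi\star\xi\cdot\varpi\succ\xi\star\pi$; set $\perp\!\!\!\perp$ of processes closed under anti-execution; proof-like terms QP), coherent, in a ground model $\mathcal M\models$ ZF+$V=L$. The realizability model $\mathcal N_{\mathcal A}$: individuals of $\mathcal M$, $\|\top\|=\emptyset$, $\|\bot\|=\Pi$, $\|a\not\varepsilon b\|=\{\pi:(a,\pi)\in b\}$, $\|a\subset b\|=\bigcup_c\{\xi\cdot\pi:(c,\pi)\in a,\xi\Vdash c\notin b\}$, $\|a\notin b\|=\bigcup_c\{\xi\cdot\xi'\cdot\pi:(c,\pi)\in b,\xi\Vdash a\subset c,\xi'\Vdash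 c\subset a\}$, $\|A\to B\|=\{\xi\cdot\pi:\xi\Vdash A,\pi\in\|B\|\}$, $\|\forall xA\|=\bigcup_a\|A[a/x]\|$; $\xi\Vdash F$ iff $\xi\star\pi\in\perp\!\!\!\perp$ for all $\pi\in\|F\|$; $\Vdash F$ means some proof-like term realizes $F$. Functionals of $\mathcal M$ are function symbols. $\gimel X=X\times\Pi$; $\|\forall x^{\gimel X}F\|=\bigcup_{a\in X}\|F[a]\|$; $\gimel2$ is a Boolean algebra with the extended operations; $i\ne0$ is the formula whose falsity value is $\Pi$ if $i=0$ and $\emptyset$ otherwise. $\gimel_iE$ is defined by the function symbol $\gimel_0E=\{\emptyset\}\times\Pi$, $\gimel_1E=E\times\Pi$ of $\mathcal M$. $\mathbb N$ denotes the set of integers of $\mathcal N_{\mathcal A}$. *)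

theory Defs
  imports Main
begin

section \<open>First-order set theory over a structure with one binary relation\<close>

datatype fm = FMem nat nat | FEq nat nat | FNeg fm | FConj fm fm | FAll nat fm

primrec sat :: "('m \<Rightarrow> 'm \<Rightarrow> bool) \<Rightarrow> (nat \<Rightarrow> 'm) \<Rightarrow> fm \<Rightarrow> bool" where
  "sat mem e (FMem i j) \<longleftrightarrow> mem (e i) (e j)"
| "sat mem e (FEq i j) \<longleftrightarrow> e i = e j"
| "sat mem e (FNeg p) \<longleftrightarrow> \<not> sat mem e p"
| "sat mem e (FConj p q) \<longleftrightarrow> sat mem e p \<and> sat mem e q"
| "sat mem e (FAll i p) \<longleftrightarrow> (\<forall>a. sat mem (e(i := a)) p)"

text \<open>
  All notions of this locale are relativised to the structure: their quantifiers range over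
  the individuals, so that they express what the structure believes about its own sets.
\<close>

locale universe =
  fixes mem :: "'m \<Rightarrow> 'm \<Rightarrow> bool" (infix "\<in>\<^sub>M" 50)
begin

text \<open>The individual with extension \<open>P\<close>; meaningful only if \<open>P\<close> is the extension of a set.\<close>

definition cset :: "('m \<Rightarrow> bool) \<Rightarrow> 'm" where
  "cset P = (THE z. \<forall>x. x \<in>\<^sub>M z \<longleftrightarrow> P x)"

definition subs :: "'m \<Rightarrow> 'm \<Rightarrow> bool" where
  "subs a b \<longleftrightarrow> (\<forall>x. x \<in>\<^sub>M a \<longrightarrow> x \<in>\<^sub>M b)"

definition empty :: 'm where
  "empty = cset (\<lambda>x. False)"

definition upair :: "'m \<Rightarrow> 'm \<Rightarrow> 'm" where
  "upair a b = cset (\<lambda>x. x = a \<or> x = b)"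

definition sing :: "'m \<Rightarrow> 'm" where
  "sing a = upair a a"

definition pair :: "'m \<Rightarrow> 'm \<Rightarrow> 'm" where
  "pair a b = upair (sing a) (upair a b)"

definition times :: "'m \<Rightarrow> 'm \<Rightarrow> 'm" where
  "times X Y = cset (\<lambda>z. \<exists>x y. x \<in>\<^sub>M X \<and> y \<in>\<^sub>M Y \<and> z = pair x y)"

definition succ :: "'m \<Rightarrow> 'm" where
  "succ a = cset (\<lambda>x. x \<in>\<^sub>M a \<or> x = a)"

definition zero :: 'm where
  "zero = empty"

definition one :: 'm where
  "one = succ zero"

definition two :: 'm where
  "two = succ one"

definition func_on :: "'m \<Rightarrow> 'm \<Rightarrow> bool" where
  "func_on f X \<longleftrightarrow>
     (\<forall>z. z \<in>\<^sub>M f \<longrightarrow> (\<exists>x y. x \<in>\<^sub>M X \<and> z = pair x y)) \<and>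
     (\<forall>x. x \<in>\<^sub>M X \<longrightarrow> (\<exists>!y. pair x y \<in>\<^sub>M f))"

definition ap :: "'m \<Rightarrow> 'm \<Rightarrow> 'm" where
  "ap f x = (THE y. pair x y \<in>\<^sub>M f)"

definition func :: "'m \<Rightarrow> 'm \<Rightarrow> 'm \<Rightarrow> bool" where
  "func f X Y \<longleftrightarrow> func_on f X \<and> (\<forall>x. x \<in>\<^sub>M X \<longrightarrow> ap f x \<in>\<^sub>M Y)"

definition bijection :: "'m \<Rightarrow> 'm \<Rightarrow> 'm \<Rightarrow> bool" where
  "bijection f X Y \<longleftrightarrow> func f X Y \<and>
     (\<forall>y. y \<in>\<^sub>M Y \<longrightarrow> (\<exists>!x. x \<in>\<^sub>M X \<and> ap f x = y))"

definition transitive :: "'m \<Rightarrow> bool" where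
  "transitive a \<longleftrightarrow> (\<forall>x. x \<in>\<^sub>M a \<longrightarrow> subs x a)"

definition ordinal :: "'m \<Rightarrow> bool" where
  "ordinal a \<longleftrightarrow> transitive a \<and> (\<forall>x. x \<in>\<^sub>M a \<longrightarrow> transitive x)"

definition natural :: "'m \<Rightarrow> bool" where
  "natural n \<longleftrightarrow> ordinal n \<and> (\<forall>k. k = n \<or> k \<in>\<^sub>M n \<longrightarrow> k = zero \<or> (\<exists>j. k = succ j))"

definition omega :: 'm where
  "omega = cset natural"

definition infinite_set :: "'m \<Rightarrow> bool" where
  "infinite_set X \<longleftrightarrow> \<not> (\<exists>n f. natural n \<and> bijection f n X)"

text \<open>
  Definability over \<open>A\<close> inside the structure. A formula with variables indexed by \<open>omega\<close> and
  parameters from \<open>A\<close> is represented by the set of assignments from \<open>omega\<close> to \<open>A\<close> that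
  satisfy it; these sets form the least family that contains the atomic relations and is
  closed under complement, intersection and existential quantification over \<open>A\<close>.
\<close>

definition assigns :: "'m \<Rightarrow> ('m \<Rightarrow> bool) \<Rightarrow> 'm" where
  "assigns A P = cset (\<lambda>s. func s omega A \<and> P s)"

definition def_closed :: "'m \<Rightarrow> 'm \<Rightarrow> bool" where
  "def_closed A D \<longleftrightarrow>
     (\<forall>m n. m \<in>\<^sub>M omega \<longrightarrow> n \<in>\<^sub>M omega \<longrightarrow>
        assigns A (\<lambda>s. ap s m \<in>\<^sub>M ap s n) \<in>\<^sub>M D \<and> assigns A (\<lambda>s. ap s m = ap s n) \<in>\<^sub>M D) \<and>
     (\<forall>m a. m \<in>\<^sub>M omega \<longrightarrow> a \<in>\<^sub>M A \<longrightarrow> assigns A (\<lambda>s. ap s m = a) \<in>\<^sub>M D) \<and>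
     (\<forall>R. R \<in>\<^sub>M D \<longrightarrow> assigns A (\<lambda>s. \<not> s \<in>\<^sub>M R) \<in>\<^sub>M D) \<and>
     (\<forall>R S. R \<in>\<^sub>M D \<longrightarrow> S \<in>\<^sub>M D \<longrightarrow> assigns A (\<lambda>s. s \<in>\<^sub>M R \<and> s \<in>\<^sub>M S) \<in>\<^sub>M D) \<and>
     (\<forall>m R. m \<in>\<^sub>M omega \<longrightarrow> R \<in>\<^sub>M D \<longrightarrow>
        assigns A (\<lambda>s. \<exists>t. func t omega A \<and> t \<in>\<^sub>M R \<and>
          (\<forall>n. n \<in>\<^sub>M omega \<longrightarrow> n \<noteq> m \<longrightarrow> ap t n = ap s n)) \<in>\<^sub>M D)"

definition definable_subset :: "'m \<Rightarrow> 'm \<Rightarrow> bool" where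
  "definable_subset A X \<longleftrightarrow> subs X A \<and>
     (\<forall>D. def_closed A D \<longrightarrow> assigns A (\<lambda>s. ap s zero \<in>\<^sub>M X) \<in>\<^sub>M D)"

text \<open>The constructible hierarchy, as \<open>L\<^sub>\<beta> = \<Union>\<gamma><\<beta>. Def(L\<^sub>\<gamma>)\<close>, below the ordinal \<open>a\<close>.\<close>

definition L_hierarchy :: "'m \<Rightarrow> 'm \<Rightarrow> bool" where
  "L_hierarchy a f \<longleftrightarrow> ordinal a \<and> func_on f a \<and>
     (\<forall>b. b \<in>\<^sub>M a \<longrightarrow>
        (\<forall>x. x \<in>\<^sub>M ap f b \<longleftrightarrow> (\<exists>c. c \<in>\<^sub>M b \<and> definable_subset (ap f c) x)))"

definition constructible :: "'m \<Rightarrow> bool" where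
  "constructible x \<longleftrightarrow> (\<exists>a f b. L_hierarchy a f \<and> b \<in>\<^sub>M a \<and> x \<in>\<^sub>M ap f b)"

end

text \<open>Arbitrary assignments \<open>e\<close> in the two schemes supply the parameters.\<close>

locale zf_model = universe +
  assumes extensionality: "(\<forall>x. x \<in>\<^sub>M a \<longleftrightarrow> x \<in>\<^sub>M b) \<Longrightarrow> a = b"
    and foundation: "\<exists>x. x \<in>\<^sub>M a \<Longrightarrow> \<exists>x. x \<in>\<^sub>M a \<and> (\<forall>y. y \<in>\<^sub>M x \<longrightarrow> \<not> y \<in>\<^sub>M a)"
    and pairing: "\<exists>c. \<forall>x. x \<in>\<^sub>M c \<longleftrightarrow> x = a \<or> x = b"
    and union: "\<exists>b. \<forall>x. x \<in>\<^sub>M b \<longleftrightarrow> (\<exists>y. y \<in>\<^sub>M a \<and> x \<in>\<^sub>M y)"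
    and powerset: "\<exists>b. \<forall>x. x \<in>\<^sub>M b \<longleftrightarrow> (\<forall>y. y \<in>\<^sub>M x \<longrightarrow> y \<in>\<^sub>M a)"
    and infinity: "\<exists>a. (\<exists>z. z \<in>\<^sub>M a \<and> (\<forall>x. \<not> x \<in>\<^sub>M z)) \<and>
      (\<forall>x. x \<in>\<^sub>M a \<longrightarrow> (\<exists>y. y \<in>\<^sub>M a \<and> (\<forall>z. z \<in>\<^sub>M y \<longleftrightarrow> z \<in>\<^sub>M x \<or> z = x)))"
    and separation: "\<exists>b. \<forall>x. x \<in>\<^sub>M b \<longleftrightarrow> x \<in>\<^sub>M a \<and> sat mem (e(0 := x)) p"
    and replacement: "(\<forall>x. x \<in>\<^sub>M a \<longrightarrow> (\<exists>!y. sat mem (e(0 := x, 1 := y)) p)) \<Longrightarrow>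
      \<exists>b. \<forall>y. y \<in>\<^sub>M b \<longleftrightarrow> (\<exists>x. x \<in>\<^sub>M a \<and> sat mem (e(0 := x, 1 := y)) p)"

locale ground_model = zf_model +
  assumes V_eq_L: "\<forall>x. constructible x"


section \<open>Realizability algebras in the ground model\<close>

text \<open>
  All components are individuals of the ground model: the carriers, the operations (functions
  in the sense of the ground model), the instructions, the execution preorder, the set
  of processes written with a double bottom (\<open>Pole\<close>) and the set of proof-like terms.
\<close>

record 'm ralg =
  Lam :: 'm
  Stk :: 'm
  Prc :: 'm
  App :: 'm
  Push :: 'm
  Cut :: 'm
  Cont :: 'm
  cB :: 'm
  cC :: 'm
  cI :: 'm
  cK :: 'm
  cW :: 'm
  cCC :: 'm
  Exec :: 'm
  Pole :: 'm
  QP :: 'm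

locale realizability_frame = universe mem
  for mem :: "'m \<Rightarrow> 'm \<Rightarrow> bool" (infix "\<in>\<^sub>M" 50) +
  fixes \<A> :: "'m ralg"
begin

definition app :: "'m \<Rightarrow> 'm \<Rightarrow> 'm" where
  "app x y = ap (App \<A>) (pair x y)"

definition push :: "'m \<Rightarrow> 'm \<Rightarrow> 'm" (infixr "\<cdot>" 65) where
  "x \<cdot> p = ap (Push \<A>) (pair x p)"

definition cut :: "'m \<Rightarrow> 'm \<Rightarrow> 'm" (infix "\<star>" 60) where
  "x \<star> p = ap (Cut \<A>) (pair x p)"

definition cont :: "'m \<Rightarrow> 'm" where
  "cont p = ap (Cont \<A>) p"

definition exec :: "'m \<Rightarrow> 'm \<Rightarrow> bool" (infix "\<succ>" 50) where
  "p \<succ> q \<longleftrightarrow> pair p q \<in>\<^sub>M Exec \<A>"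

definition is_algebra :: bool where
  "is_algebra \<longleftrightarrow>
     func (App \<A>) (times (Lam \<A>) (Lam \<A>)) (Lam \<A>) \<and>
     func (Push \<A>) (times (Lam \<A>) (Stk \<A>)) (Stk \<A>) \<and>
     func (Cut \<A>) (times (Lam \<A>) (Stk \<A>)) (Prc \<A>) \<and>
     func (Cont \<A>) (Stk \<A>) (Lam \<A>) \<and>
     subs (QP \<A>) (Lam \<A>) \<and>
     cB \<A> \<in>\<^sub>M QP \<A> \<and> cC \<A> \<in>\<^sub>M QP \<A> \<and> cI \<A> \<in>\<^sub>M QP \<A> \<and>
     cK \<A> \<in>\<^sub>M QP \<A> \<and> cW \<A> \<in>\<^sub>M QP \<A> \<and> cCC \<A> \<in>\<^sub>M QP \<A> \<and>
     (\<forall>x y. x \<in>\<^sub>M QP \<A> \<longrightarrow> y \<in>\<^sub>M QP \<A> \<longrightarrow> app x y \<in>\<^sub>M QP \<A>) \<and>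
     subs (Exec \<A>) (times (Prc \<A>) (Prc \<A>)) \<and>
     (\<forall>p. p \<in>\<^sub>M Prc \<A> \<longrightarrow> p \<succ> p) \<and>
     (\<forall>p q r. p \<succ> q \<longrightarrow> q \<succ> r \<longrightarrow> p \<succ> r) \<and>
     (\<forall>x y z p q. x \<in>\<^sub>M Lam \<A> \<longrightarrow> y \<in>\<^sub>M Lam \<A> \<longrightarrow> z \<in>\<^sub>M Lam \<A> \<longrightarrow>
        p \<in>\<^sub>M Stk \<A> \<longrightarrow> q \<in>\<^sub>M Stk \<A> \<longrightarrow>
          app x y \<star> p \<succ> x \<star> y \<cdot> p \<and>
          cI \<A> \<star> x \<cdot> p \<succ> x \<star> p \<and>
          cK \<A> \<star> x \<cdot> y \<cdot> p \<succ> x \<star> p \<and>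
          cW \<A> \<star> x \<cdot> y \<cdot> p \<succ> x \<star> y \<cdot> y \<cdot> p \<and>
          cC \<A> \<star> x \<cdot> y \<cdot> z \<cdot> p \<succ> x \<star> z \<cdot> y \<cdot> p \<and>
          cB \<A> \<star> x \<cdot> y \<cdot> z \<cdot> p \<succ> x \<star> app y z \<cdot> p \<and>
          cCC \<A> \<star> x \<cdot> p \<succ> x \<star> cont p \<cdot> p \<and>
          cont p \<star> x \<cdot> q \<succ> x \<star> p) \<and>
     subs (Pole \<A>) (Prc \<A>) \<and>
     (\<forall>p q. p \<succ> q \<longrightarrow> q \<in>\<^sub>M Pole \<A> \<longrightarrow> p \<in>\<^sub>M Pole \<A>)"

definition coherent :: bool where
  "coherent \<longleftrightarrow>
     (\<forall>t. t \<in>\<^sub>M QP \<A> \<longrightarrow> (\<exists>p. p \<in>\<^sub>M Stk \<A> \<and> \<not> t \<star> p \<in>\<^sub>M Pole \<A>))"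


subsection \<open>Falsity values\<close>

text \<open>
  A closed formula with parameters is represented by its falsity value, a set of stacks;
  a formula with free variables is a function from individuals to falsity values, and a
  function symbol is applied as the corresponding functional of the ground model.
\<close>

definition forces :: "'m \<Rightarrow> 'm set \<Rightarrow> bool" (infix "\<tturnstile>" 40) where
  "x \<tturnstile> F \<longleftrightarrow> x \<in>\<^sub>M Lam \<A> \<and> (\<forall>p\<in>F. x \<star> p \<in>\<^sub>M Pole \<A>)"

definition realized :: "'m set \<Rightarrow> bool" where
  "realized F \<longleftrightarrow> (\<exists>t. t \<in>\<^sub>M QP \<A> \<and> t \<tturnstile> F)"

definition fbot :: "'m set" where
  "fbot = {p. p \<in>\<^sub>M Stk \<A>}"

definition fimp :: "'m set \<Rightarrow> 'm set \<Rightarrow> 'm set" (infixr "\<^bold>\<longrightarrow>" 25) where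
  "(F \<^bold>\<longrightarrow> G) = {x \<cdot> p | x p. x \<tturnstile> F \<and> p \<in> G}"

definition fall :: "('m \<Rightarrow> 'm set) \<Rightarrow> 'm set" (binder "\<^bold>\<forall>" 10) where
  "fall F = (\<Union>a. F a)"

definition gimel :: "'m \<Rightarrow> 'm" where
  "gimel X = times X (Stk \<A>)"

definition fall_gimel :: "'m \<Rightarrow> ('m \<Rightarrow> 'm set) \<Rightarrow> 'm set" where
  "fall_gimel X F = (\<Union>a\<in>{a. a \<in>\<^sub>M X}. F a)"

definition not_eps :: "'m \<Rightarrow> 'm \<Rightarrow> 'm set" where
  "not_eps a b = {p. p \<in>\<^sub>M Stk \<A> \<and> pair a p \<in>\<^sub>M b}"

definition fneq :: "'m \<Rightarrow> 'm \<Rightarrow> 'm set" where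
  "fneq a b = (if a = b then fbot else {})"

definition fnot :: "'m set \<Rightarrow> 'm set" where
  "fnot F = (F \<^bold>\<longrightarrow> fbot)"

definition fand :: "'m set \<Rightarrow> 'm set \<Rightarrow> 'm set" (infixr "\<^bold>\<and>" 35) where
  "(F \<^bold>\<and> G) = fnot (F \<^bold>\<longrightarrow> G \<^bold>\<longrightarrow> fbot)"

definition fex :: "('m \<Rightarrow> 'm set) \<Rightarrow> 'm set" (binder "\<^bold>\<exists>" 10) where
  "fex F = fnot (\<^bold>\<forall>a. fnot (F a))"

definition eps :: "'m \<Rightarrow> 'm \<Rightarrow> 'm set" (infix "\<^bold>\<in>" 50) where
  "(a \<^bold>\<in> b) = fnot (not_eps a b)"

text \<open>Equality is the strong (Leibniz) one, not the extensional one.\<close>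

definition feq :: "'m \<Rightarrow> 'm \<Rightarrow> 'm set" (infix "\<^bold>=" 50) where
  "(a \<^bold>= b) = (\<^bold>\<forall>z. not_eps a z \<^bold>\<longrightarrow> not_eps b z)"


subsection \<open>Integers and injections of the realizability model\<close>

text \<open>
  In the realizability model \<open>zero\<close> is the empty set and \<open>rsucc a\<close> is the singleton of \<open>a\<close>;
  the set of integers is the least set containing \<open>zero\<close> and closed under \<open>rsucc\<close>. (The
  von Neumann integers of the ground model will not do: as individuals of the
  realizability model they need not have the right elements.)
\<close>

definition rsucc :: "'m \<Rightarrow> 'm" where
  "rsucc a = times (sing a) (Stk \<A>)"

definition is_integer :: "'m \<Rightarrow> 'm set" where
  "is_integer x = (\<^bold>\<forall>X. zero \<^bold>\<in> X \<^bold>\<longrightarrow> (\<^bold>\<forall>y. y \<^bold>\<in> X \<^bold>\<longrightarrow> rsucc y \<^bold>\<in> X) \<^bold>\<longrightarrow> x \<^bold>\<in> X)"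

definition is_set_of_integers :: "'m \<Rightarrow> 'm set" where
  "is_set_of_integers N = (\<^bold>\<forall>x. (x \<^bold>\<in> N \<^bold>\<longrightarrow> is_integer x) \<^bold>\<and> (is_integer x \<^bold>\<longrightarrow> x \<^bold>\<in> N))"

text \<open>Ordered pairs of the realizability model are given by the pairing functional.\<close>

definition is_injection :: "'m \<Rightarrow> 'm \<Rightarrow> 'm \<Rightarrow> 'm set" where
  "is_injection f X Y =
     ((\<^bold>\<forall>z. z \<^bold>\<in> f \<^bold>\<longrightarrow> (\<^bold>\<exists>x. \<^bold>\<exists>y. x \<^bold>\<in> X \<^bold>\<and> y \<^bold>\<in> Y \<^bold>\<and> z \<^bold>= pair x y)) \<^bold>\<and>
      (\<^bold>\<forall>x. x \<^bold>\<in> X \<^bold>\<longrightarrow> (\<^bold>\<exists>y. pair x y \<^bold>\<in> f)) \<^bold>\<and>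
      (\<^bold>\<forall>x. \<^bold>\<forall>y. \<^bold>\<forall>y'. pair x y \<^bold>\<in> f \<^bold>\<longrightarrow> pair x y' \<^bold>\<in> f \<^bold>\<longrightarrow> y \<^bold>= y') \<^bold>\<and>
      (\<^bold>\<forall>x. \<^bold>\<forall>x'. \<^bold>\<forall>y. pair x y \<^bold>\<in> f \<^bold>\<longrightarrow> pair x' y \<^bold>\<in> f \<^bold>\<longrightarrow> x \<^bold>= x'))"

definition injection_from_integers_into :: "'m \<Rightarrow> 'm set" where
  "injection_from_integers_into Y =
     (\<^bold>\<exists>N. is_set_of_integers N \<^bold>\<and> (\<^bold>\<exists>f. is_injection f N Y))"

text \<open>Only the values at \<open>zero\<close> and \<open>one\<close> matter; elsewhere the choice is arbitrary.\<close>

definition gimel_ix :: "'m \<Rightarrow> 'm \<Rightarrow> 'm" where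
  "gimel_ix i E = (if i = zero then gimel (sing empty) else gimel E)"

end

end

theory Submission
  imports Defs
begin

text \<open>
  Since the ground model satisfies \<open>V = L\<close>, the set \<open>E\<close> can be well-ordered in it. To each integer
  \<open>n\<close> of the ground model correspond the integer \<open>x\<close> of the realizability model (the \<open>n\<close>-th iterate
  of \<open>rsucc\<close>), a term \<open>a\<close> that computes with \<open>n\<close>, and the \<open>n\<close>-th element \<open>y\<close> of \<open>E\<close>. The sets of all
  \<open>(x, a \<cdot> \<pi>)\<close> and of all \<open>((x, y), a \<cdot> \<pi>)\<close> then represent the integers and an injection into
  \<open>gimel_ix one E\<close>; replacing \<open>y\<close> by the empty set gives the graph of a map into
  \<open>gimel_ix zero E\<close>. A realizer of injectivity must not depend on \<open>i\<close>. From the two integers \<open>a\<close> and \<open>a'\<close> that the hypotheses provide,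
  it decides whether they are equal: if so, the conclusion holds, and if not, then \<open>i = 0\<close>, and the
  realizer of \<open>i \<noteq> 0\<close> proves anything.

  The ground model may be ill-founded, so that every recursion and induction has to be carried out
  inside it, for predicates that are definable in the language of set theory.

  To well-order a constructible set, the definable relations over the levels of the constructible
  hierarchy are enumerated: each of them arises by one of finitely many operations from ordinals and
  from at most two others, so that a well-order of some of them yields the next one, the one
  with the least such description.
\<close>

section \<open>Definable predicates\<close>

text \<open>A stack refuting membership of \<open>x\<close> in \<open>integers\<close> starts with
  the very numeral listed for \<open>x\<close>, not with some term that computes it. A realizer of
  membership can therefore be used to obtain this numeral, but on an unknown stack, so the current
  stack must first be saved with \<open>cc\<close> unless the conclusion is bottom. For the same
  reason the compiled terms distinguish passing the value of a variable from passing a closure, and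
  successors are built with \<open>B\<close>. The numerals are recursors and not mere iterators:
  iteration proves the induction principle by which integers are defined, and access to the
  predecessor makes the equality test possible. \<open>infinite_set\<close> only excludes bijections
  with naturals, so an injective sequence in \<open>E\<close> requires a choice of successive
  elements; this is what the well-order supplies. Inductions about execution run inside the model,
  where \<open>app\<close>, \<open>push\<close> and \<open>cut\<close> are unsuitable because they
  rest on \<open>ap\<close>; such statements are first rephrased with \<open>val\<close>.\<close>

primrec rename_fm :: "(nat \<Rightarrow> nat) \<Rightarrow> fm \<Rightarrow> fm" where
  "rename_fm f (FMem i j) = FMem (f i) (f j)"
| "rename_fm f (FEq i j) = FEq (f i) (f j)"
| "rename_fm f (FNeg p) = FNeg (rename_fm f p)"
| "rename_fm f (FConj p q) = FConj (rename_fm f p) (rename_fm f q)"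
| "rename_fm f (FAll i p) = FAll (f i) (rename_fm f p)"

text \<open>Bound names are renamed together with free ones, so injectivity of \<open>f\<close> is
  what excludes capture.\<close>

lemma sat_rename_fm:
  assumes "inj f"
  shows "sat mem e (rename_fm f p) \<longleftrightarrow> sat mem (e \<circ> f) p"
proof (induction p arbitrary: e)
  case (FAll i p)
  have eq: "(e(f i := a)) \<circ> f = (e \<circ> f)(i := a)" for a
    using assms by (auto simp: fun_eq_iff inj_eq)
  show ?case unfolding rename_fm.simps sat.simps FAll eq ..
qed (simp_all del: fun_upd_apply)

text \<open>Variables congruent to 0, 1 and 2 modulo 3 stand for free variables, for parameters and
  for names that are kept fresh for bound variables.\<close>

definition mix :: "(nat \<Rightarrow> 'm) \<Rightarrow> (nat \<Rightarrow> 'm) \<Rightarrow> (nat \<Rightarrow> 'm) \<Rightarrow> nat \<Rightarrow> 'm" where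
  "mix e c j n = (if n mod 3 = 0 then e (n div 3) else if n mod 3 = 1 then c (n div 3) else j (n div 3))"

lemma mod3_cases:
  obtains q :: nat where "n = 3 * q" | q where "n = 3 * q + 1" | q where "n = 3 * q + 2"
proof -
  have "n = 3 * (n div 3) + n mod 3" "n mod 3 < 3" by simp_all
  then show ?thesis using that by (metis One_nat_def Suc_1 add_0_right less_2_cases less_antisym numeral_3_eq_3)
qed

lemma Suc_mult_3 [simp]: "Suc (3 * q) mod 3 = 1" "Suc (3 * q) div 3 = q"
  "Suc (Suc (3 * q)) mod 3 = 2" "Suc (Suc (3 * q)) div 3 = q"
  by presburger+

lemma mix_simps [simp]:
  "mix e c j (3 * q) = e q" "mix e c j (3 * q + 1) = c q" "mix e c j (Suc (3 * q)) = c q"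
  "mix e c j (3 * q + 2) = j q" "mix e c j (Suc (Suc (3 * q))) = j q"
  by (simp_all add: mix_def)

named_theorems definable_intros

context universe
begin

text \<open>One formula and one list \<open>c\<close> of parameters must serve for all
  \<open>e\<close>. Independence of \<open>j\<close> leaves infinitely many names at the disposal of
  quantifiers.\<close>

definition definable :: "((nat \<Rightarrow> 'm) \<Rightarrow> bool) \<Rightarrow> bool" where
  "definable P \<longleftrightarrow> (\<exists>p c. \<forall>e j. sat mem (mix e c j) p \<longleftrightarrow> P e)"

text \<open>Free variables are de Bruijn indices into the assignment: a quantifier binds index 0.\<close>

definition definable_term :: "((nat \<Rightarrow> 'm) \<Rightarrow> 'm) \<Rightarrow> bool" where
  "definable_term t \<longleftrightarrow> definable (\<lambda>e. e 0 = t (\<lambda>n. e (Suc n)))"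

lemma definable_mem_var: "definable (\<lambda>e. e i \<in>\<^sub>M e k)"
  unfolding definable_def by (rule exI[of _ "FMem (3 * i) (3 * k)"]) (simp add: mix_def)

lemma definable_eq_var: "definable (\<lambda>e. e i = e k)"
  unfolding definable_def by (rule exI[of _ "FEq (3 * i) (3 * k)"]) (simp add: mix_def)

lemma definable_term_var [definable_intros]: "definable_term (\<lambda>e. e k)"
  unfolding definable_term_def by (rule definable_eq_var)

lemma definable_term_const [definable_intros]: "definable_term (\<lambda>e. c)"
  unfolding definable_term_def definable_def
  by (rule exI[of _ "FEq 0 1"], rule exI[of _ "\<lambda>_. c"]) (simp add: mix_def)

lemma definable_not [definable_intros]: "definable P \<Longrightarrow> definable (\<lambda>e. \<not> P e)"
  unfolding definable_def by (metis sat.simps(3))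

lemma definable_and [definable_intros]:
  assumes "definable P" "definable Q"
  shows "definable (\<lambda>e. P e \<and> Q e)"
proof -
  obtain p c where p: "\<And>e j. sat mem (mix e c j) p \<longleftrightarrow> P e"
    using assms(1) unfolding definable_def by blast
  obtain q d where q: "\<And>e j. sat mem (mix e d j) q \<longleftrightarrow> Q e"
    using assms(2) unfolding definable_def by blast
  \<comment> \<open>The parameter lists are interleaved: \<open>f\<close> moves the parameters of
    \<open>p\<close> to even positions and \<open>g\<close> those of \<open>q\<close> to odd
    ones.\<close>
  define f where "f n = (if n mod 3 = 1 then 6 * (n div 3) + 1 else n)" for n :: nat
  define g where "g n = (if n mod 3 = 1 then 6 * (n div 3) + 4 else n)" for n :: nat
  have f_simps: "f (3 * q) = 3 * q" "f (3 * q + 1) = 3 * (2 * q) + 1" "f (3 * q + 2) = 3 * q + 2" for q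
    by (simp_all add: f_def)
  have g_simps: "g (3 * q) = 3 * q" "g (3 * q + 1) = 3 * (2 * q + 1) + 1" "g (3 * q + 2) = 3 * q + 2" for q
    by (simp_all add: g_def)
  have f: "inj f"
  proof (rule injI)
    fix x y assume "f x = f y"
    then show "x = y"
      by (cases x rule: mod3_cases; cases y rule: mod3_cases; simp only: f_simps; presburger)
  qed
  have g: "inj g"
  proof (rule injI)
    fix x y assume "g x = g y"
    then show "x = y"
      by (cases x rule: mod3_cases; cases y rule: mod3_cases; simp only: g_simps; presburger)
  qed
  define b where "b n = (if even n then c (n div 2) else d (n div 2))" for n
  have "(mix e b j \<circ> f) n = mix e c j n" for e j n
    by (cases n rule: mod3_cases) (simp_all only: comp_def f_simps mix_simps, simp_all add: b_def)
  moreover have "(mix e b j \<circ> g) n = mix e d j n" for e j n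
    by (cases n rule: mod3_cases) (simp_all only: comp_def g_simps mix_simps, simp_all add: b_def)
  ultimately have "mix e b j \<circ> f = mix e c j" "mix e b j \<circ> g = mix e d j" for e j
    by auto
  then have "sat mem (mix e b j) (FConj (rename_fm f p) (rename_fm g q)) \<longleftrightarrow> P e \<and> Q e" for e j
    by (simp add: sat_rename_fm f g p q)
  then show ?thesis unfolding definable_def by blast
qed

lemma definable_rename:
  assumes "definable P" "inj g"
  shows "definable (\<lambda>e. P (\<lambda>n. e (g n)))"
proof -
  obtain p c where p: "\<And>e j. sat mem (mix e c j) p \<longleftrightarrow> P e"
    using assms(1) unfolding definable_def by blast
  define f where "f n = (if n mod 3 = 0 then 3 * g (n div 3) else n)" for n :: nat
  have f3: "f n mod 3 = n mod 3" for n
    unfolding f_def by simp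
  have "inj f"
  proof (rule injI)
    fix x y assume h: "f x = f y"
    then have m: "x mod 3 = y mod 3" by (metis f3)
    show "x = y"
    proof (cases "x mod 3 = 0")
      case True
      then have "g (x div 3) = g (y div 3)" using h m by (simp add: f_def)
      then have "x div 3 = y div 3" using assms(2) by (simp add: inj_eq)
      then show ?thesis using m by (metis div_mult_mod_eq)
    next
      case False then show ?thesis using h m by (simp add: f_def)
    qed
  qed
  moreover have "mix e c j \<circ> f = mix (\<lambda>n. e (g n)) c j" for e j
    by (auto simp: mix_def fun_eq_iff f_def)
  ultimately have "sat mem (mix e c j) (rename_fm f p) \<longleftrightarrow> P (\<lambda>n. e (g n))" for e j
    by (simp add: sat_rename_fm p)
  then show ?thesis unfolding definable_def by blast
qed

lemma definable_all [definable_intros]: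
  assumes "definable (\<lambda>e. Q (\<lambda>n. e (Suc n)) (e 0))"
  shows "definable (\<lambda>e. \<forall>y. Q e y)"
proof -
  obtain p c where p: "\<And>e j. sat mem (mix e c j) p \<longleftrightarrow> Q (\<lambda>n. e (Suc n)) (e 0)"
    using assms(1) unfolding definable_def by blast
  \<comment> \<open>The variable with index 0 becomes the fresh name 2, which is then quantified;
    the other free variables move down by one index, and the remaining fresh names move up to keep 2
    vacant.\<close>
  define f where "f n = (if n = 0 then 2 else if n mod 3 = 0 then n - 3 else if n mod 3 = 1 then n else n + 3)"
    for n :: nat
  have f_simps: "f (3 * q) = (case q of 0 \<Rightarrow> 2 | Suc r \<Rightarrow> 3 * r)"
    "f (3 * q + 1) = 3 * q + 1" "f (3 * q + 2) = 3 * Suc q + 2" for q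
    by (auto simp: f_def dvd_eq_mod_eq_0 split: nat.split)
  have "inj f"
  proof (rule injI)
    fix x y assume "f x = f y"
    then show "x = y"
      by (cases x rule: mod3_cases; cases y rule: mod3_cases; simp only: f_simps split: nat.splits; presburger)
  qed
  moreover have "(mix e c j)(2 := y) \<circ> f = mix (case_nat y e) c (\<lambda>n. j (Suc n))" for e j y
  proof
    fix n :: nat
    have ne: "3 * q \<noteq> 2" "3 * q + 1 \<noteq> 2" "3 * Suc q + 2 \<noteq> 2" for q :: nat
      by presburger+
    show "((mix e c j)(2 := y) \<circ> f) n = mix (case_nat y e) c (\<lambda>n. j (Suc n)) n"
      by (cases n rule: mod3_cases)
        (simp_all only: comp_def f_simps mix_simps fun_upd_def ne if_False split: nat.split, simp_all)
  qed
  ultimately have "sat mem (mix e c j) (FAll 2 (rename_fm f p)) \<longleftrightarrow> (\<forall>y. Q e y)" for e j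
    by (simp add: sat_rename_fm p)
  then show ?thesis unfolding definable_def by blast
qed

lemma definable_iff_eq: "definable P \<Longrightarrow> (\<And>e. P e \<longleftrightarrow> Q e) \<Longrightarrow> definable Q"
  by (auto simp: fun_eq_iff definable_def)

lemma definable_or [definable_intros]: "definable P \<Longrightarrow> definable Q \<Longrightarrow> definable (\<lambda>e. P e \<or> Q e)"
  by (rule definable_iff_eq[of "\<lambda>e. \<not> (\<not> P e \<and> \<not> Q e)"]) (intro definable_intros, simp_all)

lemma definable_imp [definable_intros]: "definable P \<Longrightarrow> definable Q \<Longrightarrow> definable (\<lambda>e. P e \<longrightarrow> Q e)"
  by (rule definable_iff_eq[of "\<lambda>e. \<not> (P e \<and> \<not> Q e)"]) (intro definable_intros, simp_all)

lemma definable_ex [definable_intros]: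
  "definable (\<lambda>e. Q (\<lambda>n. e (Suc n)) (e 0)) \<Longrightarrow> definable (\<lambda>e. \<exists>y. Q e y)"
  by (rule definable_iff_eq[of "\<lambda>e. \<not> (\<forall>y. \<not> Q e y)"]) (intro definable_intros, simp_all)

lemma definable_iff [definable_intros]: "definable P \<Longrightarrow> definable Q \<Longrightarrow> definable (\<lambda>e. P e \<longleftrightarrow> Q e)"
  by (rule definable_iff_eq[of "\<lambda>e. (P e \<longrightarrow> Q e) \<and> (Q e \<longrightarrow> P e)"]) (intro definable_intros, auto)

lemma definable_subst:
  assumes "definable (\<lambda>e. P (e 0) (\<lambda>n. e (Suc n)))" "definable_term t"
  shows "definable (\<lambda>e. P (t e) e)"
proof -
  have "definable (\<lambda>e. \<exists>y. y = t e \<and> P y e)"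
    using assms unfolding definable_term_def by (intro definable_ex definable_and)
  then show ?thesis by (rule definable_iff_eq) simp
qed

lemma definable_term_shift: "definable_term t \<Longrightarrow> definable_term (\<lambda>e. t (\<lambda>n. e (Suc n)))"
  unfolding definable_term_def
  using definable_rename[where g = "\<lambda>n. case n of 0 \<Rightarrow> 0 | Suc k \<Rightarrow> Suc (Suc k)"]
  by (fastforce simp: inj_def split: nat.splits)

lemma definable_comp1: "definable (\<lambda>e. P (e 0)) \<Longrightarrow> definable_term s \<Longrightarrow> definable (\<lambda>e. P (s e))"
  by (rule definable_subst[where P = "\<lambda>x e. P x"])

lemma definable_comp2:
  assumes "definable (\<lambda>e. P (e 0) (e 1))" "definable_term s" "definable_term t"
  shows "definable (\<lambda>e. P (s e) (t e))"
proof -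
  have "definable (\<lambda>e. P (s (\<lambda>n. e (Suc n))) (e 0))"
    by (rule definable_subst[where P = "\<lambda>x e. P x (e 0)"])
      (use assms definable_term_shift in auto)
  from definable_subst[where P = "\<lambda>y e. P (s e) y", OF this assms(3)] show ?thesis .
qed

lemma definable_comp3:
  assumes "definable (\<lambda>e. P (e 0) (e 1) (e 2))" "definable_term s" "definable_term t" "definable_term u"
  shows "definable (\<lambda>e. P (s e) (t e) (u e))"
proof -
  have "definable (\<lambda>e. P (s (\<lambda>n. e (Suc (Suc n)))) (e 0) (e 1))"
    by (rule definable_subst[where P = "\<lambda>x e. P x (e 0) (e 1)"])
      (use assms definable_term_shift[OF definable_term_shift] in \<open>auto simp: numeral_2_eq_2\<close>)
  then have "definable (\<lambda>e. P (s (\<lambda>n. e (Suc n))) (t (\<lambda>n. e (Suc n))) (e 0))"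
    by (intro definable_subst[where P = "\<lambda>x e. P (s (\<lambda>n. e (Suc n))) x (e 0)"])
      (use assms definable_term_shift in auto)
  from definable_subst[where P = "\<lambda>y e. P (s e) (t e) y", OF this assms(4)] show ?thesis .
qed

lemma definable_mem [definable_intros]:
  "definable_term s \<Longrightarrow> definable_term t \<Longrightarrow> definable (\<lambda>e. s e \<in>\<^sub>M t e)"
  by (rule definable_comp2[where P = "\<lambda>x y. x \<in>\<^sub>M y", OF definable_mem_var])

lemma definable_eq [definable_intros]:
  "definable_term s \<Longrightarrow> definable_term t \<Longrightarrow> definable (\<lambda>e. s e = t e)"
  by (rule definable_comp2[where P = "\<lambda>x y. x = y", OF definable_eq_var])

lemma definable_ex1 [definable_intros]:
  "definable (\<lambda>e. Q (\<lambda>n. e (Suc n)) (e 0)) \<Longrightarrow> definable (\<lambda>e. \<exists>!y. Q e y)"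
proof (rule definable_iff_eq[of "\<lambda>e. \<exists>y. \<forall>z. Q e z \<longleftrightarrow> z = y"])
  assume "definable (\<lambda>e. Q (\<lambda>n. e (Suc n)) (e 0))"
  from definable_rename[OF this, where g = "\<lambda>n. case n of 0 \<Rightarrow> 0 | Suc k \<Rightarrow> Suc (Suc k)"]
  have "definable (\<lambda>e. Q (\<lambda>n. e (Suc (Suc n))) (e 0))"
    by (simp add: inj_def split: nat.splits)
  then show "definable (\<lambda>e. \<exists>y. \<forall>z. Q e z \<longleftrightarrow> z = y)"
    by (intro definable_intros)
qed metis

lemma definable_const: "definable (\<lambda>e. b)"
proof (cases b)
  case True
  have "definable (\<lambda>e. e 0 = e 0)" by (rule definable_eq_var)
  with True show ?thesis by simp
next
  case False
  have "definable (\<lambda>e. \<not> e 0 = e 0)" by (intro definable_intros)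
  with False show ?thesis by simp
qed

lemma definable_term_comp1:
  assumes "definable (\<lambda>e. e 0 = f (e 1))" "definable_term s"
  shows "definable_term (\<lambda>e. f (s e))"
  unfolding definable_term_def
  using definable_comp2[where P = "\<lambda>x y. x = f y", OF assms(1) definable_term_var definable_term_shift[OF assms(2)]] .

lemma definable_term_comp2:
  assumes "definable (\<lambda>e. e 0 = f (e 1) (e 2))" "definable_term s" "definable_term t"
  shows "definable_term (\<lambda>e. f (s e) (t e))"
  unfolding definable_term_def
  using definable_comp3[where P = "\<lambda>x y z. x = f y z", OF assms(1) definable_term_var
      definable_term_shift[OF assms(2)] definable_term_shift[OF assms(3)]] .

text \<open>Every free variable except index 0 is turned into a parameter with its value in
  \<open>a\<close>, which is interleaved with the old parameters. This allows separation to be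
  applied under a fixed assignment.\<close>

lemma definable_fix:
  assumes "definable (\<lambda>e. P (\<lambda>n. e (Suc n)) (e 0))"
  shows "definable (\<lambda>e. P a (e 0))"
proof -
  obtain p c where p: "\<And>e j. sat mem (mix e c j) p \<longleftrightarrow> P (\<lambda>n. e (Suc n)) (e 0)"
    using assms unfolding definable_def by blast
  define f where "f n = (if n = 0 then 0 else if n mod 3 = 0 then 2 * n - 5
    else if n mod 3 = 1 then 6 * (n div 3) + 4 else n)" for n :: nat
  define d where "d n = (if even n then a (n div 2) else c (n div 2))" for n
  have f_simps: "f (3 * q) = (case q of 0 \<Rightarrow> 3 * 0 | Suc r \<Rightarrow> 3 * (2 * r) + 1)"
    "f (3 * q + 1) = 3 * (2 * q + 1) + 1" "f (3 * q + 2) = 3 * q + 2" for q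
    by (auto simp: f_def dvd_eq_mod_eq_0 split: nat.split)
  have parity: "3 * (2 * r) + 1 \<noteq> 3 * (2 * q + 1) + 1" for r q :: nat
    by presburger
  have "inj f"
  proof (rule injI)
    fix x y assume "f x = f y"
    then show "x = y"
      by (cases x rule: mod3_cases; cases y rule: mod3_cases; simp only: f_simps)
        (auto split: nat.splits simp: parity parity[symmetric] | presburger)+
  qed
  moreover have "(mix e d j \<circ> f) n = mix (case_nat (e 0) a) c j n" for e j n
  proof (cases n rule: mod3_cases)
    case (1 q)
    then show ?thesis
      by (cases q) (simp_all only: comp_def f_simps mix_simps nat.case, simp_all add: d_def)
  qed (simp_all only: comp_def f_simps mix_simps, simp_all add: d_def)
  then have "mix e d j \<circ> f = mix (case_nat (e 0) a) c j" for e j by auto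
  ultimately have "sat mem (mix e d j) (rename_fm f p) \<longleftrightarrow> P a (e 0)" for e j
    by (simp add: sat_rename_fm p)
  then show ?thesis unfolding definable_def by blast
qed

end

section \<open>Sets, ordinals and natural numbers of the model\<close>

context universe
begin

definition sep :: "'m \<Rightarrow> ('m \<Rightarrow> bool) \<Rightarrow> 'm" where
  "sep a P = cset (\<lambda>x. x \<in>\<^sub>M a \<and> P x)"

text \<open>Unlike \<open>ap f x\<close>, this is definable without any assumption on \<open>f\<close> and \<open>x\<close>.\<close>

definition val :: "'m \<Rightarrow> 'm \<Rightarrow> 'm" where
  "val f x = cset (\<lambda>z. \<exists>y. pair x y \<in>\<^sub>M f \<and> z \<in>\<^sub>M y)"

definition cup :: "'m \<Rightarrow> 'm \<Rightarrow> 'm" where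
  "cup a b = cset (\<lambda>x. x \<in>\<^sub>M a \<or> x \<in>\<^sub>M b)"

definition bigcup :: "'m \<Rightarrow> 'm" where
  "bigcup a = cset (\<lambda>x. \<exists>y. y \<in>\<^sub>M a \<and> x \<in>\<^sub>M y)"

definition Power :: "'m \<Rightarrow> 'm" where
  "Power a = cset (\<lambda>x. subs x a)"

end

context zf_model
begin

lemma set_eqI: "(\<And>x. x \<in>\<^sub>M a \<longleftrightarrow> x \<in>\<^sub>M b) \<Longrightarrow> a = b"
  using extensionality by blast

lemma eq_iff_mem: "(\<And>x. x \<in>\<^sub>M t \<longleftrightarrow> Q x) \<Longrightarrow> (\<forall>x. x \<in>\<^sub>M a \<longleftrightarrow> Q x) \<longleftrightarrow> a = t"
  using set_eqI[of a t] by blast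

lemma mem_csetI: "\<forall>x. x \<in>\<^sub>M b \<longleftrightarrow> P x \<Longrightarrow> x \<in>\<^sub>M cset P \<longleftrightarrow> P x"
  unfolding cset_def
  by (rule theI2[where a = b and P = "\<lambda>z. \<forall>x. x \<in>\<^sub>M z \<longleftrightarrow> P x"]) (auto intro: set_eqI)

lemma mem_cset: "\<exists>b. \<forall>x. x \<in>\<^sub>M b \<longleftrightarrow> P x \<Longrightarrow> x \<in>\<^sub>M cset P \<longleftrightarrow> P x"
  using mem_csetI by blast

lemma separation_definable:
  assumes "definable (\<lambda>e. P (e 0))"
  shows "\<exists>b. \<forall>x. x \<in>\<^sub>M b \<longleftrightarrow> x \<in>\<^sub>M a \<and> P x"
proof -
  obtain p c where p: "\<And>e j. sat (\<in>\<^sub>M) (mix e c j) p \<longleftrightarrow> P (e 0)"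
    using assms unfolding definable_def by blast
  have "(mix e c e)(0 := x) = mix (e(0 := x)) c e" for e x
    by (auto simp: mix_def fun_eq_iff)
  then have "sat (\<in>\<^sub>M) ((mix e c e)(0 := x)) p \<longleftrightarrow> P x" for e x
    by (simp add: p)
  then show ?thesis using separation[of a "mix c c c" p] by simp
qed

lemma replacement_definable:
  assumes "definable (\<lambda>e. R (e 0) (e 1))" and "\<And>x. x \<in>\<^sub>M a \<Longrightarrow> \<exists>!y. R x y"
  shows "\<exists>b. \<forall>y. y \<in>\<^sub>M b \<longleftrightarrow> (\<exists>x. x \<in>\<^sub>M a \<and> R x y)"
proof -
  obtain p c where p: "\<And>e j. sat (\<in>\<^sub>M) (mix e c j) p \<longleftrightarrow> R (e 0) (e 1)"
    using assms(1) unfolding definable_def by blast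
  \<comment> \<open>The replacement scheme puts the output at name 1, which is a parameter slot of
    \<open>mix\<close>, while the second free variable has name 3; \<open>s\<close> exchanges the
    two.\<close>
  define s :: "nat \<Rightarrow> nat" where "s = id(1 := 3, 3 := 1)"
  have s: "inj s" by (auto simp: s_def inj_def)
  have "((mix c c c \<circ> s)(0 := x, 1 := y)) \<circ> s = mix (c(0 := x, 1 := y)) c c" for x y
    by (auto simp: mix_def fun_eq_iff s_def)
  then have "sat (\<in>\<^sub>M) ((mix c c c \<circ> s)(0 := x, 1 := y)) (rename_fm s p) \<longleftrightarrow> R x y" for x y
    by (simp add: sat_rename_fm[OF s] p del: fun_upd_apply) simp
  then show ?thesis
    using replacement[of a "mix c c c \<circ> s" "rename_fm s p"] assms(2) by simp
qed

lemma mem_cset_bounded: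
  assumes "definable (\<lambda>e. P (e 0))" "\<And>x. P x \<Longrightarrow> x \<in>\<^sub>M a"
  shows "x \<in>\<^sub>M cset P \<longleftrightarrow> P x"
  using separation_definable[OF assms(1), of a] assms(2) by (intro mem_cset) metis

lemma mem_sep: "definable (\<lambda>e. P (e 0)) \<Longrightarrow> x \<in>\<^sub>M sep a P \<longleftrightarrow> x \<in>\<^sub>M a \<and> P x"
  unfolding sep_def by (rule mem_cset) (rule separation_definable)

lemma definable_term_cset:
  assumes "definable (\<lambda>e. P (\<lambda>n. e (Suc n)) (e 0))"
    and "\<And>e x. x \<in>\<^sub>M cset (P e) \<longleftrightarrow> P e x"
  shows "definable_term (\<lambda>e. cset (P e))"
proof -
  have "definable (\<lambda>e. P (\<lambda>n. e (Suc (Suc n))) (e 0))"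
    using definable_rename[OF assms(1), where g = "\<lambda>n. case n of 0 \<Rightarrow> 0 | Suc k \<Rightarrow> Suc (Suc k)"]
    by (simp add: inj_def split: nat.splits)
  then have "definable (\<lambda>e. \<forall>x. x \<in>\<^sub>M e 0 \<longleftrightarrow> P (\<lambda>n. e (Suc n)) x)"
    by (intro definable_intros)
  then show ?thesis unfolding definable_term_def
    by (rule definable_iff_eq) (metis assms(2) set_eqI)
qed

lemma definable_term_sep [definable_intros]:
  assumes "definable_term a" "definable (\<lambda>e. P (\<lambda>n. e (Suc n)) (e 0))"
  shows "definable_term (\<lambda>e. sep (a e) (P e))"
proof -
  have "x \<in>\<^sub>M cset (\<lambda>x. x \<in>\<^sub>M a e \<and> P e x) \<longleftrightarrow> x \<in>\<^sub>M a e \<and> P e x" for e x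
    using mem_sep[of "P e" x "a e"] definable_fix[OF assms(2)] by (simp add: sep_def)
  then show ?thesis
    unfolding sep_def
    by (intro definable_term_cset definable_and definable_mem definable_term_shift[OF assms(1)] assms(2)
        definable_term_var)
qed

lemma mem_empty [simp]: "\<not> x \<in>\<^sub>M empty"
  using mem_cset_bounded[where P = "\<lambda>x. False", OF definable_const] by (simp add: empty_def)

lemma mem_upair [simp]: "x \<in>\<^sub>M upair a b \<longleftrightarrow> x = a \<or> x = b"
  unfolding upair_def by (rule mem_cset) (rule pairing)

lemma mem_sing [simp]: "x \<in>\<^sub>M sing a \<longleftrightarrow> x = a"
  by (simp add: sing_def)

lemma mem_bigcup [simp]: "x \<in>\<^sub>M bigcup a \<longleftrightarrow> (\<exists>y. y \<in>\<^sub>M a \<and> x \<in>\<^sub>M y)"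
  unfolding bigcup_def by (rule mem_cset) (rule union)

lemma mem_Power [simp]: "x \<in>\<^sub>M Power a \<longleftrightarrow> subs x a"
  unfolding Power_def by (rule mem_cset) (use powerset in \<open>simp add: subs_def\<close>)

lemma mem_cup [simp]: "x \<in>\<^sub>M cup a b \<longleftrightarrow> x \<in>\<^sub>M a \<or> x \<in>\<^sub>M b"
  unfolding cup_def
  by (rule mem_csetI[of "bigcup (upair a b)"]) auto

lemma mem_succ [simp]: "x \<in>\<^sub>M succ a \<longleftrightarrow> x \<in>\<^sub>M a \<or> x = a"
  unfolding succ_def
  by (rule mem_csetI[of "cup a (sing a)"]) auto

lemma upair_eq_iff: "upair a b = upair c d \<longleftrightarrow> a = c \<and> b = d \<or> a = d \<and> b = c"
proof
  assume h: "upair a b = upair c d"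
  have "x = a \<or> x = b \<longleftrightarrow> x = c \<or> x = d" for x
    using mem_upair[of x a b] mem_upair[of x c d] h by simp
  then show "a = c \<and> b = d \<or> a = d \<and> b = c" by metis
qed (auto simp: upair_def disj_commute)

lemma pair_eq_iff [simp]: "pair a b = pair c d \<longleftrightarrow> a = c \<and> b = d"
  unfolding pair_def sing_def upair_eq_iff by auto

lemma definable_subs_vars: "definable (\<lambda>e. subs (e 0) (e 1))"
  unfolding subs_def by (intro definable_intros)

lemmas definable_subs [definable_intros] = definable_comp2[where P = subs, OF definable_subs_vars]

lemma definable_term_upair [definable_intros]:
  "definable_term s \<Longrightarrow> definable_term t \<Longrightarrow> definable_term (\<lambda>e. upair (s e) (t e))"
proof (rule definable_term_comp2[where f = upair])
  show "definable (\<lambda>e. e 0 = upair (e 1) (e 2))"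
    by (rule definable_iff_eq[of "\<lambda>e. \<forall>x. x \<in>\<^sub>M e 0 \<longleftrightarrow> x = e 1 \<or> x = e 2"])
      (intro definable_intros, intro eq_iff_mem, simp)
qed

lemma definable_term_sing [definable_intros]:
  "definable_term s \<Longrightarrow> definable_term (\<lambda>e. sing (s e))"
  unfolding sing_def by (intro definable_intros)

lemma definable_term_pair [definable_intros]:
  "definable_term s \<Longrightarrow> definable_term t \<Longrightarrow> definable_term (\<lambda>e. pair (s e) (t e))"
  unfolding pair_def by (intro definable_intros)

lemma definable_term_succ [definable_intros]:
  "definable_term s \<Longrightarrow> definable_term (\<lambda>e. succ (s e))"
proof (rule definable_term_comp1[where f = succ])
  show "definable (\<lambda>e. e 0 = succ (e 1))"
    by (rule definable_iff_eq[of "\<lambda>e. \<forall>x. x \<in>\<^sub>M e 0 \<longleftrightarrow> x \<in>\<^sub>M e 1 \<or> x = e 1"])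
      (intro definable_intros, intro eq_iff_mem, simp)
qed

lemma definable_term_cup [definable_intros]:
  "definable_term s \<Longrightarrow> definable_term t \<Longrightarrow> definable_term (\<lambda>e. cup (s e) (t e))"
proof (rule definable_term_comp2[where f = cup])
  show "definable (\<lambda>e. e 0 = cup (e 1) (e 2))"
    by (rule definable_iff_eq[of "\<lambda>e. \<forall>x. x \<in>\<^sub>M e 0 \<longleftrightarrow> x \<in>\<^sub>M e 1 \<or> x \<in>\<^sub>M e 2"])
      (intro definable_intros, intro eq_iff_mem, simp)
qed

lemma mem_times [simp]: "z \<in>\<^sub>M times X Y \<longleftrightarrow> (\<exists>x y. x \<in>\<^sub>M X \<and> y \<in>\<^sub>M Y \<and> z = pair x y)"
  unfolding times_def
proof (rule mem_cset_bounded[where a = "Power (Power (cup X Y))"])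
  show "definable (\<lambda>e. \<exists>x y. x \<in>\<^sub>M X \<and> y \<in>\<^sub>M Y \<and> e 0 = pair x y)"
    by (intro definable_intros)
qed (auto simp: subs_def pair_def)

lemma definable_term_times [definable_intros]:
  "definable_term s \<Longrightarrow> definable_term t \<Longrightarrow> definable_term (\<lambda>e. times (s e) (t e))"
proof (rule definable_term_comp2[where f = times])
  show "definable (\<lambda>e. e 0 = times (e 1) (e 2))"
    by (rule definable_iff_eq[of "\<lambda>e. \<forall>z. z \<in>\<^sub>M e 0 \<longleftrightarrow> (\<exists>x y. x \<in>\<^sub>M e 1 \<and> y \<in>\<^sub>M e 2 \<and> z = pair x y)"])
      (intro definable_intros, intro eq_iff_mem, simp)
qed

lemma pair_in_bigcup: "pair x y \<in>\<^sub>M f \<Longrightarrow> x \<in>\<^sub>M bigcup (bigcup f)" "pair x y \<in>\<^sub>M f \<Longrightarrow> y \<in>\<^sub>M bigcup (bigcup f)"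
  unfolding mem_bigcup pair_def using mem_upair by blast+

lemma mem_val: "z \<in>\<^sub>M val f x \<longleftrightarrow> (\<exists>y. pair x y \<in>\<^sub>M f \<and> z \<in>\<^sub>M y)"
  unfolding val_def
proof (rule mem_cset_bounded[where a = "bigcup (bigcup (bigcup f))"])
  show "definable (\<lambda>e. \<exists>y. pair x y \<in>\<^sub>M f \<and> e 0 \<in>\<^sub>M y)"
    by (intro definable_intros)
qed (metis mem_bigcup pair_in_bigcup(2))

lemma definable_term_val [definable_intros]:
  "definable_term s \<Longrightarrow> definable_term t \<Longrightarrow> definable_term (\<lambda>e. val (s e) (t e))"
proof (rule definable_term_comp2[where f = val])
  show "definable (\<lambda>e. e 0 = val (e 1) (e 2))"
    by (rule definable_iff_eq[of "\<lambda>e. \<forall>z. z \<in>\<^sub>M e 0 \<longleftrightarrow> (\<exists>y. pair (e 2) y \<in>\<^sub>M e 1 \<and> z \<in>\<^sub>M y)"])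
      (intro definable_intros, intro eq_iff_mem, simp add: mem_val)
qed

lemma val_eq: "\<exists>!y. pair x y \<in>\<^sub>M f \<Longrightarrow> pair x y \<in>\<^sub>M f \<Longrightarrow> val f x = y"
  by (rule set_eqI) (auto simp: mem_val)

lemma ap_eq: "\<exists>!y. pair x y \<in>\<^sub>M f \<Longrightarrow> pair x y \<in>\<^sub>M f \<Longrightarrow> ap f x = y"
  unfolding ap_def by (rule the1_equality)

lemma func_on_ap: "func_on f X \<Longrightarrow> x \<in>\<^sub>M X \<Longrightarrow> pair x y \<in>\<^sub>M f \<longleftrightarrow> ap f x = y"
  unfolding func_on_def using ap_eq by metis

lemma func_on_val: "func_on f X \<Longrightarrow> x \<in>\<^sub>M X \<Longrightarrow> val f x = ap f x"
  by (metis func_on_ap func_on_def val_eq)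

lemma definable_func_on_vars: "definable (\<lambda>e. func_on (e 0) (e 1))"
  unfolding func_on_def by (intro definable_intros)

lemmas definable_func_on [definable_intros] = definable_comp2[where P = func_on, OF definable_func_on_vars]

lemma func_val: "func f X Y \<longleftrightarrow> func_on f X \<and> (\<forall>x. x \<in>\<^sub>M X \<longrightarrow> val f x \<in>\<^sub>M Y)"
  unfolding func_def using func_on_val by metis

lemma definable_func_vars: "definable (\<lambda>e. func (e 0) (e 1) (e 2))"
  unfolding func_val by (intro definable_intros)

lemmas definable_func [definable_intros] = definable_comp3[where P = func, OF definable_func_vars]

lemma func_onI:
  assumes "\<And>z. z \<in>\<^sub>M f \<Longrightarrow> \<exists>x. x \<in>\<^sub>M X \<and> z = pair x (g x)" "\<And>x. x \<in>\<^sub>M X \<Longrightarrow> pair x (g x) \<in>\<^sub>M f"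
  shows "func_on f X"
  unfolding func_on_def
proof (intro conjI allI impI)
  fix x assume "x \<in>\<^sub>M X"
  then show "\<exists>!y. pair x y \<in>\<^sub>M f"
    by (intro ex1I[of _ "g x"]) (use assms in fastforce)+
qed (use assms in blast)

lemma foundation_definable:
  assumes "definable (\<lambda>e. P (e 0))" "x \<in>\<^sub>M a" "P x"
  shows "\<exists>x. x \<in>\<^sub>M a \<and> P x \<and> (\<forall>y. y \<in>\<^sub>M x \<longrightarrow> y \<in>\<^sub>M a \<longrightarrow> \<not> P y)"
  using foundation[of "sep a P"] assms by (auto simp: mem_sep)

lemma mem_irrefl [simp]: "\<not> x \<in>\<^sub>M x"
  using foundation[of "sing x"] by auto

lemma mem_asym: "x \<in>\<^sub>M y \<Longrightarrow> \<not> y \<in>\<^sub>M x"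
  using foundation[of "upair x y"] by auto

lemma succ_eq_iff [simp]: "succ a = succ b \<longleftrightarrow> a = b"
proof
  assume "succ a = succ b"
  then have "a \<in>\<^sub>M succ b" "b \<in>\<^sub>M succ a" using mem_succ[of a a] mem_succ[of b b] by simp_all
  then show "a = b" using mem_asym by auto
qed simp

lemma succ_neq_empty [simp]: "succ a \<noteq> empty" "empty \<noteq> succ a"
  using mem_succ[of a a] mem_empty[of a] by metis+

lemma definable_transitive_var: "definable (\<lambda>e. transitive (e 0))"
  unfolding transitive_def by (intro definable_intros)

lemmas definable_transitive [definable_intros] = definable_comp1[where P = transitive, OF definable_transitive_var]

lemma definable_ordinal_var: "definable (\<lambda>e. ordinal (e 0))"
  unfolding ordinal_def by (intro definable_intros)

lemmas definable_ordinal [definable_intros] = definable_comp1[where P = ordinal, OF definable_ordinal_var]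

lemma ordinal_mem: "ordinal a \<Longrightarrow> x \<in>\<^sub>M a \<Longrightarrow> ordinal x"
  unfolding ordinal_def transitive_def subs_def by blast

lemma ordinal_trans: "ordinal a \<Longrightarrow> x \<in>\<^sub>M a \<Longrightarrow> y \<in>\<^sub>M x \<Longrightarrow> y \<in>\<^sub>M a"
  unfolding ordinal_def transitive_def subs_def by blast

lemma ordinal_succ: "ordinal a \<Longrightarrow> ordinal (succ a)"
  unfolding ordinal_def transitive_def subs_def mem_succ by blast

text \<open>Two nested minimal choices: \<open>x\<close> is minimal among those with an incomparable
  partner, then \<open>y\<close> is minimal among the partners of \<open>x\<close>. Minimality
  forces \<open>x\<close> and \<open>y\<close> to have the same elements.\<close>

lemma ordinal_linear:
  assumes a: "ordinal a" and b: "ordinal b"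
  shows "a \<in>\<^sub>M b \<or> a = b \<or> b \<in>\<^sub>M a"
proof (rule ccontr)
  define inc where "inc x y \<longleftrightarrow> \<not> (x \<in>\<^sub>M y \<or> x = y \<or> y \<in>\<^sub>M x)" for x y
  assume "\<not> ?thesis"
  then have "\<exists>y. y \<in>\<^sub>M succ b \<and> inc a y" by (auto simp: inc_def)
  moreover have "definable (\<lambda>e. \<exists>y. y \<in>\<^sub>M succ b \<and> inc (e 0) y)"
    unfolding inc_def by (intro definable_intros)
  ultimately obtain x where x: "x \<in>\<^sub>M succ a" "\<exists>y. y \<in>\<^sub>M succ b \<and> inc x y"
    and xmin: "\<And>z y. z \<in>\<^sub>M x \<Longrightarrow> z \<in>\<^sub>M succ a \<Longrightarrow> y \<in>\<^sub>M succ b \<Longrightarrow> \<not> inc z y"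
    using foundation_definable[where P = "\<lambda>x. \<exists>y. y \<in>\<^sub>M succ b \<and> inc x y" and x = a and a = "succ a"]
    by auto
  have "definable (\<lambda>e. inc x (e 0))"
    unfolding inc_def by (intro definable_intros)
  then obtain y where y: "y \<in>\<^sub>M succ b" "inc x y"
    and ymin: "\<And>z. z \<in>\<^sub>M y \<Longrightarrow> z \<in>\<^sub>M succ b \<Longrightarrow> \<not> inc x z"
    using foundation_definable[where P = "inc x" and a = "succ b"] x(2) by blast
  have "ordinal x" "ordinal y" using x(1) y(1) ordinal_mem ordinal_succ a b by blast+
  have "z \<in>\<^sub>M y" if "z \<in>\<^sub>M x" for z
  proof -
    have "z \<in>\<^sub>M succ a" using that x(1) ordinal_trans ordinal_succ a by blast
    then have "\<not> inc z y" using xmin that y(1) by blast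
    then show ?thesis using that y(2) \<open>ordinal x\<close> ordinal_trans unfolding inc_def by blast
  qed
  moreover have "z \<in>\<^sub>M x" if "z \<in>\<^sub>M y" for z
  proof -
    have "z \<in>\<^sub>M succ b" using that y(1) ordinal_trans ordinal_succ b by blast
    then have "\<not> inc x z" using ymin that by blast
    then show ?thesis using that y(2) \<open>ordinal y\<close> ordinal_trans unfolding inc_def by blast
  qed
  ultimately have "x = y" by (intro set_eqI) blast
  then show False using y(2) by (simp add: inc_def)
qed

lemma least_ordinal:
  assumes P: "definable (\<lambda>e. P (e 0))" and "P a" and ord: "\<And>x. P x \<Longrightarrow> ordinal x"
  shows "\<exists>!x. P x \<and> (\<forall>y. y \<in>\<^sub>M x \<longrightarrow> \<not> P y)"
proof -
  obtain x where x: "x \<in>\<^sub>M succ a" "P x" "\<forall>y. y \<in>\<^sub>M x \<longrightarrow> y \<in>\<^sub>M succ a \<longrightarrow> \<not> P y"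
    using foundation_definable[OF P, of a "succ a"] \<open>P a\<close> by auto
  then have "\<forall>y. y \<in>\<^sub>M x \<longrightarrow> \<not> P y"
    using ordinal_trans ordinal_succ[OF ord[OF \<open>P a\<close>]] by blast
  then show ?thesis using x(2) ordinal_linear ord by metis
qed

lemma definable_natural_var: "definable (\<lambda>e. natural (e 0))"
  unfolding natural_def by (intro definable_intros)

lemmas definable_natural [definable_intros] = definable_comp1[where P = natural, OF definable_natural_var]

lemma natural_zero [simp]: "natural zero"
  by (auto simp: natural_def zero_def ordinal_def transitive_def)

lemma natural_succ [simp]: "natural n \<Longrightarrow> natural (succ n)"
  by (auto simp: natural_def intro: ordinal_succ)

lemma natural_mem: "natural n \<Longrightarrow> k \<in>\<^sub>M n \<Longrightarrow> natural k"
  unfolding natural_def using ordinal_mem ordinal_trans by metis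

lemma natural_induct [consumes 2, case_names zero succ]:
  assumes P: "definable (\<lambda>e. P (e 0))" and "natural n"
    and zero: "P zero" and succ: "\<And>k. natural k \<Longrightarrow> P k \<Longrightarrow> P (succ k)"
  shows "P n"
proof (rule ccontr)
  assume "\<not> P n"
  moreover have "definable (\<lambda>e. \<not> P (e 0))" by (intro definable_intros P)
  ultimately obtain x where x: "x \<in>\<^sub>M succ n" "\<not> P x" "\<forall>y. y \<in>\<^sub>M x \<longrightarrow> y \<in>\<^sub>M succ n \<longrightarrow> P y"
    using foundation_definable[where P = "\<lambda>x. \<not> P x" and x = n and a = "succ n"] by auto
  then have nat: "natural x" using \<open>natural n\<close> natural_mem natural_succ by blast
  show False
  proof (cases "x = zero")
    case False
    then obtain j where j: "x = succ j" using nat unfolding natural_def by blast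
    then have "j \<in>\<^sub>M x" by simp
    moreover have "j \<in>\<^sub>M succ n"
      using calculation x(1) \<open>natural n\<close> ordinal_trans natural_succ unfolding natural_def by blast
    ultimately show False using x succ[of j] natural_mem[OF nat] j by blast
  qed (use x zero in simp)
qed

lemma mem_omega [simp]: "n \<in>\<^sub>M omega \<longleftrightarrow> natural n"
proof -
  obtain a z where z: "z \<in>\<^sub>M a" "\<forall>x. \<not> x \<in>\<^sub>M z"
    and s: "\<And>x. x \<in>\<^sub>M a \<Longrightarrow> \<exists>y. y \<in>\<^sub>M a \<and> (\<forall>z. z \<in>\<^sub>M y \<longleftrightarrow> z \<in>\<^sub>M x \<or> z = x)"
    using infinity by blast
  have "zero = z" unfolding zero_def by (rule set_eqI) (use z in simp)
  moreover have "succ x \<in>\<^sub>M a" if "x \<in>\<^sub>M a" for x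
  proof -
    obtain y where y: "y \<in>\<^sub>M a" "\<forall>z. z \<in>\<^sub>M y \<longleftrightarrow> z \<in>\<^sub>M x \<or> z = x" using s[OF \<open>x \<in>\<^sub>M a\<close>] by blast
    have "y = succ x" by (rule set_eqI) (simp add: y(2))
    then show ?thesis using y(1) by simp
  qed
  ultimately have "n \<in>\<^sub>M a" if "natural n" for n
    using natural_induct[where P = "\<lambda>x. x \<in>\<^sub>M a" and n = n] that z(1) by (simp add: definable_intros)
  then show ?thesis
    unfolding omega_def by (intro mem_cset_bounded definable_intros)
qed

end

section \<open>Iteration and transfinite generation\<close>

context zf_model
begin

text \<open>Recursion along the naturals of the model. Only the range of the sequence is kept,
  together with its induction principle; a function that acts on pairs can carry further data
  along.\<close>

lemma iteration_set:
  assumes F: "definable (\<lambda>e. e 0 = F (e 1))"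
  obtains T where "a \<in>\<^sub>M T" "\<And>x. x \<in>\<^sub>M T \<Longrightarrow> F x \<in>\<^sub>M T"
    "\<And>P x. definable (\<lambda>e. P (e 0)) \<Longrightarrow> P a \<Longrightarrow> (\<And>x. x \<in>\<^sub>M T \<Longrightarrow> P x \<Longrightarrow> P (F x)) \<Longrightarrow> x \<in>\<^sub>M T \<Longrightarrow> P x"
proof -
  \<comment> \<open>A trace is only required to justify each of its entries by an earlier one. It
    need not be a function or have a prescribed domain, so adding one justified entry preserves the
    condition.\<close>
  define tr where "tr s \<longleftrightarrow> (\<forall>w. pair zero w \<in>\<^sub>M s \<longrightarrow> w = a) \<and>
    (\<forall>k w. pair (succ k) w \<in>\<^sub>M s \<longrightarrow> (\<exists>v. pair k v \<in>\<^sub>M s \<and> w = F v))" for s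
  define R where "R n v \<longleftrightarrow> (\<exists>s. pair n v \<in>\<^sub>M s \<and> tr s)" for n v
  have DF: "definable_term t \<Longrightarrow> definable_term (\<lambda>e. F (t e))" for t
    using definable_term_comp1[OF F] .
  have DR: "definable (\<lambda>e. R (s e) (t e))" if "definable_term s" "definable_term t" for s t
  proof (rule definable_comp2[OF _ that])
    show "definable (\<lambda>e. R (e 0) (e 1))"
      unfolding R_def tr_def by (intro definable_intros DF)
  qed
  have R_zero: "R zero w \<longleftrightarrow> w = a" for w
  proof
    show "R zero w" if "w = a"
      unfolding R_def tr_def
      by (rule exI[of _ "sing (pair zero a)"]) (simp add: that zero_def)
  qed (auto simp: R_def tr_def)
  have R_succ: "R (succ n) w \<longleftrightarrow> (\<exists>v. R n v \<and> w = F v)" for n w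
  proof
    assume "\<exists>v. R n v \<and> w = F v"
    then obtain v s where s: "pair n v \<in>\<^sub>M s" "tr s" "w = F v" unfolding R_def by blast
    then have "tr (cup s (sing (pair (succ n) w)))"
      unfolding tr_def by (auto simp: zero_def) blast+
    then show "R (succ n) w" unfolding R_def by (intro exI[of _ "cup s (sing (pair (succ n) w))"]) simp
  next
    assume "R (succ n) w"
    then show "\<exists>v. R n v \<and> w = F v" unfolding R_def tr_def by metis
  qed
  have R_unique: "\<exists>!v. R n v" if "natural n" for n
    using _ that
  proof (induction n rule: natural_induct)
    show "definable (\<lambda>e. \<exists>!v. R (e 0) v)" by (intro definable_intros DR)
    show "\<exists>!v. R zero v" by (simp add: R_zero)
    show "\<exists>!v. R (succ k) v" if "\<exists>!v. R k v" for k
      using that by (auto simp: R_succ)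
  qed
  obtain T where T: "\<And>v. v \<in>\<^sub>M T \<longleftrightarrow> (\<exists>n. natural n \<and> R n v)"
    using replacement_definable[where R = R and a = omega, OF DR[OF definable_term_var definable_term_var]]
      R_unique by (simp, blast)
  show thesis
  proof
    show "a \<in>\<^sub>M T" unfolding T using R_zero natural_zero by blast
    show "F x \<in>\<^sub>M T" if "x \<in>\<^sub>M T" for x
      using that unfolding T using R_succ natural_succ by metis
  next
    fix P x
    assume P: "definable (\<lambda>e. P (e 0))" "P a" "\<And>x. x \<in>\<^sub>M T \<Longrightarrow> P x \<Longrightarrow> P (F x)" and "x \<in>\<^sub>M T"
    then obtain n where n: "natural n" "R n x" unfolding T by blast
    have "\<forall>v. R n v \<longrightarrow> P v"
      using _ n(1)
    proof (induction n rule: natural_induct)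
      have "definable_term s \<Longrightarrow> definable (\<lambda>e. P (s e))" for s by (rule definable_comp1[OF P(1)])
      note DP = this
      show "definable (\<lambda>e. \<forall>v. R (e 0) v \<longrightarrow> P v)" by (intro definable_intros DR DP)
    qed (use P T in \<open>auto simp: R_zero R_succ\<close>)
    then show "P x" using n(2) by blast
  qed
qed

end

section \<open>Well-orders generated by a successor rule\<close>

context universe
begin

text \<open>The relation is reflexive on its field, so that \<open>pair x x \<in>\<^sub>M r\<close>
  expresses membership in the field throughout.\<close>

definition wellorder :: "'m \<Rightarrow> bool" where
  "wellorder r \<longleftrightarrow>
     (\<forall>x y. pair x y \<in>\<^sub>M r \<longrightarrow> pair x x \<in>\<^sub>M r \<and> pair y y \<in>\<^sub>M r) \<and>
     (\<forall>x y. pair x y \<in>\<^sub>M r \<longrightarrow> pair y x \<in>\<^sub>M r \<longrightarrow> x = y) \<and>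
     (\<forall>x y z. pair x y \<in>\<^sub>M r \<longrightarrow> pair y z \<in>\<^sub>M r \<longrightarrow> pair x z \<in>\<^sub>M r) \<and>
     (\<forall>x y. pair x x \<in>\<^sub>M r \<longrightarrow> pair y y \<in>\<^sub>M r \<longrightarrow> pair x y \<in>\<^sub>M r \<or> pair y x \<in>\<^sub>M r) \<and>
     (\<forall>Z. (\<exists>x. x \<in>\<^sub>M Z) \<longrightarrow> (\<forall>x. x \<in>\<^sub>M Z \<longrightarrow> pair x x \<in>\<^sub>M r) \<longrightarrow>
        (\<exists>x. x \<in>\<^sub>M Z \<and> (\<forall>y. y \<in>\<^sub>M Z \<longrightarrow> pair x y \<in>\<^sub>M r)))"

text \<open>The restricted order, and not just the set of strict predecessors, because the successor
  rule \<open>nxt\<close> takes an order as its argument.\<close>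

definition below :: "'m \<Rightarrow> 'm \<Rightarrow> 'm" where
  "below r x = sep r (\<lambda>z. \<exists>u v. z = pair u v \<and> pair u x \<in>\<^sub>M r \<and> u \<noteq> x \<and> pair v x \<in>\<^sub>M r \<and> v \<noteq> x)"

text \<open>The well-orders of subsets of \<open>G\<close> that are obtained by adding \<open>nxt r\<close> on top of \<open>r\<close>.\<close>

definition generated :: "'m \<Rightarrow> ('m \<Rightarrow> 'm) \<Rightarrow> 'm \<Rightarrow> bool" where
  "generated G nxt r \<longleftrightarrow> wellorder r \<and> subs r (times G G) \<and>
     (\<forall>x. pair x x \<in>\<^sub>M r \<longrightarrow> x = nxt (below r x))"

definition initial_in :: "'m \<Rightarrow> 'm \<Rightarrow> bool" where
  "initial_in r r' \<longleftrightarrow> (\<forall>x y. pair y y \<in>\<^sub>M r \<longrightarrow> (pair x y \<in>\<^sub>M r \<longleftrightarrow> pair x y \<in>\<^sub>M r'))"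

end

context zf_model
begin

lemma wellorderD:
  assumes "wellorder r"
  shows "pair x y \<in>\<^sub>M r \<Longrightarrow> pair x x \<in>\<^sub>M r" "pair x y \<in>\<^sub>M r \<Longrightarrow> pair y y \<in>\<^sub>M r"
    "pair x y \<in>\<^sub>M r \<Longrightarrow> pair y x \<in>\<^sub>M r \<Longrightarrow> x = y"
    "pair x y \<in>\<^sub>M r \<Longrightarrow> pair y z \<in>\<^sub>M r \<Longrightarrow> pair x z \<in>\<^sub>M r"
    "pair x x \<in>\<^sub>M r \<Longrightarrow> pair y y \<in>\<^sub>M r \<Longrightarrow> pair x y \<in>\<^sub>M r \<or> pair y x \<in>\<^sub>M r"
    "x \<in>\<^sub>M Z \<Longrightarrow> (\<And>x. x \<in>\<^sub>M Z \<Longrightarrow> pair x x \<in>\<^sub>M r) \<Longrightarrow> \<exists>x. x \<in>\<^sub>M Z \<and> (\<forall>y. y \<in>\<^sub>M Z \<longrightarrow> pair x y \<in>\<^sub>M r)"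
proof -
  note w = assms[unfolded wellorder_def]
  show "pair x y \<in>\<^sub>M r \<Longrightarrow> pair x x \<in>\<^sub>M r" "pair x y \<in>\<^sub>M r \<Longrightarrow> pair y y \<in>\<^sub>M r"
    using w[THEN conjunct1] by blast+
  show "pair x y \<in>\<^sub>M r \<Longrightarrow> pair y x \<in>\<^sub>M r \<Longrightarrow> x = y"
    using w[THEN conjunct2, THEN conjunct1] by blast
  show "pair x y \<in>\<^sub>M r \<Longrightarrow> pair y z \<in>\<^sub>M r \<Longrightarrow> pair x z \<in>\<^sub>M r"
    using w[THEN conjunct2, THEN conjunct2, THEN conjunct1] by blast
  show "pair x x \<in>\<^sub>M r \<Longrightarrow> pair y y \<in>\<^sub>M r \<Longrightarrow> pair x y \<in>\<^sub>M r \<or> pair y x \<in>\<^sub>M r"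
    using w[THEN conjunct2, THEN conjunct2, THEN conjunct2, THEN conjunct1] by blast
  show "x \<in>\<^sub>M Z \<Longrightarrow> (\<And>x. x \<in>\<^sub>M Z \<Longrightarrow> pair x x \<in>\<^sub>M r) \<Longrightarrow> \<exists>x. x \<in>\<^sub>M Z \<and> (\<forall>y. y \<in>\<^sub>M Z \<longrightarrow> pair x y \<in>\<^sub>M r)"
    using w[THEN conjunct2, THEN conjunct2, THEN conjunct2, THEN conjunct2] by blast
qed

lemma wellorder_least:
  assumes r: "wellorder r" and P: "definable (\<lambda>e. P (e 0))" and "P a"
    and fld: "\<And>x. P x \<Longrightarrow> pair x x \<in>\<^sub>M r"
  shows "\<exists>!x. P x \<and> (\<forall>y. P y \<longrightarrow> pair x y \<in>\<^sub>M r)"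
proof -
  have "x \<in>\<^sub>M cset P \<longleftrightarrow> P x" for x
    using fld pair_in_bigcup by (intro mem_cset_bounded[OF P, where a = "bigcup (bigcup r)"]) blast
  then obtain x where "P x" "\<forall>y. P y \<longrightarrow> pair x y \<in>\<^sub>M r"
    using wellorderD(6)[OF r, of a "cset P"] \<open>P a\<close> fld by auto
  then show ?thesis using wellorderD(3)[OF r] by blast
qed

lemma wellorder_leastE:
  assumes "wellorder r" "definable (\<lambda>e. P (e 0))" "P a" "\<And>x. P x \<Longrightarrow> pair x x \<in>\<^sub>M r"
  obtains x where "P x" "\<And>y. P y \<Longrightarrow> pair x y \<in>\<^sub>M r"
  using wellorder_least[OF assms] by blast

lemma definable_wellorder_var: "definable (\<lambda>e. wellorder (e 0))"
  unfolding wellorder_def by (intro definable_intros)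

lemmas definable_wellorder [definable_intros] = definable_comp1[where P = wellorder, OF definable_wellorder_var]

lemma definable_term_below [definable_intros]:
  "definable_term s \<Longrightarrow> definable_term t \<Longrightarrow> definable_term (\<lambda>e. below (s e) (t e))"
proof (rule definable_term_comp2[where f = below])
  show "definable (\<lambda>e. e 0 = below (e 1) (e 2))"
    unfolding below_def by (intro definable_intros)
qed

lemma mem_below: "z \<in>\<^sub>M below r x \<longleftrightarrow>
    z \<in>\<^sub>M r \<and> (\<exists>u v. z = pair u v \<and> pair u x \<in>\<^sub>M r \<and> u \<noteq> x \<and> pair v x \<in>\<^sub>M r \<and> v \<noteq> x)"
  unfolding below_def by (rule mem_sep) (intro definable_intros)

lemma pair_mem_below: "pair u v \<in>\<^sub>M below r x \<longleftrightarrow>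
    pair u v \<in>\<^sub>M r \<and> pair u x \<in>\<^sub>M r \<and> u \<noteq> x \<and> pair v x \<in>\<^sub>M r \<and> v \<noteq> x"
  unfolding mem_below by auto

lemma below_eqI:
  assumes "\<And>u v. pair u v \<in>\<^sub>M below r x \<longleftrightarrow> pair u v \<in>\<^sub>M below r' x'"
  shows "below r x = below r' x'"
proof (rule set_eqI)
  fix z
  show "z \<in>\<^sub>M below r x \<longleftrightarrow> z \<in>\<^sub>M below r' x'"
    using assms mem_below[of z r x] mem_below[of z r' x'] by metis
qed

text \<open>Predecessors of \<open>y\<close> other than \<open>x\<close> are strict predecessors of
  \<open>x\<close>, where the two orders coincide by hypothesis.\<close>

lemma below_initial:
  assumes "wellorder r" "wellorder r'" "below r x = below r' x" "pair x x \<in>\<^sub>M r" "pair x x \<in>\<^sub>M r'"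
    and y: "pair y x \<in>\<^sub>M r"
  shows "pair y x \<in>\<^sub>M r'" "below r y = below r' y"
proof -
  note w = wellorderD[OF assms(1)] and w' = wellorderD[OF assms(2)]
  have eq: "pair u v \<in>\<^sub>M below r x \<longleftrightarrow> pair u v \<in>\<^sub>M below r' x" for u v using assms(3) by simp
  show yx': "pair y x \<in>\<^sub>M r'"
  proof (cases "y = x")
    case False
    then show ?thesis using eq[of y y] w(1) y unfolding pair_mem_below by blast
  qed (use assms in simp)
  show "below r y = below r' y"
  proof (cases "y = x")
    case False
    have 1: "pair u x \<in>\<^sub>M r \<and> u \<noteq> x" if "pair u y \<in>\<^sub>M r" for u
      using that w(3,4) False y by blast
    have 2: "pair u x \<in>\<^sub>M r' \<and> u \<noteq> x" if "pair u y \<in>\<^sub>M r'" for u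
      using that w'(3,4) False yx' by blast
    have 3: "pair u y \<in>\<^sub>M r \<longleftrightarrow> pair u y \<in>\<^sub>M r'" for u
    proof
      assume "pair u y \<in>\<^sub>M r"
      then have "pair u y \<in>\<^sub>M below r x" using 1[of u] y False by (simp add: pair_mem_below)
      then have "pair u y \<in>\<^sub>M below r' x" by (simp only: eq)
      then show "pair u y \<in>\<^sub>M r'" by (simp add: pair_mem_below)
    next
      assume "pair u y \<in>\<^sub>M r'"
      then have "pair u y \<in>\<^sub>M below r' x" using 2[of u] yx' False by (simp add: pair_mem_below)
      then have "pair u y \<in>\<^sub>M below r x" by (simp only: eq)
      then show "pair u y \<in>\<^sub>M r" by (simp add: pair_mem_below)
    qed
    have 4: "pair u v \<in>\<^sub>M r \<longleftrightarrow> pair u v \<in>\<^sub>M r'" if "pair u y \<in>\<^sub>M r" "pair v y \<in>\<^sub>M r" for u v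
      using eq[of u v] 1[OF that(1)] 1[OF that(2)] 2[of u] 2[of v] 3 that by (simp add: pair_mem_below)
    show ?thesis
      by (rule below_eqI) (use 3 4 in \<open>auto simp: pair_mem_below\<close>)
  qed (use assms in simp)
qed

text \<open>The common part \<open>I\<close> is initial in both orders. If it exhausted neither, the
  least elements \<open>x\<close> and \<open>x'\<close> outside it would have the same order below
  them; both are \<open>nxt\<close> of that order, so they would be equal and belong to
  \<open>I\<close>.\<close>

lemma generated_comparable:
  assumes "generated G nxt r" "generated G nxt r'"
  shows "initial_in r r' \<or> initial_in r' r"
proof (rule ccontr)
  assume neg: "\<not> ?thesis"
  have wo: "wellorder r" "wellorder r'" and
    nxt: "\<And>x. pair x x \<in>\<^sub>M r \<Longrightarrow> x = nxt (below r x)" "\<And>x. pair x x \<in>\<^sub>M r' \<Longrightarrow> x = nxt (below r' x)"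
    using assms unfolding generated_def by blast+
  note w = wellorderD[OF wo(1)] and w' = wellorderD[OF wo(2)]
  define I where "I x \<longleftrightarrow> pair x x \<in>\<^sub>M r \<and> pair x x \<in>\<^sub>M r' \<and> below r x = below r' x" for x
  have DI: "definable (\<lambda>e. I (e 0))" unfolding I_def by (intro definable_intros)
  have down: "I y \<and> pair y x \<in>\<^sub>M r'" if "I x" "pair y x \<in>\<^sub>M r" for x y
    using below_initial[OF wo, of x y] that w(1) w'(1) unfolding I_def by blast
  have down': "I y \<and> pair y x \<in>\<^sub>M r" if "I x" "pair y x \<in>\<^sub>M r'" for x y
    using below_initial[OF wo(2,1), of x y] that w(1) w'(1) unfolding I_def by metis
  have D: "definable (\<lambda>e. pair (e 0) (e 0) \<in>\<^sub>M q \<and> \<not> I (e 0))" for q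
    by (intro definable_intros DI)
  obtain a a' where a: "pair a a \<in>\<^sub>M r" "\<not> I a" "pair a' a' \<in>\<^sub>M r'" "\<not> I a'"
    using neg down down' unfolding initial_in_def by blast
  obtain x where x: "pair x x \<in>\<^sub>M r" "\<not> I x" "\<And>y. pair y y \<in>\<^sub>M r \<Longrightarrow> \<not> I y \<Longrightarrow> pair x y \<in>\<^sub>M r"
    by (rule wellorder_leastE[where P = "\<lambda>x. pair x x \<in>\<^sub>M r \<and> \<not> I x" and a = a, OF wo(1) D]) (use a in auto)
  obtain x' where x': "pair x' x' \<in>\<^sub>M r'" "\<not> I x'" "\<And>y. pair y y \<in>\<^sub>M r' \<Longrightarrow> \<not> I y \<Longrightarrow> pair x' y \<in>\<^sub>M r'"
    by (rule wellorder_leastE[where P = "\<lambda>x. pair x x \<in>\<^sub>M r' \<and> \<not> I x" and a = a', OF wo(2) D]) (use a in auto)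
  have 1: "pair u x \<in>\<^sub>M r \<and> u \<noteq> x \<longleftrightarrow> I u" for u
  proof
    assume "pair u x \<in>\<^sub>M r \<and> u \<noteq> x"
    then show "I u" using x(3)[of u] w(1,3) by blast
  next
    assume "I u"
    then show "pair u x \<in>\<^sub>M r \<and> u \<noteq> x" using down[of u x] x(1,2) w(5)[of u x] unfolding I_def by blast
  qed
  have 2: "pair u x' \<in>\<^sub>M r' \<and> u \<noteq> x' \<longleftrightarrow> I u" for u
  proof
    assume "pair u x' \<in>\<^sub>M r' \<and> u \<noteq> x'"
    then show "I u" using x'(3)[of u] w'(1,3) by blast
  next
    assume "I u"
    then show "pair u x' \<in>\<^sub>M r' \<and> u \<noteq> x'" using down'[of u x'] x'(1,2) w'(5)[of u x'] unfolding I_def by blast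
  qed
  have "below r x = below r' x'"
  proof (rule below_eqI)
    fix u v
    show "pair u v \<in>\<^sub>M below r x \<longleftrightarrow> pair u v \<in>\<^sub>M below r' x'"
      using 1[of u] 1[of v] 2[of u] 2[of v] down[of v u] down'[of v u] unfolding pair_mem_below by blast
  qed
  then have "x = x'" "below r x = below r' x" using nxt x(1) x'(1) by metis+
  then show False using x x' unfolding I_def by blast
qed

text \<open>Zermelo's argument: comparability makes the union \<open>U\<close> of all generated
  orders generated again, and if \<open>nxt U\<close> were an element of \<open>G\<close> outside
  the field, adding it on top would yield a larger generated order. The bound \<open>G\<close>
  ensures that the generated orders form a set.\<close>

lemma transfinite_generation:
  assumes nxt: "definable (\<lambda>e. e 0 = nxt (e 1))"
  obtains r where "wellorder r" "subs r (times G G)" "nxt r \<in>\<^sub>M G \<Longrightarrow> pair (nxt r) (nxt r) \<in>\<^sub>M r"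
proof -
  have D: "definable (\<lambda>e. generated G nxt (e 0))"
    unfolding generated_def by (intro definable_intros definable_term_comp1[OF nxt])
  define C where "C = sep (Power (times G G)) (generated G nxt)"
  define U where "U = bigcup C"
  have memU: "z \<in>\<^sub>M U \<longleftrightarrow> (\<exists>r. generated G nxt r \<and> z \<in>\<^sub>M r)" for z
    by (auto simp: U_def C_def mem_sep[OF D] generated_def)
  have initU: "initial_in r U" if "generated G nxt r" for r
    unfolding initial_in_def
  proof (intro allI impI iffI)
    fix x y assume y: "pair y y \<in>\<^sub>M r" and "pair x y \<in>\<^sub>M U"
    then obtain r' where r': "generated G nxt r'" "pair x y \<in>\<^sub>M r'" unfolding memU by blast
    moreover then have "pair y y \<in>\<^sub>M r'" unfolding generated_def using wellorderD(2) by blast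
    ultimately show "pair x y \<in>\<^sub>M r"
      using generated_comparable[OF that r'(1)] y unfolding initial_in_def by blast
  qed (use that in \<open>auto simp: memU\<close>)
  have up: "\<exists>r. generated G nxt r \<and> pair x x \<in>\<^sub>M r \<and> pair y y \<in>\<^sub>M r"
    if "pair x x \<in>\<^sub>M U" "pair y y \<in>\<^sub>M U" for x y
    using that generated_comparable unfolding memU initial_in_def by metis
  have refl: "pair x x \<in>\<^sub>M U \<and> pair y y \<in>\<^sub>M U" if "pair x y \<in>\<^sub>M U" for x y
    using that unfolding memU generated_def using wellorderD(1,2) by metis
  have inr: "pair x y \<in>\<^sub>M r \<longleftrightarrow> pair x y \<in>\<^sub>M U" if "generated G nxt r" "pair y y \<in>\<^sub>M r" for r x y
    using initU that unfolding initial_in_def by blast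
  have wo: "generated G nxt r \<Longrightarrow> wellorder r" for r unfolding generated_def by blast
  have "wellorder U"
    unfolding wellorder_def
  proof (intro conjI allI impI)
    fix x y z
    show "pair x x \<in>\<^sub>M U" "pair y y \<in>\<^sub>M U" if "pair x y \<in>\<^sub>M U" using refl that by blast+
    show "x = y" if "pair x y \<in>\<^sub>M U" "pair y x \<in>\<^sub>M U"
      using that up[of x y] refl inr wo wellorderD(3) by metis
    show "pair x z \<in>\<^sub>M U" if "pair x y \<in>\<^sub>M U" "pair y z \<in>\<^sub>M U"
      using that up[of z y] refl[of x y] refl[of y z] inr wo wellorderD(4) by metis
    show "pair x y \<in>\<^sub>M U \<or> pair y x \<in>\<^sub>M U" if "pair x x \<in>\<^sub>M U" "pair y y \<in>\<^sub>M U"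
      using that up[of x y] inr wo wellorderD(5) by metis
  next
    fix Z assume Z: "\<exists>x. x \<in>\<^sub>M Z" "\<forall>x. x \<in>\<^sub>M Z \<longrightarrow> pair x x \<in>\<^sub>M U"
    then obtain z r where z: "z \<in>\<^sub>M Z" and r: "generated G nxt r" "pair z z \<in>\<^sub>M r" unfolding memU by blast
    have D: "definable (\<lambda>e. e 0 \<in>\<^sub>M Z \<and> pair (e 0) (e 0) \<in>\<^sub>M r)" by (intro definable_intros)
    obtain m where m: "m \<in>\<^sub>M Z" "pair m m \<in>\<^sub>M r" "\<And>y. y \<in>\<^sub>M Z \<Longrightarrow> pair y y \<in>\<^sub>M r \<Longrightarrow> pair m y \<in>\<^sub>M r"
      by (rule wellorder_leastE[where P = "\<lambda>x. x \<in>\<^sub>M Z \<and> pair x x \<in>\<^sub>M r" and a = z, OF wo[OF r(1)] D]) (use z r(2) in auto)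
    have "pair m y \<in>\<^sub>M U" if y: "y \<in>\<^sub>M Z" for y
    proof (cases "pair y y \<in>\<^sub>M r")
      case True
      then show ?thesis using m(3) y inr r(1) by blast
    next
      case False
      obtain r' where r': "generated G nxt r'" "pair m m \<in>\<^sub>M r'" "pair y y \<in>\<^sub>M r'"
        using up[of m y] Z(2) m(1) y by blast
      have "\<not> pair y m \<in>\<^sub>M r'" using False inr[OF r'(1,2), of y] inr[OF r(1) m(2), of y] wellorderD(1)[OF wo[OF r(1)]] by blast
      then show ?thesis using wellorderD(5)[OF wo[OF r'(1)] r'(2,3)] inr[OF r'(1,3)] by blast
    qed
    then show "\<exists>x. x \<in>\<^sub>M Z \<and> (\<forall>y. y \<in>\<^sub>M Z \<longrightarrow> pair x y \<in>\<^sub>M U)" using m(1) by blast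
  qed
  note w = wellorderD[OF this]
  have subU: "subs U (times G G)"
    unfolding subs_def memU generated_def by blast
  have nxtU: "x = nxt (below U x)" if x: "pair x x \<in>\<^sub>M U" for x
  proof -
    obtain r where r: "generated G nxt r" "pair x x \<in>\<^sub>M r" using x unfolding memU by blast
    have "below U x = below r x"
      using below_initial(2)[OF wo[OF r(1)] \<open>wellorder U\<close>, of x x]
      by (intro below_eqI) (use inr[OF r(1)] r(2) wellorderD(1)[OF wo[OF r(1)]] in \<open>unfold pair_mem_below, metis\<close>)
    then show ?thesis using r unfolding generated_def by metis
  qed
  have "pair (nxt U) (nxt U) \<in>\<^sub>M U" if "nxt U \<in>\<^sub>M G"
  proof (rule ccontr)
    define n where "n = nxt U"
    assume "\<not> pair (nxt U) (nxt U) \<in>\<^sub>M U"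
    then have n: "\<not> pair x n \<in>\<^sub>M U" "\<not> pair n x \<in>\<^sub>M U" for x using refl unfolding n_def by blast+
    \<comment> \<open>\<open>U\<close> with \<open>n\<close> as a new greatest element; the order
      below \<open>n\<close> in it is \<open>U\<close> itself, so the rule \<open>nxt\<close> holds
      at \<open>n\<close>.\<close>
    define V where "V = cup U (sep (times G (sing n)) (\<lambda>z. \<exists>x. z = pair x n \<and> (pair x x \<in>\<^sub>M U \<or> x = n)))"
    have "definable (\<lambda>e. \<exists>x. e 0 = pair x n \<and> (pair x x \<in>\<^sub>M U \<or> x = n))"
      by (intro definable_intros)
    then have "z \<in>\<^sub>M V \<longleftrightarrow> z \<in>\<^sub>M U \<or> (\<exists>x. z = pair x n \<and> (pair x x \<in>\<^sub>M U \<or> x = n))" for z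
      using that subU unfolding V_def n_def[symmetric] by (fastforce simp: mem_sep subs_def)
    then have V: "pair x y \<in>\<^sub>M V \<longleftrightarrow> pair x y \<in>\<^sub>M U \<or> y = n \<and> (pair x x \<in>\<^sub>M U \<or> x = n)" for x y by auto
    have "wellorder V"
      unfolding wellorder_def
    proof (intro conjI allI impI)
      fix x y z
      show "pair x x \<in>\<^sub>M V" "pair y y \<in>\<^sub>M V" if "pair x y \<in>\<^sub>M V" using that refl unfolding V by blast+
      show "x = y" if "pair x y \<in>\<^sub>M V" "pair y x \<in>\<^sub>M V" using that w(3) n unfolding V by blast
      show "pair x z \<in>\<^sub>M V" if "pair x y \<in>\<^sub>M V" "pair y z \<in>\<^sub>M V" using that w(4) refl n unfolding V by blast
      show "pair x y \<in>\<^sub>M V \<or> pair y x \<in>\<^sub>M V" if "pair x x \<in>\<^sub>M V" "pair y y \<in>\<^sub>M V"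
        using that w(5) n unfolding V by blast
    next
      fix Z assume Z: "\<exists>x. x \<in>\<^sub>M Z" "\<forall>x. x \<in>\<^sub>M Z \<longrightarrow> pair x x \<in>\<^sub>M V"
      show "\<exists>x. x \<in>\<^sub>M Z \<and> (\<forall>y. y \<in>\<^sub>M Z \<longrightarrow> pair x y \<in>\<^sub>M V)"
      proof (cases "\<exists>x. x \<in>\<^sub>M Z \<and> pair x x \<in>\<^sub>M U")
        case True
        then obtain z where z: "z \<in>\<^sub>M Z" "pair z z \<in>\<^sub>M U" by blast
        have D: "definable (\<lambda>e. e 0 \<in>\<^sub>M Z \<and> pair (e 0) (e 0) \<in>\<^sub>M U)" by (intro definable_intros)
        obtain m where m: "m \<in>\<^sub>M Z" "pair m m \<in>\<^sub>M U" "\<And>y. y \<in>\<^sub>M Z \<Longrightarrow> pair y y \<in>\<^sub>M U \<Longrightarrow> pair m y \<in>\<^sub>M U"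
          by (rule wellorder_leastE[where P = "\<lambda>x. x \<in>\<^sub>M Z \<and> pair x x \<in>\<^sub>M U" and a = z, OF \<open>wellorder U\<close> D]) (use z in auto)
        then show ?thesis using Z(2) unfolding V by blast
      next
        case False
        then show ?thesis using Z unfolding V by blast
      qed
    qed
    moreover have "subs V (times G G)"
      using subU that unfolding V_def n_def[symmetric]
      by (auto simp: subs_def mem_sep definable_intros)
    moreover have "x = nxt (below V x)" if "pair x x \<in>\<^sub>M V" for x
    proof (cases "pair x x \<in>\<^sub>M U")
      case True
      then have "below V x = below U x"
        by (intro below_eqI) (unfold pair_mem_below V, use n refl in blast)
      then show ?thesis using nxtU True by simp
    next
      case False
      then have x: "x = n" using that V by blast
      have "below V x = U"
      proof (rule set_eqI)
        fix z
        show "z \<in>\<^sub>M below V x \<longleftrightarrow> z \<in>\<^sub>M U"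
        proof
          assume "z \<in>\<^sub>M below V x"
          then show "z \<in>\<^sub>M U" unfolding mem_below x using V n by auto
        next
          assume z: "z \<in>\<^sub>M U"
          then obtain u v where "z = pair u v" using subU by (auto simp: subs_def)
          then show "z \<in>\<^sub>M below V x" using z n refl by (auto simp: pair_mem_below V x)
        qed
      qed
      then show ?thesis by (simp add: x n_def)
    qed
    ultimately have "generated G nxt V" unfolding generated_def by blast
    then have "pair n n \<in>\<^sub>M U" using V memU by blast
    then show False using n by blast
  qed
  then show thesis using that \<open>wellorder U\<close> subU by blast
qed

end

section \<open>Well-ordering constructible sets\<close>

context universe
begin

text \<open>This and the following operations restate the closure conditions of
  \<open>def_closed\<close> with \<open>sep\<close> and \<open>val\<close> in place of
  \<open>cset\<close> and \<open>ap\<close>, which makes them definable terms.\<close>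

definition assignments :: "'m \<Rightarrow> 'm" where
  "assignments A = sep (Power (times omega A)) (\<lambda>s. func s omega A)"

definition rel_mem :: "'m \<Rightarrow> 'm \<Rightarrow> 'm \<Rightarrow> 'm" where
  "rel_mem A m n = sep (assignments A) (\<lambda>s. val s m \<in>\<^sub>M val s n)"

definition rel_eq :: "'m \<Rightarrow> 'm \<Rightarrow> 'm \<Rightarrow> 'm" where
  "rel_eq A m n = sep (assignments A) (\<lambda>s. val s m = val s n)"

definition rel_const :: "'m \<Rightarrow> 'm \<Rightarrow> 'm \<Rightarrow> 'm" where
  "rel_const A m x = sep (assignments A) (\<lambda>s. val s m = x)"

text \<open>A single connective takes the place of complement and intersection, so that fewer
  generating operations have to be enumerated.\<close>

definition rel_nand :: "'m \<Rightarrow> 'm \<Rightarrow> 'm \<Rightarrow> 'm" where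
  "rel_nand A R S = sep (assignments A) (\<lambda>s. \<not> (s \<in>\<^sub>M R \<and> s \<in>\<^sub>M S))"

definition rel_ex :: "'m \<Rightarrow> 'm \<Rightarrow> 'm \<Rightarrow> 'm" where
  "rel_ex A m R = sep (assignments A) (\<lambda>s. \<exists>t. t \<in>\<^sub>M assignments A \<and> t \<in>\<^sub>M R \<and>
     (\<forall>n. natural n \<longrightarrow> n \<noteq> m \<longrightarrow> val t n = val s n))"

definition rel_code :: "'m \<Rightarrow> 'm \<Rightarrow> 'm" where
  "rel_code A X = sep (assignments A) (\<lambda>s. val s zero \<in>\<^sub>M X)"

lemma definable_comp4:
  assumes "definable (\<lambda>e. P (e 0) (e 1) (e 2) (e 3))"
    "definable_term s" "definable_term t" "definable_term u" "definable_term v"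
  shows "definable (\<lambda>e. P (s e) (t e) (u e) (v e))"
proof -
  note sh = definable_term_shift and sh2 = definable_term_shift[OF definable_term_shift]
  have "definable (\<lambda>e. P (s (\<lambda>n. e (Suc (Suc (Suc n))))) (e 0) (e 1) (e 2))"
    by (rule definable_subst[where P = "\<lambda>x e. P x (e 0) (e 1) (e 2)"])
      (use assms(1) sh2[OF sh[OF assms(2)]] in \<open>auto simp: numeral_2_eq_2 numeral_3_eq_3\<close>)
  then have "definable (\<lambda>e. P (s (\<lambda>n. e (Suc (Suc n)))) (t (\<lambda>n. e (Suc (Suc n)))) (e 0) (e 1))"
    by (intro definable_subst[where P = "\<lambda>x e. P (s (\<lambda>n. e (Suc (Suc n)))) x (e 0) (e 1)"])
      (use sh2[OF assms(3)] in \<open>auto simp: numeral_2_eq_2\<close>)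
  then have "definable (\<lambda>e. P (s (\<lambda>n. e (Suc n))) (t (\<lambda>n. e (Suc n))) (u (\<lambda>n. e (Suc n))) (e 0))"
    by (intro definable_subst[where P = "\<lambda>x e. P (s (\<lambda>n. e (Suc n))) (t (\<lambda>n. e (Suc n))) x (e 0)"])
      (use sh[OF assms(4)] in auto)
  from definable_subst[where P = "\<lambda>y e. P (s e) (t e) (u e) y", OF this assms(5)] show ?thesis .
qed

lemma definable_term_comp3:
  assumes "definable_term (\<lambda>e. f (e 0) (e 1) (e 2))" "definable_term s" "definable_term t" "definable_term u"
  shows "definable_term (\<lambda>e. f (s e) (t e) (u e))"
proof -
  have "definable (\<lambda>e. e 0 = f (e 1) (e 2) (e 3))"
    using assms(1) unfolding definable_term_def by (simp add: numeral_2_eq_2 numeral_3_eq_3)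
  from definable_comp4[where P = "\<lambda>w x y z. w = f x y z", OF this definable_term_var
      definable_term_shift[OF assms(2)] definable_term_shift[OF assms(3)] definable_term_shift[OF assms(4)]]
  show ?thesis unfolding definable_term_def .
qed

definition definable_rel :: "'m \<Rightarrow> 'm \<Rightarrow> bool" where
  "definable_rel A R \<longleftrightarrow> (\<forall>D. def_closed A D \<longrightarrow> R \<in>\<^sub>M D)"

end

context zf_model
begin

lemma definable_term_Power [definable_intros]:
  "definable_term s \<Longrightarrow> definable_term (\<lambda>e. Power (s e))"
proof (rule definable_term_comp1[where f = Power])
  show "definable (\<lambda>e. e 0 = Power (e 1))"
    by (rule definable_iff_eq[of "\<lambda>e. \<forall>x. x \<in>\<^sub>M e 0 \<longleftrightarrow> subs x (e 1)"])
      (intro definable_intros, intro eq_iff_mem, simp)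
qed

lemma mem_assignments: "s \<in>\<^sub>M assignments A \<longleftrightarrow> func s omega A"
proof -
  have "z \<in>\<^sub>M times omega A" if s: "func s omega A" and z: "z \<in>\<^sub>M s" for z
  proof -
    obtain x y where xy: "x \<in>\<^sub>M omega" "z = pair x y"
      using s z unfolding func_def func_on_def by blast
    then have "ap s x = y" using s z func_on_ap unfolding func_def by blast
    then show ?thesis using s xy unfolding func_def by auto
  qed
  then show ?thesis
    unfolding assignments_def by (subst mem_sep) (auto intro!: definable_intros simp: subs_def)
qed

lemma definable_term_assignments [definable_intros]:
  "definable_term s \<Longrightarrow> definable_term (\<lambda>e. assignments (s e))"
proof (rule definable_term_comp1[where f = assignments])
  show "definable (\<lambda>e. e 0 = assignments (e 1))"
    unfolding assignments_def by (intro definable_intros)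
qed

lemma definable_terms_rel_vars:
  "definable_term (\<lambda>e. rel_mem (e 0) (e 1) (e 2))" "definable_term (\<lambda>e. rel_eq (e 0) (e 1) (e 2))"
  "definable_term (\<lambda>e. rel_const (e 0) (e 1) (e 2))" "definable_term (\<lambda>e. rel_nand (e 0) (e 1) (e 2))"
  "definable_term (\<lambda>e. rel_ex (e 0) (e 1) (e 2))"
  unfolding rel_mem_def rel_eq_def rel_const_def rel_nand_def rel_ex_def
  by (intro definable_intros)+

lemmas definable_terms_rel [definable_intros] =
  definable_term_comp3[where f = rel_mem, OF definable_terms_rel_vars(1)]
  definable_term_comp3[where f = rel_eq, OF definable_terms_rel_vars(2)]
  definable_term_comp3[where f = rel_const, OF definable_terms_rel_vars(3)]
  definable_term_comp3[where f = rel_nand, OF definable_terms_rel_vars(4)]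
  definable_term_comp3[where f = rel_ex, OF definable_terms_rel_vars(5)]

lemma definable_term_rel_code [definable_intros]:
  "definable_term s \<Longrightarrow> definable_term t \<Longrightarrow> definable_term (\<lambda>e. rel_code (s e) (t e))"
proof (rule definable_term_comp2[where f = rel_code])
  show "definable (\<lambda>e. e 0 = rel_code (e 1) (e 2))"
    unfolding rel_code_def by (intro definable_intros)
qed

lemma mem_rel:
  "s \<in>\<^sub>M rel_mem A m n \<longleftrightarrow> s \<in>\<^sub>M assignments A \<and> val s m \<in>\<^sub>M val s n"
  "s \<in>\<^sub>M rel_eq A m n \<longleftrightarrow> s \<in>\<^sub>M assignments A \<and> val s m = val s n"
  "s \<in>\<^sub>M rel_const A m x \<longleftrightarrow> s \<in>\<^sub>M assignments A \<and> val s m = x"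
  "s \<in>\<^sub>M rel_nand A R S \<longleftrightarrow> s \<in>\<^sub>M assignments A \<and> \<not> (s \<in>\<^sub>M R \<and> s \<in>\<^sub>M S)"
  "s \<in>\<^sub>M rel_ex A m R \<longleftrightarrow> s \<in>\<^sub>M assignments A \<and> (\<exists>t. t \<in>\<^sub>M assignments A \<and> t \<in>\<^sub>M R \<and>
     (\<forall>n. natural n \<longrightarrow> n \<noteq> m \<longrightarrow> val t n = val s n))"
  "s \<in>\<^sub>M rel_code A X \<longleftrightarrow> s \<in>\<^sub>M assignments A \<and> val s zero \<in>\<^sub>M X"
  unfolding rel_mem_def rel_eq_def rel_const_def rel_nand_def rel_ex_def rel_code_def
  by (rule mem_sep, intro definable_intros)+

lemma assigns_eqI:
  assumes "\<And>s. s \<in>\<^sub>M R \<longleftrightarrow> s \<in>\<^sub>M assignments A \<and> P' s" "\<And>s. func s omega A \<Longrightarrow> P s \<longleftrightarrow> P' s"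
  shows "assigns A P = R"
proof (rule set_eqI)
  fix s
  show "s \<in>\<^sub>M assigns A P \<longleftrightarrow> s \<in>\<^sub>M R"
    unfolding assigns_def
    by (subst mem_csetI[of R]) (use assms in \<open>auto simp: mem_assignments\<close>)
qed

lemma func_ap_val: "func s X Y \<Longrightarrow> x \<in>\<^sub>M X \<Longrightarrow> ap s x = val s x"
  unfolding func_def using func_on_val by metis

lemma assigns_rel:
  "natural m \<Longrightarrow> natural n \<Longrightarrow> assigns A (\<lambda>s. ap s m \<in>\<^sub>M ap s n) = rel_mem A m n"
  "natural m \<Longrightarrow> natural n \<Longrightarrow> assigns A (\<lambda>s. ap s m = ap s n) = rel_eq A m n"
  "natural m \<Longrightarrow> assigns A (\<lambda>s. ap s m = x) = rel_const A m x"
  "assigns A (\<lambda>s. \<not> s \<in>\<^sub>M R) = rel_nand A R R"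
  "assigns A (\<lambda>s. s \<in>\<^sub>M R \<and> s \<in>\<^sub>M S) = rel_nand A (rel_nand A R S) (rel_nand A R S)"
  "natural m \<Longrightarrow> assigns A (\<lambda>s. \<exists>t. func t omega A \<and> t \<in>\<^sub>M R \<and>
     (\<forall>n. n \<in>\<^sub>M omega \<longrightarrow> n \<noteq> m \<longrightarrow> ap t n = ap s n)) = rel_ex A m R"
  "assigns A (\<lambda>s. ap s zero \<in>\<^sub>M X) = rel_code A X"
proof -
  show "assigns A (\<lambda>s. s \<in>\<^sub>M R \<and> s \<in>\<^sub>M S) = rel_nand A (rel_nand A R S) (rel_nand A R S)"
    by (rule assigns_eqI[where P' = "\<lambda>s. s \<in>\<^sub>M R \<and> s \<in>\<^sub>M S"]) (auto simp: mem_rel)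
  show "assigns A (\<lambda>s. \<not> s \<in>\<^sub>M R) = rel_nand A R R"
    by (rule assigns_eqI[where P' = "\<lambda>s. \<not> s \<in>\<^sub>M R"]) (auto simp: mem_rel)
  show "natural m \<Longrightarrow> assigns A (\<lambda>s. \<exists>t. func t omega A \<and> t \<in>\<^sub>M R \<and>
     (\<forall>n. n \<in>\<^sub>M omega \<longrightarrow> n \<noteq> m \<longrightarrow> ap t n = ap s n)) = rel_ex A m R"
    by (rule assigns_eqI, rule mem_rel) (auto simp: mem_assignments func_ap_val)
qed (rule assigns_eqI, rule mem_rel, simp add: func_ap_val)+

lemma def_closed_rel: "def_closed A D \<longleftrightarrow>
    (\<forall>m n. natural m \<longrightarrow> natural n \<longrightarrow> rel_mem A m n \<in>\<^sub>M D \<and> rel_eq A m n \<in>\<^sub>M D) \<and>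
    (\<forall>m a. natural m \<longrightarrow> a \<in>\<^sub>M A \<longrightarrow> rel_const A m a \<in>\<^sub>M D) \<and>
    (\<forall>R. R \<in>\<^sub>M D \<longrightarrow> rel_nand A R R \<in>\<^sub>M D) \<and>
    (\<forall>R S. R \<in>\<^sub>M D \<longrightarrow> S \<in>\<^sub>M D \<longrightarrow> rel_nand A (rel_nand A R S) (rel_nand A R S) \<in>\<^sub>M D) \<and>
    (\<forall>m R. natural m \<longrightarrow> R \<in>\<^sub>M D \<longrightarrow> rel_ex A m R \<in>\<^sub>M D)"
  unfolding def_closed_def mem_omega by (simp add: assigns_rel[unfolded mem_omega] cong: conj_cong)

lemma definable_definable_rel [definable_intros]:
  "definable_term s \<Longrightarrow> definable_term t \<Longrightarrow> definable (\<lambda>e. definable_rel (s e) (t e))"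
proof (rule definable_comp2[where P = definable_rel])
  show "definable (\<lambda>e. definable_rel (e 0) (e 1))"
    unfolding definable_rel_def def_closed_rel by (intro definable_intros)
qed

lemma definable_relI:
  "natural m \<Longrightarrow> natural n \<Longrightarrow> definable_rel A (rel_mem A m n)"
  "natural m \<Longrightarrow> natural n \<Longrightarrow> definable_rel A (rel_eq A m n)"
  "natural m \<Longrightarrow> a \<in>\<^sub>M A \<Longrightarrow> definable_rel A (rel_const A m a)"
  "definable_rel A R \<Longrightarrow> definable_rel A S \<Longrightarrow> definable_rel A (rel_nand A R S)"
  "natural m \<Longrightarrow> definable_rel A R \<Longrightarrow> definable_rel A (rel_ex A m R)"
proof -
  \<comment> \<open>The closure conditions provide complements and intersections only; a plain nand
    is the complement of an intersection.\<close>
  have "rel_nand A (rel_nand A (rel_nand A R S) (rel_nand A R S)) (rel_nand A (rel_nand A R S) (rel_nand A R S)) = rel_nand A R S"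
    by (rule set_eqI) (auto simp: mem_rel)
  then have "rel_nand A R S \<in>\<^sub>M D" if "def_closed A D" "R \<in>\<^sub>M D" "S \<in>\<^sub>M D" for D
    using that unfolding def_closed_rel by metis
  then show "definable_rel A R \<Longrightarrow> definable_rel A S \<Longrightarrow> definable_rel A (rel_nand A R S)"
    unfolding definable_rel_def by blast
qed (simp_all add: definable_rel_def def_closed_rel)

lemma definable_rel_subs: "definable_rel A R \<Longrightarrow> subs R (assignments A)"
proof -
  assume "definable_rel A R"
  moreover have "def_closed A (Power (assignments A))"
    unfolding def_closed_rel by (auto simp: mem_rel subs_def)
  ultimately show ?thesis unfolding definable_rel_def by auto
qed

text \<open>The constant assignment with value \<open>x\<close> belongs to the code of a set exactly
  when \<open>x\<close> belongs to the set.\<close>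

lemma rel_code_inj:
  assumes "rel_code A X = rel_code A Y" "subs X A" "subs Y A"
  shows "X = Y"
proof (rule set_eqI)
  fix x
  have "x \<in>\<^sub>M X \<longleftrightarrow> x \<in>\<^sub>M Y" if "x \<in>\<^sub>M A"
  proof -
    define s where "s = times omega (sing x)"
    have fs: "func_on s omega" by (rule func_onI[where g = "\<lambda>_. x"]) (auto simp: s_def)
    have v: "val s n = x" if "natural n" for n
      using val_eq[of n s x] that by (auto simp: s_def)
    have "s \<in>\<^sub>M assignments A" using fs v that by (simp add: mem_assignments func_val)
    then have "x \<in>\<^sub>M Z \<longleftrightarrow> s \<in>\<^sub>M rel_code A Z" for Z by (simp add: mem_rel v)
    then show ?thesis using assms(1) by simp
  qed
  then show "x \<in>\<^sub>M X \<longleftrightarrow> x \<in>\<^sub>M Y" using assms(2,3) unfolding subs_def by blast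
qed

lemma definable_subset_code:
  "definable_subset A X \<longleftrightarrow> subs X A \<and> definable_rel A (rel_code A X)"
  unfolding definable_subset_def definable_rel_def assigns_rel ..

end

section \<open>Enumeration of the definable relations of all levels below \<open>c\<close>\<close>

context universe
begin

definition least_mem :: "('m \<Rightarrow> bool) \<Rightarrow> 'm \<Rightarrow> bool" where
  "least_mem P x \<longleftrightarrow> P x \<and> (\<forall>y. y \<in>\<^sub>M x \<longrightarrow> \<not> P y)"

definition least_in :: "'m \<Rightarrow> ('m \<Rightarrow> bool) \<Rightarrow> 'm \<Rightarrow> bool" where
  "least_in r P x \<longleftrightarrow> P x \<and> (\<forall>y. P y \<longrightarrow> pair x y \<in>\<^sub>M r)"

end

text \<open>\<open>A d\<close> is the \<open>d\<close>-th level of the constructible hierarchy, for \<open>d \<le> c\<close>.\<close>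

locale constructible_levels = zf_model mem
  for mem :: "'m \<Rightarrow> 'm \<Rightarrow> bool" (infix "\<in>\<^sub>M" 50) +
  fixes A :: "'m \<Rightarrow> 'm" and c :: 'm
  assumes A_definable: "definable (\<lambda>e. e 0 = A (e 1))"
    and ordinal_c: "ordinal c"
    and mem_A: "d \<in>\<^sub>M c \<or> d = c \<Longrightarrow> x \<in>\<^sub>M A d \<longleftrightarrow> (\<exists>d'. d' \<in>\<^sub>M d \<and> definable_subset (A d') x)"
begin

text \<open>A definable relation of level \<open>d\<close> is obtained by one of five operations, selected by \<open>k\<close> and
  \<open>n\<close>, from ordinals and from at most two relations that are given with their levels.\<close>

definition generates :: "'m \<Rightarrow> 'm \<Rightarrow> 'm \<Rightarrow> 'm \<Rightarrow> 'm \<Rightarrow> 'm \<Rightarrow> 'm \<Rightarrow> bool" where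
  "generates k d m n u v w \<longleftrightarrow>
     k = zero \<and> w = pair d (rel_mem (A d) m n) \<or>
     k = one \<and> w = pair d (rel_eq (A d) m n) \<or>
     k = two \<and> n = zero \<and> (\<exists>d' X. d' \<in>\<^sub>M d \<and> X \<in>\<^sub>M A d \<and> subs X (A d') \<and>
       u = pair d' (rel_code (A d') X) \<and> w = pair d (rel_const (A d) m X)) \<or>
     k = two \<and> n = one \<and> (\<exists>R S. u = pair d R \<and> v = pair d S \<and> w = pair d (rel_nand (A d) R S)) \<or>
     k = two \<and> n = two \<and> (\<exists>R. u = pair d R \<and> w = pair d (rel_ex (A d) m R))"

text \<open>The result has to be new and the relations \<open>u\<close>, \<open>v\<close> already
  listed, so that a description refers only to the order built so far.\<close>

definition candidate :: "'m \<Rightarrow> 'm \<Rightarrow> 'm \<Rightarrow> 'm \<Rightarrow> 'm \<Rightarrow> 'm \<Rightarrow> 'm \<Rightarrow> bool" where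
  "candidate r k d m n u v \<longleftrightarrow> natural k \<and> d \<in>\<^sub>M c \<and> natural m \<and> natural n \<and>
     pair u u \<in>\<^sub>M r \<and> pair v v \<in>\<^sub>M r \<and> (\<exists>w. generates k d m n u v w \<and> \<not> pair w w \<in>\<^sub>M r)"

text \<open>The lexicographically least candidate: the first four components are ordinals, compared
  by membership, and the last two are compared by \<open>r\<close> itself.\<close>

definition selected :: "'m \<Rightarrow> 'm \<Rightarrow> 'm \<Rightarrow> 'm \<Rightarrow> 'm \<Rightarrow> 'm \<Rightarrow> 'm \<Rightarrow> bool" where
  "selected r k d m n u v \<longleftrightarrow>
     least_mem (\<lambda>k. \<exists>d m n u v. candidate r k d m n u v) k \<and>
     least_mem (\<lambda>d. \<exists>m n u v. candidate r k d m n u v) d \<and>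
     least_mem (\<lambda>m. \<exists>n u v. candidate r k d m n u v) m \<and>
     least_mem (\<lambda>n. \<exists>u v. candidate r k d m n u v) n \<and>
     least_in r (\<lambda>u. \<exists>v. candidate r k d m n u v) u \<and>
     least_in r (\<lambda>v. candidate r k d m n u v) v"

text \<open>The dummy element \<open>c\<close> comes first, since \<open>u\<close> and \<open>v\<close> must range over a nonempty set.\<close>

definition next_to :: "'m \<Rightarrow> 'm \<Rightarrow> bool" where
  "next_to r w \<longleftrightarrow> (if pair c c \<in>\<^sub>M r
     then \<exists>k d m n u v. selected r k d m n u v \<and> generates k d m n u v w else w = c)"

text \<open>The value \<open>empty\<close> merely makes \<open>nxt\<close> a total definable
  function; the argument evaluates it only where a successor is determined.\<close>

definition nxt :: "'m \<Rightarrow> 'm" where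
  "nxt r = (if \<exists>!w. next_to r w then THE w. next_to r w else empty)"

definition relations :: 'm where
  "relations = cup (sing c) (sep (times c (Power (assignments (A c)))) (\<lambda>z. \<exists>d R. z = pair d R \<and> definable_rel (A d) R))"

lemma definable_term_A [definable_intros]: "definable_term s \<Longrightarrow> definable_term (\<lambda>e. A (s e))"
  using definable_term_comp1[OF A_definable] .

text \<open>Only the constants need an argument: \<open>u\<close> contains the code of the parameter
  \<open>X\<close>, which determines \<open>X\<close> by \<open>rel_code_inj\<close>.\<close>

lemma generates_unique: "generates k d m n u v w \<Longrightarrow> generates k d m n u v w' \<Longrightarrow> w = w'"
proof -
  have ne: "zero \<noteq> one" "one \<noteq> zero" "zero \<noteq> two" "two \<noteq> zero" "one \<noteq> two" "two \<noteq> one"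
    by (auto simp: zero_def one_def two_def)
  assume "generates k d m n u v w" "generates k d m n u v w'"
  then show "w = w'"
    unfolding generates_def
    by (elim disjE conjE exE) (simp_all add: ne, use rel_code_inj in blast)
qed

lemma least_mem_ex1:
  "definable (\<lambda>e. P (e 0)) \<Longrightarrow> (\<And>x. P x \<Longrightarrow> ordinal x) \<Longrightarrow> P a \<Longrightarrow> \<exists>!x. least_mem P x"
  unfolding least_mem_def by (rule least_ordinal)

lemma least_in_ex1:
  "definable (\<lambda>e. P (e 0)) \<Longrightarrow> wellorder r \<Longrightarrow> (\<And>x. P x \<Longrightarrow> pair x x \<in>\<^sub>M r) \<Longrightarrow> P a \<Longrightarrow> \<exists>!x. least_in r P x"
  unfolding least_in_def by (rule wellorder_least)

lemma candidate_ordinals: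
  assumes "candidate r k d m n u v"
  shows "ordinal k" "ordinal d" "ordinal m" "ordinal n" "pair u u \<in>\<^sub>M r" "pair v v \<in>\<^sub>M r"
proof -
  have "natural x \<Longrightarrow> ordinal x" for x by (simp add: natural_def)
  then show "ordinal k" "ordinal d" "ordinal m" "ordinal n" "pair u u \<in>\<^sub>M r" "pair v v \<in>\<^sub>M r"
    using assms ordinal_mem[OF ordinal_c, of d] by (simp_all add: candidate_def)
qed

lemma selected_unique:
  assumes r: "wellorder r" and s: "selected r k d m n u v" and s': "selected r k' d' m' n' u' v'"
  shows "k = k' \<and> d = d' \<and> m = m' \<and> n = n' \<and> u = u' \<and> v = v'"
proof -
  have eq: "x = y" if "least_mem P x" "least_mem P y" "\<And>x. P x \<Longrightarrow> ordinal x" for P x y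
    using that ordinal_linear unfolding least_mem_def by metis
  have eq': "x = y" if "least_in r P x" "least_in r P y" for P x y
    using that wellorderD(3)[OF r] unfolding least_in_def by blast
  note s = s[unfolded selected_def] and s' = s'[unfolded selected_def]
  have k: "k' = k" by (rule eq[OF s'[THEN conjunct1] s[THEN conjunct1]]) (elim exE, erule candidate_ordinals(1))
  note s' = s'[THEN conjunct2, unfolded k] and s = s[THEN conjunct2]
  have d: "d' = d" by (rule eq[OF s'[THEN conjunct1] s[THEN conjunct1]]) (elim exE, erule candidate_ordinals(2))
  note s' = s'[THEN conjunct2, unfolded d] and s = s[THEN conjunct2]
  have m: "m' = m" by (rule eq[OF s'[THEN conjunct1] s[THEN conjunct1]]) (elim exE, erule candidate_ordinals(3))
  note s' = s'[THEN conjunct2, unfolded m] and s = s[THEN conjunct2]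
  have n: "n' = n" by (rule eq[OF s'[THEN conjunct1] s[THEN conjunct1]]) (elim exE, erule candidate_ordinals(4))
  note s' = s'[THEN conjunct2, unfolded n] and s = s[THEN conjunct2]
  have u: "u' = u" by (rule eq'[OF s'[THEN conjunct1] s[THEN conjunct1]])
  note s' = s'[THEN conjunct2, unfolded u] and s = s[THEN conjunct2]
  have "v' = v" by (rule eq'[OF s' s])
  then show ?thesis using k d m n u by simp
qed

lemma selected_ex:
  assumes r: "wellorder r" and ex: "\<exists>k d m n u v. candidate r k d m n u v"
  shows "\<exists>k d m n u v. selected r k d m n u v"
proof -
  have m: "\<exists>x. least_mem P x \<and> P x"
    if "definable (\<lambda>e. P (e 0))" "\<And>x. P x \<Longrightarrow> ordinal x" "\<exists>x. P x" for P
    using least_mem_ex1[of P] that unfolding least_mem_def by blast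
  have i: "\<exists>x. least_in r P x \<and> P x"
    if "definable (\<lambda>e. P (e 0))" "\<And>x. P x \<Longrightarrow> pair x x \<in>\<^sub>M r" "\<exists>x. P x" for P
    using least_in_ex1[of P r] that r unfolding least_in_def by blast
  note o = candidate_ordinals
  have D: "definable (\<lambda>e. \<exists>d m n u v. candidate r (e 0) d m n u v)"
    "definable (\<lambda>e. \<exists>m n u v. candidate r k (e 0) m n u v)"
    "definable (\<lambda>e. \<exists>n u v. candidate r k d (e 0) n u v)"
    "definable (\<lambda>e. \<exists>u v. candidate r k d m (e 0) u v)"
    "definable (\<lambda>e. \<exists>v. candidate r k d m n (e 0) v)"
    "definable (\<lambda>e. candidate r k d m n u (e 0))" for k d m n u
    unfolding candidate_def generates_def by (intro definable_intros)+
  obtain k where k: "least_mem (\<lambda>k. \<exists>d m n u v. candidate r k d m n u v) k"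
    and ex: "\<exists>d m n u v. candidate r k d m n u v"
    using m[OF D(1) _ ex] o(1) by blast
  obtain d where d: "least_mem (\<lambda>d. \<exists>m n u v. candidate r k d m n u v) d"
    and ex: "\<exists>m n u v. candidate r k d m n u v"
    using m[OF D(2) _ ex] o(2) by blast
  obtain m' where m': "least_mem (\<lambda>m. \<exists>n u v. candidate r k d m n u v) m'"
    and ex: "\<exists>n u v. candidate r k d m' n u v"
    using m[OF D(3) _ ex] o(3) by blast
  obtain n where n: "least_mem (\<lambda>n. \<exists>u v. candidate r k d m' n u v) n"
    and ex: "\<exists>u v. candidate r k d m' n u v"
    using m[OF D(4) _ ex] o(4) by blast
  obtain u where u: "least_in r (\<lambda>u. \<exists>v. candidate r k d m' n u v) u"
    and ex: "\<exists>v. candidate r k d m' n u v"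
    using i[OF D(5) _ ex] o(5) by blast
  obtain v where v: "least_in r (\<lambda>v. candidate r k d m' n u v) v"
    using i[OF D(6) _ ex] o(6) by blast
  show ?thesis unfolding selected_def using k d m' n u v by blast
qed

lemma definable_next_to: "definable (\<lambda>e. next_to (e 0) (e 1))"
proof -
  have "definable (\<lambda>e. pair c c \<in>\<^sub>M e 0 \<and> (\<exists>k d m n u v. selected (e 0) k d m n u v \<and> generates k d m n u v (e 1)) \<or>
      \<not> pair c c \<in>\<^sub>M e 0 \<and> e 1 = c)"
    unfolding selected_def least_mem_def least_in_def candidate_def generates_def by (intro definable_intros)
  then show ?thesis by (rule definable_iff_eq) (simp add: next_to_def)
qed

lemma definable_nxt: "definable (\<lambda>e. e 0 = nxt (e 1))"
proof -
  have D: "definable_term s \<Longrightarrow> definable_term t \<Longrightarrow> definable (\<lambda>e. next_to (s e) (t e))" for s t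
    using definable_comp2[OF definable_next_to] .
  have "definable (\<lambda>e. (\<exists>!w. next_to (e 1) w) \<and> next_to (e 1) (e 0) \<or> \<not> (\<exists>!w. next_to (e 1) w) \<and> e 0 = empty)"
    by (intro definable_intros D)
  then show ?thesis
  proof (rule definable_iff_eq)
    fix e
    show "(\<exists>!w. next_to (e 1) w) \<and> next_to (e 1) (e 0) \<or> \<not> (\<exists>!w. next_to (e 1) w) \<and> e 0 = empty \<longleftrightarrow>
      e 0 = nxt (e 1)"
      unfolding nxt_def using theI'[of "next_to (e 1)"] by (cases "\<exists>!w. next_to (e 1) w") auto
  qed
qed

lemma nxt_eq:
  assumes r: "wellorder r" and "next_to r w"
  shows "nxt r = w"
proof -
  have "\<exists>!w. next_to r w"
  proof (rule ex1I[of _ w])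
    fix w' assume "next_to r w'"
    then show "w' = w"
      using assms(2) selected_unique[OF r] generates_unique unfolding next_to_def
      by (cases "pair c c \<in>\<^sub>M r") (simp_all, blast)
  qed (rule assms(2))
  then show ?thesis unfolding nxt_def using assms(2) by (simp add: the1_equality)
qed

lemma A_mono: "d \<in>\<^sub>M c \<Longrightarrow> x \<in>\<^sub>M A d \<Longrightarrow> x \<in>\<^sub>M A c"
  using mem_A ordinal_trans[OF ordinal_c] by blast

lemma mem_relations: "z \<in>\<^sub>M relations \<longleftrightarrow> z = c \<or> (\<exists>d R. z = pair d R \<and> d \<in>\<^sub>M c \<and> definable_rel (A d) R)"
proof -
  have "definable (\<lambda>e. \<exists>d R. e 0 = pair d R \<and> definable_rel (A d) R)" by (intro definable_intros)
  moreover have "subs R (assignments (A c))" if d: "d \<in>\<^sub>M c" and R: "definable_rel (A d) R" for d R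
  proof -
    have "subs (assignments (A d)) (assignments (A c))"
      using A_mono[OF d] by (auto simp: subs_def mem_assignments func_def)
    then show ?thesis using definable_rel_subs[OF R] unfolding subs_def by blast
  qed
  ultimately show ?thesis unfolding relations_def by (auto simp: mem_sep)
qed

text \<open>Separates the dummy \<open>c\<close> from genuine entries. Here \<open>d\<close> is an
  element of \<open>c\<close>, whereas every element of the pair contains \<open>d\<close>, and no
  set contains itself.\<close>

lemma pair_neq_c: "d \<in>\<^sub>M c \<Longrightarrow> pair d R \<noteq> c"
proof
  assume "d \<in>\<^sub>M c" "pair d R = c"
  then have "d = sing d \<or> d = upair d R" unfolding pair_def by (metis mem_upair)
  moreover have "d \<in>\<^sub>M sing d" "d \<in>\<^sub>M upair d R" by simp_all
  ultimately show False using mem_irrefl by metis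
qed

text \<open>An order that generation can no longer extend has no candidates, so its field is closed
  under the five operations. By induction on levels, closure yields completeness: the listed
  relations of level \<open>d\<close> form a family as in \<open>def_closed\<close> and thus include
  all definable ones.\<close>

lemma relations_wellorder:
  obtains r where "wellorder r"
    "\<And>d R. d \<in>\<^sub>M c \<Longrightarrow> definable_rel (A d) R \<Longrightarrow> pair (pair d R) (pair d R) \<in>\<^sub>M r"
proof -
  obtain r where r: "wellorder r" and sub: "subs r (times relations relations)"
    and nxt: "nxt r \<in>\<^sub>M relations \<Longrightarrow> pair (nxt r) (nxt r) \<in>\<^sub>M r"
    using transfinite_generation[OF definable_nxt] by blast
  have fldG: "x \<in>\<^sub>M relations" if "pair x x \<in>\<^sub>M r" for x
    using sub that by (auto simp: subs_def)
  have c: "pair c c \<in>\<^sub>M r"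
  proof (rule ccontr)
    assume "\<not> pair c c \<in>\<^sub>M r"
    then have "nxt r = c" by (intro nxt_eq[OF r]) (simp add: next_to_def)
    then show False using nxt \<open>\<not> pair c c \<in>\<^sub>M r\<close> by (simp add: mem_relations)
  qed
  have rel: "definable_rel (A d) R" if "pair (pair d R) (pair d R) \<in>\<^sub>M r" "d \<in>\<^sub>M c" for d R
    using fldG[OF that(1)] pair_neq_c[OF that(2)] by (auto simp: mem_relations)
  have gen_rel: "w \<in>\<^sub>M relations" if g: "generates k d m n u v w" and c: "candidate r k d m n u v" for k d m n u v w
  proof -
    have *: "d \<in>\<^sub>M c" "natural m" "natural n" "pair u u \<in>\<^sub>M r" "pair v v \<in>\<^sub>M r"
      using c unfolding candidate_def by blast+
    have "\<exists>R. w = pair d R \<and> definable_rel (A d) R"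
      using g unfolding generates_def
    proof (elim disjE conjE exE)
      fix d' X assume "X \<in>\<^sub>M A d" "w = pair d (rel_const (A d) m X)"
      then show ?thesis using definable_relI(3)[OF *(2)] by blast
    next
      fix R S assume "u = pair d R" "v = pair d S" "w = pair d (rel_nand (A d) R S)"
      moreover from this have "definable_rel (A d) R" "definable_rel (A d) S" using rel * by blast+
      ultimately show ?thesis using definable_relI(4) by blast
    next
      fix R assume "u = pair d R" "w = pair d (rel_ex (A d) m R)"
      moreover from this have "definable_rel (A d) R" using rel * by blast
      ultimately show ?thesis using definable_relI(5)[OF *(2)] by blast
    qed (use definable_relI(1,2)[OF *(2,3)] in blast)+
    then show ?thesis using * by (auto simp: mem_relations)
  qed
  have no_candidate: "\<not> candidate r k d m n u v" for k d m n u v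
  proof
    assume "candidate r k d m n u v"
    then obtain k d m n u v where s: "selected r k d m n u v" using selected_ex[OF r] by blast
    then have cand: "candidate r k d m n u v" unfolding selected_def least_in_def by blast
    then obtain w where w: "generates k d m n u v w" "\<not> pair w w \<in>\<^sub>M r" unfolding candidate_def by blast
    have "next_to r w" unfolding next_to_def if_P[OF c] using s w(1) by blast
    then have "nxt r = w" by (rule nxt_eq[OF r])
    then show False using nxt gen_rel[OF w(1) cand] w(2) by simp
  qed
  have gen: "pair w w \<in>\<^sub>M r" if "generates k d m n u v w" "natural k" "d \<in>\<^sub>M c" "natural m" "natural n"
      "pair u u \<in>\<^sub>M r" "pair v v \<in>\<^sub>M r" for k d m n u v w
    using no_candidate[of k d m n u v] that unfolding candidate_def by blast
  have nat: "natural zero" "natural one" "natural two" by (simp_all add: one_def two_def)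
  have "pair (pair d R) (pair d R) \<in>\<^sub>M r" if dc: "d \<in>\<^sub>M c" and dR: "definable_rel (A d) R" for d R
  proof (rule ccontr)
    \<comment> \<open>Below the least bad level everything is listed. This provides the codes of the
      parameters from \<open>A d\<close>, since each of them is definable over a lower
      level.\<close>
    define bad where "bad d \<longleftrightarrow> (\<exists>R. definable_rel (A d) R \<and> \<not> pair (pair d R) (pair d R) \<in>\<^sub>M r)" for d
    have "definable (\<lambda>e. bad (e 0))" unfolding bad_def by (intro definable_intros)
    moreover assume "\<not> pair (pair d R) (pair d R) \<in>\<^sub>M r"
    moreover from this have "bad d" using dR unfolding bad_def by blast
    ultimately obtain d where d: "d \<in>\<^sub>M c" "bad d" and low: "\<And>d'. d' \<in>\<^sub>M d \<Longrightarrow> \<not> bad d'"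
      using foundation_definable[where P = bad and a = c and x = d] dc ordinal_trans[OF ordinal_c]
      by blast
    \<comment> \<open>It must be a set, because \<open>definable_rel\<close> tests only families
      that are individuals of the model.\<close>
    define D where "D = cset (\<lambda>R. pair (pair d R) (pair d R) \<in>\<^sub>M r)"
    have D: "R \<in>\<^sub>M D \<longleftrightarrow> pair (pair d R) (pair d R) \<in>\<^sub>M r" for R
      unfolding D_def
    proof (rule mem_cset_bounded)
      show "definable (\<lambda>e. pair (pair d (e 0)) (pair d (e 0)) \<in>\<^sub>M r)" by (intro definable_intros)
      show "R \<in>\<^sub>M bigcup (bigcup (bigcup (bigcup r)))" if "pair (pair d R) (pair d R) \<in>\<^sub>M r" for R
        using pair_in_bigcup(2)[OF pair_in_bigcup(2)[OF that]] .
    qed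
    have nand: "rel_nand (A d) R S \<in>\<^sub>M D" if "R \<in>\<^sub>M D" "S \<in>\<^sub>M D" for R S
      using gen[of two d zero one "pair d R" "pair d S"] that d(1) nat unfolding D generates_def by blast
    have "def_closed (A d) D"
      unfolding def_closed_rel
    proof (intro conjI allI impI)
      fix m n assume "natural m" "natural n"
      then show "rel_mem (A d) m n \<in>\<^sub>M D" "rel_eq (A d) m n \<in>\<^sub>M D"
        unfolding D using gen[of zero d m n c c] gen[of one d m n c c] d(1) nat c unfolding generates_def by blast+
    next
      fix m a assume m: "natural m" and a: "a \<in>\<^sub>M A d"
      then obtain d' where d': "d' \<in>\<^sub>M d" "definable_subset (A d') a" using mem_A d(1) by blast
      then have "pair (pair d' (rel_code (A d') a)) (pair d' (rel_code (A d') a)) \<in>\<^sub>M r"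
        using low unfolding bad_def definable_subset_code by blast
      then show "rel_const (A d) m a \<in>\<^sub>M D"
        unfolding D using gen[of two d m zero "pair d' (rel_code (A d') a)" c] d(1) d' m a nat c
        unfolding generates_def definable_subset_code by blast
    next
      fix m R assume "natural m" "R \<in>\<^sub>M D"
      then show "rel_ex (A d) m R \<in>\<^sub>M D"
        unfolding D using gen[of two d m two "pair d R" c] d(1) nat c unfolding generates_def by blast
    qed (use nand in blast)+
    then show False using d(2) D unfolding bad_def definable_rel_def by blast
  qed
  then show thesis using that r by blast
qed

text \<open>An element of \<open>E\<close> is definable over a level below \<open>c\<close> and so
  has a code among the listed relations. The same set may have codes at several levels, so elements
  are compared by their least codes.\<close>

lemma level_wellorder:
  assumes E: "subs E (A c)"
  obtains q where "wellorder q" "\<And>x. x \<in>\<^sub>M E \<Longrightarrow> pair x x \<in>\<^sub>M q"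
proof -
  obtain r where r: "wellorder r"
    and rel: "\<And>d R. d \<in>\<^sub>M c \<Longrightarrow> definable_rel (A d) R \<Longrightarrow> pair (pair d R) (pair d R) \<in>\<^sub>M r"
    using relations_wellorder by blast
  note w = wellorderD[OF r]
  define K where "K x g \<longleftrightarrow> pair g g \<in>\<^sub>M r \<and> (\<exists>d. d \<in>\<^sub>M c \<and> subs x (A d) \<and> g = pair d (rel_code (A d) x))" for x g
  have K_inj: "x = y" if "K x g" "K y g" for x y g
    using that rel_code_inj unfolding K_def by auto
  define L where "L x g \<longleftrightarrow> least_in r (K x) g" for x g
  have DL: "definable_term s \<Longrightarrow> definable_term t \<Longrightarrow> definable (\<lambda>e. L (s e) (t e))" for s t
  proof (rule definable_comp2[where P = L])
    show "definable (\<lambda>e. L (e 0) (e 1))"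
      unfolding L_def K_def least_in_def by (intro definable_intros)
  qed
  have L_unique: "g = h" if "L x g" "L x h" for x g h
    using that w(3) unfolding L_def least_in_def by blast
  have L_inj: "x = y" if "L x g" "L y g" for x y g
    using that K_inj unfolding L_def least_in_def by blast
  have L_fld: "pair g g \<in>\<^sub>M r" if "L x g" for x g
    using that unfolding L_def least_in_def K_def by blast
  have L_ex: "\<exists>g. L x g" if x: "x \<in>\<^sub>M E" for x
  proof -
    obtain d where "d \<in>\<^sub>M c" "definable_subset (A d) x" using E x mem_A unfolding subs_def by blast
    then have "K x (pair d (rel_code (A d) x))"
      using rel unfolding K_def definable_subset_code by blast
    moreover have "definable (\<lambda>e. K x (e 0))" unfolding K_def by (intro definable_intros)
    ultimately show ?thesis using least_in_ex1[of "K x" r] r unfolding L_def K_def by blast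
  qed
  define q where "q = sep (times E E) (\<lambda>z. \<exists>x y g h. z = pair x y \<and> L x g \<and> L y h \<and> pair g h \<in>\<^sub>M r)"
  have "definable (\<lambda>e. \<exists>x y g h. e 0 = pair x y \<and> L x g \<and> L y h \<and> pair g h \<in>\<^sub>M r)"
    by (intro definable_intros DL)
  then have q: "pair x y \<in>\<^sub>M q \<longleftrightarrow> x \<in>\<^sub>M E \<and> y \<in>\<^sub>M E \<and> (\<exists>g h. L x g \<and> L y h \<and> pair g h \<in>\<^sub>M r)" for x y
    unfolding q_def by (auto simp: mem_sep)
  have q_refl: "pair x x \<in>\<^sub>M q" if "x \<in>\<^sub>M E" for x
    using that L_ex L_fld unfolding q by blast
  have "wellorder q"
    unfolding wellorder_def
  proof (intro conjI allI impI)
    fix x y z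
    show "pair x x \<in>\<^sub>M q" "pair y y \<in>\<^sub>M q" if "pair x y \<in>\<^sub>M q"
      using that q_refl unfolding q by blast+
    show "x = y" if "pair x y \<in>\<^sub>M q" "pair y x \<in>\<^sub>M q"
      using that L_unique L_inj w(3) unfolding q by metis
    show "pair x z \<in>\<^sub>M q" if "pair x y \<in>\<^sub>M q" "pair y z \<in>\<^sub>M q"
      using that L_unique w(4) unfolding q by metis
    show "pair x y \<in>\<^sub>M q \<or> pair y x \<in>\<^sub>M q" if "pair x x \<in>\<^sub>M q" "pair y y \<in>\<^sub>M q"
      using that L_fld w(5) unfolding q by metis
  next
    fix Z assume Z: "\<exists>x. x \<in>\<^sub>M Z" "\<forall>x. x \<in>\<^sub>M Z \<longrightarrow> pair x x \<in>\<^sub>M q"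
    then obtain x g where "x \<in>\<^sub>M Z" "L x g" unfolding q by blast
    then have ex: "\<exists>x. x \<in>\<^sub>M Z \<and> L x g" by blast
    have D: "definable (\<lambda>e. \<exists>x. x \<in>\<^sub>M Z \<and> L x (e 0))" by (intro definable_intros DL)
    obtain h where h: "\<exists>x. x \<in>\<^sub>M Z \<and> L x h" "\<And>g. \<exists>x. x \<in>\<^sub>M Z \<and> L x g \<Longrightarrow> pair h g \<in>\<^sub>M r"
      by (rule wellorder_leastE[where P = "\<lambda>g. \<exists>x. x \<in>\<^sub>M Z \<and> L x g", OF r D ex]) (use L_fld in blast)+
    then show "\<exists>x. x \<in>\<^sub>M Z \<and> (\<forall>y. y \<in>\<^sub>M Z \<longrightarrow> pair x y \<in>\<^sub>M q)"
      using Z(2) unfolding q by blast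
  qed
  then show thesis using that q_refl by blast
qed

end

text \<open>A constructible \<open>E\<close> is definable over some level \<open>c\<close>, hence a
  subset of that level. The levels are given by \<open>val f\<close>, which agrees with
  \<open>ap f\<close> on the ordinals involved and is definable everywhere.\<close>

lemma (in ground_model) wellorder_exists:
  obtains q where "wellorder q" "\<And>x. x \<in>\<^sub>M E \<Longrightarrow> pair x x \<in>\<^sub>M q"
proof -
  obtain a f b where L: "L_hierarchy a f" and b: "b \<in>\<^sub>M a" and E: "E \<in>\<^sub>M ap f b"
    using V_eq_L unfolding constructible_def by blast
  then obtain c where c: "c \<in>\<^sub>M b" "definable_subset (ap f c) E" unfolding L_hierarchy_def by blast
  have a: "ordinal a" and f: "func_on f a" using L unfolding L_hierarchy_def by blast+
  have val: "val f d = ap f d" if "d \<in>\<^sub>M a" for d using func_on_val[OF f that] .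
  have ca: "c \<in>\<^sub>M a" using ordinal_trans[OF a b c(1)] .
  interpret constructible_levels mem "val f" c
  proof
    show "definable (\<lambda>e. e 0 = val f (e 1))" by (intro definable_intros)
    show "ordinal c" using ordinal_mem[OF a ca] .
    fix d x assume "d \<in>\<^sub>M c \<or> d = c"
    then have d: "d \<in>\<^sub>M a" using ordinal_trans[OF a ca] ca by blast
    then show "x \<in>\<^sub>M val f d \<longleftrightarrow> (\<exists>d'. d' \<in>\<^sub>M d \<and> definable_subset (val f d') x)"
      using L val ordinal_trans[OF a d] unfolding L_hierarchy_def by metis
  qed
  have "subs E (val f c)" using c(2) val[OF ca] unfolding definable_subset_def by simp
  then show thesis using level_wellorder that by blast
qed

section \<open>Finite sets, and an injective sequence in an infinite set\<close>

context zf_model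
begin

lemma func_iff: "func f X Y \<longleftrightarrow>
    (\<forall>z. z \<in>\<^sub>M f \<longrightarrow> (\<exists>x y. x \<in>\<^sub>M X \<and> y \<in>\<^sub>M Y \<and> z = pair x y)) \<and> (\<forall>x. x \<in>\<^sub>M X \<longrightarrow> (\<exists>!y. pair x y \<in>\<^sub>M f))"
  (is "_ \<longleftrightarrow> ?R")
proof
  assume f: "func f X Y"
  then have on: "func_on f X" unfolding func_def by blast
  have "\<exists>x y. x \<in>\<^sub>M X \<and> y \<in>\<^sub>M Y \<and> z = pair x y" if z: "z \<in>\<^sub>M f" for z
  proof -
    obtain x y where xy: "x \<in>\<^sub>M X" "z = pair x y" using on z unfolding func_on_def by blast
    then have "ap f x = y" using func_on_ap[OF on] z by blast
    then show ?thesis using f xy unfolding func_def by blast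
  qed
  then show ?R using on unfolding func_on_def by blast
next
  assume R: ?R
  then have on: "func_on f X" unfolding func_on_def by blast
  have "ap f x \<in>\<^sub>M Y" if x: "x \<in>\<^sub>M X" for x
  proof -
    have "pair x (ap f x) \<in>\<^sub>M f" using func_on_ap[OF on x] by blast
    then show ?thesis using R by fastforce
  qed
  then show "func f X Y" using on unfolding func_def by blast
qed

lemma bijection_iff: "bijection f X Y \<longleftrightarrow>
    (\<forall>z. z \<in>\<^sub>M f \<longrightarrow> (\<exists>x y. x \<in>\<^sub>M X \<and> y \<in>\<^sub>M Y \<and> z = pair x y)) \<and> (\<forall>x. x \<in>\<^sub>M X \<longrightarrow> (\<exists>!y. pair x y \<in>\<^sub>M f)) \<and>
    (\<forall>y. y \<in>\<^sub>M Y \<longrightarrow> (\<exists>!x. pair x y \<in>\<^sub>M f))"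
proof -
  have key: "(x \<in>\<^sub>M X \<and> ap f x = y) \<longleftrightarrow> pair x y \<in>\<^sub>M f" if "func f X Y" for x y
  proof -
    have "pair x y \<in>\<^sub>M f \<Longrightarrow> x \<in>\<^sub>M X" using that unfolding func_iff by fastforce
    then show ?thesis using that func_on_ap unfolding func_def by blast
  qed
  then have "bijection f X Y \<longleftrightarrow> func f X Y \<and> (\<forall>y. y \<in>\<^sub>M Y \<longrightarrow> (\<exists>!x. pair x y \<in>\<^sub>M f))"
    unfolding bijection_def by (intro conj_cong refl) simp
  then show ?thesis unfolding func_iff by (simp only: conj_assoc)
qed

text \<open>Finiteness of initial segments will be an induction hypothesis inside the model and must
  therefore be definable; \<open>bijection_iff\<close> removes \<open>ap\<close> for this
  purpose.\<close>

lemma definable_infinite_set [definable_intros]: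
  "definable_term s \<Longrightarrow> definable (\<lambda>e. infinite_set (s e))"
proof (rule definable_comp1[where P = infinite_set])
  show "definable (\<lambda>e. infinite_set (e 0))"
    unfolding infinite_set_def bijection_iff by (intro definable_intros)
qed

lemma finite_empty: "\<not> infinite_set empty"
proof -
  have "bijection empty empty empty" by (simp add: bijection_iff)
  then show ?thesis unfolding infinite_set_def using natural_zero[unfolded zero_def] by blast
qed

lemma finite_insert:
  assumes "\<not> infinite_set X" and y: "\<not> y \<in>\<^sub>M X"
  shows "\<not> infinite_set (cup X (sing y))"
proof -
  obtain n f where n: "natural n" and f: "bijection f n X" using assms(1) unfolding infinite_set_def by blast
  have "x \<in>\<^sub>M n \<and> z \<in>\<^sub>M X" if "pair x z \<in>\<^sub>M f" for x z
    using f that unfolding bijection_iff by fastforce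
  then have no: "\<not> pair n z \<in>\<^sub>M f" "\<not> pair x y \<in>\<^sub>M f" for x z using mem_irrefl y by blast+
  define g where "g = cup f (sing (pair n y))"
  have g: "pair x z \<in>\<^sub>M g \<longleftrightarrow> pair x z \<in>\<^sub>M f \<or> x = n \<and> z = y" for x z by (simp add: g_def)
  have "bijection g (succ n) (cup X (sing y))"
    unfolding bijection_iff
  proof (intro conjI allI impI)
    fix z assume "z \<in>\<^sub>M g"
    then show "\<exists>x w. x \<in>\<^sub>M succ n \<and> w \<in>\<^sub>M cup X (sing y) \<and> z = pair x w"
      using f unfolding g_def bijection_iff by fastforce
  next
    fix x assume "x \<in>\<^sub>M succ n"
    then consider "x \<in>\<^sub>M n" | "x = n" by auto
    then show "\<exists>!w. pair x w \<in>\<^sub>M g"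
    proof cases
      case 1
      then have "\<exists>!w. pair x w \<in>\<^sub>M f" "x \<noteq> n" using f unfolding bijection_iff by auto
      then show ?thesis by (simp add: g)
    next
      case 2
      then show ?thesis using no by (simp add: g)
    qed
  next
    fix w assume "w \<in>\<^sub>M cup X (sing y)"
    then consider "w \<in>\<^sub>M X" | "w = y" by auto
    then show "\<exists>!x. pair x w \<in>\<^sub>M g"
    proof cases
      case 1
      then have "\<exists>!x. pair x w \<in>\<^sub>M f" "w \<noteq> y" using f y unfolding bijection_iff by auto
      then show ?thesis by (simp add: g)
    next
      case 2
      then show ?thesis using no by (simp add: g)
    qed
  qed
  then show ?thesis using n natural_succ unfolding infinite_set_def by blast
qed

end

text \<open>The map \<open>h\<close> is the successor in a well-order of \<open>E\<close>, started
  at the least element \<open>y\<^sub>0\<close>. Elements reached in this way have finite initial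
  segments, so an infinite \<open>E\<close> always offers a next one. The first coordinate follows
  \<open>G\<close> in parallel, which yields a table without explicit indices.\<close>

lemma (in ground_model) infinite_iteration:
  assumes G: "definable (\<lambda>e. e 0 = G (e 1))" and E: "infinite_set E"
  obtains T y\<^sub>0 h where
    "pair b y\<^sub>0 \<in>\<^sub>M T"
    "\<And>p y. pair p y \<in>\<^sub>M T \<Longrightarrow> pair (G p) (h y) \<in>\<^sub>M T"
    "\<And>Q z. definable (\<lambda>e. Q (e 0)) \<Longrightarrow> Q (pair b y\<^sub>0) \<Longrightarrow>
       (\<And>p y. pair p y \<in>\<^sub>M T \<Longrightarrow> Q (pair p y) \<Longrightarrow> Q (pair (G p) (h y))) \<Longrightarrow> z \<in>\<^sub>M T \<Longrightarrow> Q z"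
    "\<And>p y. pair p y \<in>\<^sub>M T \<Longrightarrow> y \<in>\<^sub>M E \<and> h y \<noteq> y\<^sub>0"
    "\<And>p y p' y'. pair p y \<in>\<^sub>M T \<Longrightarrow> pair p' y' \<in>\<^sub>M T \<Longrightarrow> h y = h y' \<Longrightarrow> y = y'"
    "definable (\<lambda>e. e 0 = h (e 1))"
proof -
  obtain r where r: "wellorder r" and fld: "\<And>x. x \<in>\<^sub>M E \<Longrightarrow> pair x x \<in>\<^sub>M r"
    using wellorder_exists[of E] by blast
  note w = wellorderD[OF r]
  have "\<exists>x. x \<in>\<^sub>M E"
  proof (rule ccontr)
    assume "\<not> ?thesis"
    then have "E = empty" by (intro set_eqI) simp
    then show False using E finite_empty by simp
  qed
  then obtain y0 where y0: "y0 \<in>\<^sub>M E" "\<And>y. y \<in>\<^sub>M E \<Longrightarrow> pair y0 y \<in>\<^sub>M r"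
    using w(6)[of _ E] fld by blast
  define above where "above y z \<longleftrightarrow> z \<in>\<^sub>M E \<and> pair y z \<in>\<^sub>M r \<and> z \<noteq> y" for y z
  define nx where "nx y z \<longleftrightarrow> above y z \<and> (\<forall>x. above y x \<longrightarrow> pair z x \<in>\<^sub>M r)" for y z
  have nx_unique: "z = z'" if "nx y z" "nx y z'" for y z z'
    using that w(3) unfolding nx_def by blast
  have Dnx: "definable (\<lambda>e. nx (e i) (e j))" for i j
    unfolding nx_def above_def by (intro definable_intros)
  \<comment> \<open>The value \<open>empty\<close> stands for a missing successor; elements of the
    table always have one.\<close>
  define h where "h y = (if \<exists>z. nx y z then THE z. nx y z else empty)" for y
  have h_eq: "h y = z" if nx: "nx y z" for y z
  proof -
    have "(THE z. nx y z) = z" by (rule the_equality) (use nx nx_unique in blast)+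
    then show ?thesis using nx unfolding h_def by auto
  qed
  have h_empty: "h y = empty" if "\<not> (\<exists>z. nx y z)" for y
    using that by (simp only: h_def if_False)
  have Dh: "definable (\<lambda>e. e 0 = h (e 1))"
  proof (rule definable_iff_eq)
    show "definable (\<lambda>e. nx (e 1) (e 0) \<or> \<not> (\<exists>z. nx (e 1) z) \<and> e 0 = empty)"
      by (intro definable_intros Dnx)
    show "nx (e 1) (e 0) \<or> \<not> (\<exists>z. nx (e 1) z) \<and> e 0 = empty \<longleftrightarrow> e 0 = h (e 1)" for e
      using h_eq[of "e 1"] h_empty[of "e 1"] by metis
  qed
  \<comment> \<open>\<open>iteration_set\<close> expects a function on all individuals, so
    \<open>F\<close> is the identity outside pairs.\<close>
  define F where "F z = (if \<exists>p y. z = pair p y then THE v. \<exists>p y. z = pair p y \<and> v = pair (G p) (h y) else z)" for z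
  have F_pair: "F (pair p y) = pair (G p) (h y)" for p y
    unfolding F_def by auto
  have DF: "definable (\<lambda>e. e 0 = F (e 1))"
  proof (rule definable_iff_eq)
    show "definable (\<lambda>e. (\<exists>p y. e 1 = pair p y \<and> e 0 = pair (G p) (h y)) \<or> \<not> (\<exists>p y. e 1 = pair p y) \<and> e 0 = e 1)"
      by (intro definable_intros definable_term_comp1[OF G] definable_term_comp1[OF Dh])
    show "(\<exists>p y. e 1 = pair p y \<and> e 0 = pair (G p) (h y)) \<or> \<not> (\<exists>p y. e 1 = pair p y) \<and> e 0 = e 1 \<longleftrightarrow>
      e 0 = F (e 1)" for e
      by (cases "\<exists>p y. e 1 = pair p y") (auto simp: F_pair, auto simp: F_def)
  qed
  obtain T where T: "pair b y0 \<in>\<^sub>M T" "\<And>x. x \<in>\<^sub>M T \<Longrightarrow> F x \<in>\<^sub>M T"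
    and ind: "\<And>P x. definable (\<lambda>e. P (e 0)) \<Longrightarrow> P (pair b y0) \<Longrightarrow>
      (\<And>x. x \<in>\<^sub>M T \<Longrightarrow> P x \<Longrightarrow> P (F x)) \<Longrightarrow> x \<in>\<^sub>M T \<Longrightarrow> P x"
  proof (rule iteration_set[OF DF, of "pair b y0"], goal_cases)
    case (1 T)
    show thesis by (rule that) (fact 1)+
  qed
  have is_pair: "\<exists>p y. z = pair p y" if "z \<in>\<^sub>M T" for z
    using _ _ _ that
  proof (rule ind)
    show "definable (\<lambda>e. \<exists>p y. e 0 = pair p y)" by (intro definable_intros)
  qed (auto simp: F_pair)
  have induct: "Q z" if "definable (\<lambda>e. Q (e 0))" "Q (pair b y0)"
    "\<And>p y. pair p y \<in>\<^sub>M T \<Longrightarrow> Q (pair p y) \<Longrightarrow> Q (pair (G p) (h y))" "z \<in>\<^sub>M T" for Q z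
    using that(1,2) _ that(4)
  proof (rule ind)
    show "Q (F x)" if "x \<in>\<^sub>M T" "Q x" for x
      using is_pair[OF that(1)] that \<open>\<And>p y. pair p y \<in>\<^sub>M T \<Longrightarrow> Q (pair p y) \<Longrightarrow> Q (pair (G p) (h y))\<close> F_pair by metis
  qed
  define upto where "upto y = sep E (\<lambda>x. pair x y \<in>\<^sub>M r)" for y
  have upto: "x \<in>\<^sub>M upto y \<longleftrightarrow> x \<in>\<^sub>M E \<and> pair x y \<in>\<^sub>M r" for x y
    unfolding upto_def by (rule mem_sep) (intro definable_intros)
  \<comment> \<open>With nothing above \<open>y\<close>, the finite set \<open>upto y\<close> would
    be all of \<open>E\<close>. The initial segment of the successor has just one element more, so
    finiteness is preserved.\<close>
  have step: "nx y (h y) \<and> \<not> infinite_set (upto (h y))" if y: "y \<in>\<^sub>M E" and fin: "\<not> infinite_set (upto y)" for y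
  proof -
    have "\<exists>z. above y z"
    proof (rule ccontr)
      assume none: "\<not> ?thesis"
      have "upto y = E"
      proof (rule set_eqI)
        show "x \<in>\<^sub>M upto y \<longleftrightarrow> x \<in>\<^sub>M E" for x
          using none w(5)[OF fld fld] y fld unfolding upto above_def by metis
      qed
      then show False using fin E by simp
    qed
    then obtain z where z: "above y z" ..
    have D: "definable (\<lambda>e. above y (e 0))" unfolding above_def by (intro definable_intros)
    obtain m where m: "nx y m"
      by (rule wellorder_leastE[where P = "above y", OF r D z]) (use that in \<open>auto simp: nx_def above_def fld\<close>)
    then have "upto m = cup (upto y) (sing m)"
    proof -
      have m': "m \<in>\<^sub>M E" "pair y m \<in>\<^sub>M r" "\<And>x. x \<in>\<^sub>M E \<Longrightarrow> pair y x \<in>\<^sub>M r \<Longrightarrow> x \<noteq> y \<Longrightarrow> pair m x \<in>\<^sub>M r"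
        using m unfolding nx_def above_def by blast+
      show ?thesis
      proof (rule set_eqI)
        fix x
        show "x \<in>\<^sub>M upto m \<longleftrightarrow> x \<in>\<^sub>M cup (upto y) (sing m)"
        proof
          assume x: "x \<in>\<^sub>M upto m"
          show "x \<in>\<^sub>M cup (upto y) (sing m)"
          proof (cases "pair x y \<in>\<^sub>M r")
            case False
            then have "pair y x \<in>\<^sub>M r" "x \<noteq> y" using w(5)[of x y] fld x y unfolding upto by blast+
            then have "x = m" using m'(3) x w(3) unfolding upto by blast
            then show ?thesis by simp
          qed (use x in \<open>simp add: upto\<close>)
        next
          assume "x \<in>\<^sub>M cup (upto y) (sing m)"
          then show "x \<in>\<^sub>M upto m" using w(4)[OF _ m'(2)] m'(1) fld by (auto simp: upto)
        qed
      qed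
    qed
    moreover have "\<not> m \<in>\<^sub>M upto y" using m w(3) unfolding upto nx_def above_def by blast
    ultimately show ?thesis using finite_insert[OF fin] m h_eq[OF m] by simp
  qed
  have inv: "\<forall>p y. z = pair p y \<longrightarrow> y \<in>\<^sub>M E \<and> \<not> infinite_set (upto y)" if z: "z \<in>\<^sub>M T" for z
    using _ _ _ z
  proof (rule induct)
    show "definable (\<lambda>e. \<forall>p y. e 0 = pair p y \<longrightarrow> y \<in>\<^sub>M E \<and> \<not> infinite_set (upto y))"
      unfolding upto_def by (intro definable_intros)
    have "upto y0 = cup empty (sing y0)"
      by (rule set_eqI) (use y0 w(3) fld in \<open>auto simp: upto\<close>)
    then show "\<forall>p y. pair b y0 = pair p y \<longrightarrow> y \<in>\<^sub>M E \<and> \<not> infinite_set (upto y)"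
      using finite_insert[OF finite_empty, of y0] y0(1) by simp
  qed (use step in \<open>auto simp: nx_def above_def\<close>)
  have nxT: "y \<in>\<^sub>M E \<and> nx y (h y)" if "pair p y \<in>\<^sub>M T" for p y
    using inv[OF that] step by blast
  show thesis
  proof
    show "pair b y0 \<in>\<^sub>M T" by (rule T)
    show "definable (\<lambda>e. e 0 = h (e 1))" by (rule Dh)
    show "pair (G p) (h y) \<in>\<^sub>M T" if "pair p y \<in>\<^sub>M T" for p y
      using T(2)[OF that] by (simp add: F_pair)
    show "y \<in>\<^sub>M E \<and> h y \<noteq> y0" if "pair p y \<in>\<^sub>M T" for p y
      using nxT[OF that] y0 w(3) unfolding nx_def above_def by metis
    show "y = y'" if T: "pair p y \<in>\<^sub>M T" "pair p' y' \<in>\<^sub>M T" and eq: "h y = h y'" for p y p' y'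
    proof (rule ccontr)
      assume ne: "y \<noteq> y'"
      have n: "y \<in>\<^sub>M E" "y' \<in>\<^sub>M E" "nx y (h y)" "nx y' (h y)" using nxT[OF T(1)] nxT[OF T(2)] eq by simp_all
      have "pair y y' \<in>\<^sub>M r \<or> pair y' y \<in>\<^sub>M r" using w(5) fld n by blast
      then have "pair (h y) y' \<in>\<^sub>M r \<or> pair (h y) y \<in>\<^sub>M r" using n ne unfolding nx_def above_def by blast
      then show False using n w(3) unfolding nx_def above_def by blast
    qed
  qed (rule induct)
qed

section \<open>Compiling lambda-terms to combinators\<close>

text \<open>Variables are de Bruijn levels: \<open>LAbs t\<close> under \<open>n\<close> variables binds the variable \<open>n\<close>. In
  \<open>LAppV t i\<close> the argument is the value of the variable \<open>i\<close> itself, and not a term that reduces to it.\<close>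

datatype lam = LVar nat | LApp lam lam | LAppV lam nat | LAbs lam | LB | LCC

locale realizability_algebra = zf_model mem + realizability_frame mem "\<A>"
  for mem :: "'m \<Rightarrow> 'm \<Rightarrow> bool" (infix "\<in>\<^sub>M" 50) and \<A> :: "'m ralg" +
  assumes algebra: "is_algebra" and coherence: "coherent"
begin

abbreviation qp :: "'m \<Rightarrow> bool" where "qp x \<equiv> x \<in>\<^sub>M QP \<A>"
abbreviation lm :: "'m \<Rightarrow> bool" where "lm x \<equiv> x \<in>\<^sub>M Lam \<A>"
abbreviation st :: "'m \<Rightarrow> bool" where "st p \<equiv> p \<in>\<^sub>M Stk \<A>"
abbreviation pole :: "'m \<Rightarrow> bool" where "pole p \<equiv> p \<in>\<^sub>M Pole \<A>"

lemma qp_lm [simp]: "qp x \<Longrightarrow> lm x"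
  using algebra unfolding is_algebra_def subs_def by blast

lemma qp_combinators [simp]: "qp (cB \<A>)" "qp (cC \<A>)" "qp (cI \<A>)" "qp (cK \<A>)" "qp (cW \<A>)" "qp (cCC \<A>)"
  using algebra unfolding is_algebra_def by blast+

lemma qp_app [simp]: "qp x \<Longrightarrow> qp y \<Longrightarrow> qp (app x y)"
  using algebra unfolding is_algebra_def by blast

lemma lm_app [simp]: "lm x \<Longrightarrow> lm y \<Longrightarrow> lm (app x y)"
  using algebra unfolding is_algebra_def func_def app_def by simp

lemma st_push [simp]: "lm x \<Longrightarrow> st p \<Longrightarrow> st (x \<cdot> p)"
  using algebra unfolding is_algebra_def func_def push_def by simp

lemma lm_cont [simp]: "st p \<Longrightarrow> lm (cont p)"
  using algebra unfolding is_algebra_def func_def cont_def by simp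

lemma pole_exec: "p \<succ> q \<Longrightarrow> pole q \<Longrightarrow> pole p"
  using algebra unfolding is_algebra_def by blast

lemma exec_rules:
  "lm x \<Longrightarrow> lm y \<Longrightarrow> lm z \<Longrightarrow> st p \<Longrightarrow> st q \<Longrightarrow>
     app x y \<star> p \<succ> x \<star> y \<cdot> p \<and> cI \<A> \<star> x \<cdot> p \<succ> x \<star> p \<and> cK \<A> \<star> x \<cdot> y \<cdot> p \<succ> x \<star> p \<and>
     cW \<A> \<star> x \<cdot> y \<cdot> p \<succ> x \<star> y \<cdot> y \<cdot> p \<and> cC \<A> \<star> x \<cdot> y \<cdot> z \<cdot> p \<succ> x \<star> z \<cdot> y \<cdot> p \<and>
     cB \<A> \<star> x \<cdot> y \<cdot> z \<cdot> p \<succ> x \<star> app y z \<cdot> p \<and> cCC \<A> \<star> x \<cdot> p \<succ> x \<star> cont p \<cdot> p \<and>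
     cont p \<star> x \<cdot> q \<succ> x \<star> p"
  using algebra unfolding is_algebra_def by (elim conjE) simp

lemma pole_rules:
  assumes "st p"
  shows "lm x \<Longrightarrow> lm y \<Longrightarrow> pole (x \<star> y \<cdot> p) \<Longrightarrow> pole (app x y \<star> p)"
    "lm x \<Longrightarrow> pole (x \<star> p) \<Longrightarrow> pole (cI \<A> \<star> x \<cdot> p)"
    "lm x \<Longrightarrow> lm y \<Longrightarrow> pole (x \<star> p) \<Longrightarrow> pole (cK \<A> \<star> x \<cdot> y \<cdot> p)"
    "lm x \<Longrightarrow> lm y \<Longrightarrow> pole (x \<star> y \<cdot> y \<cdot> p) \<Longrightarrow> pole (cW \<A> \<star> x \<cdot> y \<cdot> p)"
    "lm x \<Longrightarrow> lm y \<Longrightarrow> lm z \<Longrightarrow> pole (x \<star> z \<cdot> y \<cdot> p) \<Longrightarrow> pole (cC \<A> \<star> x \<cdot> y \<cdot> z \<cdot> p)"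
    "lm x \<Longrightarrow> lm y \<Longrightarrow> lm z \<Longrightarrow> pole (x \<star> app y z \<cdot> p) \<Longrightarrow> pole (cB \<A> \<star> x \<cdot> y \<cdot> z \<cdot> p)"
    "lm x \<Longrightarrow> pole (x \<star> cont p \<cdot> p) \<Longrightarrow> pole (cCC \<A> \<star> x \<cdot> p)"
    "lm x \<Longrightarrow> st q \<Longrightarrow> pole (x \<star> p) \<Longrightarrow> pole (cont p \<star> x \<cdot> q)"
  using assms exec_rules pole_exec by metis+

fun pushs :: "'m list \<Rightarrow> 'm \<Rightarrow> 'm" where
  "pushs [] p = p"
| "pushs (u # us) p = u \<cdot> pushs us p"

lemma st_pushs [simp]: "\<forall>u\<in>set us. lm u \<Longrightarrow> st p \<Longrightarrow> st (pushs us p)"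
  by (induction us) auto

lemma pushs_append [simp]: "pushs (us @ vs) p = pushs us (pushs vs p)"
  by (induction us) auto

lemma lm_foldl_app [simp]: "lm t \<Longrightarrow> \<forall>u\<in>set us. lm u \<Longrightarrow> lm (foldl app t us)"
  by (induction us arbitrary: t) auto

lemma pole_foldl_app:
  "lm t \<Longrightarrow> \<forall>u\<in>set us. lm u \<Longrightarrow> st p \<Longrightarrow> pole (t \<star> pushs us p) \<Longrightarrow> pole (foldl app t us \<star> p)"
  by (induction us arbitrary: t) (auto simp: pole_rules)

text \<open>\<open>drop_c n\<close> maps \<open>x, u\<^sub>1, \<dots>, u\<^sub>n\<close> to \<open>x\<close>.\<close>

fun drop_c :: "nat \<Rightarrow> 'm" where
  "drop_c 0 = cI \<A>"
| "drop_c (Suc n) = app (app (cB \<A>) (drop_c n)) (cK \<A>)"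

text \<open>For \<open>i < n\<close> this selects argument number \<open>i\<close>, counted from 0,
  among \<open>n\<close> arguments; the first clause is a default.\<close>

fun proj_c :: "nat \<Rightarrow> nat \<Rightarrow> 'm" where
  "proj_c 0 i = cI \<A>"
| "proj_c (Suc n) 0 = drop_c n"
| "proj_c (Suc n) (Suc i) = app (cK \<A>) (proj_c n i)"

fun const_c :: "nat \<Rightarrow> 'm \<Rightarrow> 'm" where
  "const_c 0 c = c"
| "const_c (Suc n) c = app (cK \<A>) (const_c n c)"

text \<open>\<open>rot_c n\<close> maps \<open>t, v, u\<^sub>1, \<dots>, u\<^sub>n\<close> to \<open>t u\<^sub>1 \<dots> u\<^sub>n v\<close>, and \<open>dup_c n i\<close> maps
  \<open>t, u\<^sub>0, \<dots>, u\<^sub>n\<^sub>-\<^sub>1\<close> to \<open>t u\<^sub>0 \<dots> u\<^sub>n\<^sub>-\<^sub>1 u\<^sub>i\<close>.\<close>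

fun rot_c :: "nat \<Rightarrow> 'm" where
  "rot_c 0 = cI \<A>"
| "rot_c (Suc n) = app (app (cB \<A>) (cC \<A>)) (app (cB \<A>) (rot_c n))"

fun dup_c :: "nat \<Rightarrow> nat \<Rightarrow> 'm" where
  "dup_c 0 i = cI \<A>"
| "dup_c (Suc n) 0 = app (app (cB \<A>) (cW \<A>)) (app (cB \<A>) (rot_c n))"
| "dup_c (Suc n) (Suc i) = app (cB \<A>) (dup_c n i)"

text \<open>The usual combinator \<open>S\<close>, and its iteration: \<open>share_c n\<close> maps \<open>a, b, u\<^sub>1, \<dots>, u\<^sub>n\<close> to
  \<open>a u\<^sub>1 \<dots> u\<^sub>n (b u\<^sub>1 \<dots> u\<^sub>n)\<close>.\<close>

definition S_c :: 'm where
  "S_c = app (app (cB \<A>) (app (cB \<A>) (cW \<A>))) (app (app (cB \<A>) (cB \<A>)) (cC \<A>))"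

fun share_c :: "nat \<Rightarrow> 'm" where
  "share_c 0 = cI \<A>"
| "share_c (Suc n) = app (app (cB \<A>) S_c) (app (cB \<A>) (share_c n))"

lemma qp_drop [simp]: "qp (drop_c n)" by (induction n) auto
lemma qp_proj [simp]: "qp (proj_c n i)" by (induction n i rule: proj_c.induct) auto
lemma qp_const [simp]: "qp c \<Longrightarrow> qp (const_c n c)" by (induction n) auto
lemma qp_rot [simp]: "qp (rot_c n)" by (induction n) auto
lemma qp_dup [simp]: "qp (dup_c n i)" by (induction n i rule: dup_c.induct) auto
lemma qp_S [simp]: "qp S_c" by (simp add: S_c_def)
lemma qp_share [simp]: "qp (share_c n)" by (induction n) auto

lemma pole_drop:
  "lm x \<Longrightarrow> \<forall>u\<in>set us. lm u \<Longrightarrow> st p \<Longrightarrow> pole (x \<star> p) \<Longrightarrow> pole (drop_c (length us) \<star> x \<cdot> pushs us p)"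
proof (induction us arbitrary: x p rule: rev_induct)
  case (snoc v us)
  have "pole (app (cK \<A>) x \<star> v \<cdot> p)"
    using snoc.prems by (intro pole_rules) simp_all
  then have "pole (drop_c (length us) \<star> app (cK \<A>) x \<cdot> pushs us (v \<cdot> p))"
    using snoc.prems by (intro snoc.IH) simp_all
  then show ?case
    using snoc.prems by (simp, intro pole_rules) simp_all
qed (auto intro: pole_rules)

lemma pole_proj:
  "i < length us \<Longrightarrow> \<forall>u\<in>set us. lm u \<Longrightarrow> st p \<Longrightarrow> pole (us ! i \<star> p) \<Longrightarrow> pole (proj_c (length us) i \<star> pushs us p)"
proof (induction us arbitrary: i)
  case (Cons u us)
  show ?case
  proof (cases i)
    case 0
    then show ?thesis using Cons.prems by (simp add: pole_drop)
  next
    case (Suc j)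
    then have "pole (proj_c (length us) j \<star> pushs us p)" using Cons by simp
    then show ?thesis using Suc Cons.prems by (simp, intro pole_rules) simp_all
  qed
qed simp

lemma pole_const:
  "qp c \<Longrightarrow> \<forall>u\<in>set us. lm u \<Longrightarrow> st p \<Longrightarrow> pole (c \<star> p) \<Longrightarrow> pole (const_c (length us) c \<star> pushs us p)"
  by (induction us) (simp_all, intro pole_rules, simp_all)

lemma pole_rot:
  "lm t \<Longrightarrow> lm v \<Longrightarrow> \<forall>u\<in>set us. lm u \<Longrightarrow> st p \<Longrightarrow> pole (t \<star> pushs us (v \<cdot> p)) \<Longrightarrow>
     pole (rot_c (length us) \<star> t \<cdot> v \<cdot> pushs us p)"
proof (induction us arbitrary: t)
  case (Cons u us)
  have "pole (app t u \<star> pushs us (v \<cdot> p))"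
    using Cons.prems by (intro pole_rules) simp_all
  then have "pole (rot_c (length us) \<star> app t u \<cdot> v \<cdot> pushs us p)"
    using Cons.prems by (intro Cons.IH) simp_all
  then show ?case
    using Cons.prems by (simp, intro pole_rules) simp_all
qed (auto intro: pole_rules)

lemma pole_dup:
  "i < length us \<Longrightarrow> lm t \<Longrightarrow> \<forall>u\<in>set us. lm u \<Longrightarrow> st p \<Longrightarrow> pole (t \<star> pushs us (us ! i \<cdot> p)) \<Longrightarrow>
     pole (dup_c (length us) i \<star> t \<cdot> pushs us p)"
proof (induction us arbitrary: t i)
  case (Cons u us)
  show ?case
  proof (cases i)
    case 0
    then have "pole (app t u \<star> pushs us (u \<cdot> p))"
      using Cons.prems by (intro pole_rules) simp_all
    then have "pole (rot_c (length us) \<star> app t u \<cdot> u \<cdot> pushs us p)"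
      using Cons.prems by (intro pole_rot) simp_all
    then show ?thesis
      using 0 Cons.prems by (simp, intro pole_rules) simp_all
  next
    case (Suc j)
    then have "pole (app t u \<star> pushs us (us ! j \<cdot> p))"
      using Cons.prems by (intro pole_rules) simp_all
    then have "pole (dup_c (length us) j \<star> app t u \<cdot> pushs us p)"
      using Suc Cons.prems by (intro Cons.IH) simp_all
    then show ?thesis
      using Suc Cons.prems by (simp, intro pole_rules) simp_all
  qed
qed simp

lemma pole_S:
  assumes "lm x" "lm y" "lm z" "st p" "pole (x \<star> z \<cdot> app y z \<cdot> p)"
  shows "pole (S_c \<star> x \<cdot> y \<cdot> z \<cdot> p)"
  unfolding S_c_def using assms by (intro pole_rules) simp_all

lemma pole_share:
  "lm a \<Longrightarrow> lm b \<Longrightarrow> \<forall>u\<in>set us. lm u \<Longrightarrow> st p \<Longrightarrow> pole (a \<star> pushs us (foldl app b us \<cdot> p)) \<Longrightarrow>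
     pole (share_c (length us) \<star> a \<cdot> b \<cdot> pushs us p)"
proof (induction us arbitrary: a b)
  case (Cons u us)
  have "pole (app a u \<star> pushs us (foldl app (app b u) us \<cdot> p))"
    using Cons.prems by (intro pole_rules) simp_all
  then have "pole (share_c (length us) \<star> app a u \<cdot> app b u \<cdot> pushs us p)"
    using Cons.prems by (intro Cons.IH) simp_all
  then have "pole (app (app (cB \<A>) (share_c (length us))) a \<star> u \<cdot> app b u \<cdot> pushs us p)"
    using Cons.prems by (intro pole_rules) simp_all
  then have "pole (S_c \<star> app (app (cB \<A>) (share_c (length us))) a \<cdot> b \<cdot> u \<cdot> pushs us p)"
    using Cons.prems by (intro pole_S) simp_all
  then show ?case
    using Cons.prems by (simp, intro pole_rules) simp_all
qed (auto intro: pole_rules)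

text \<open>The result is a closed combinator that expects the values of the \<open>n\<close>
  variables on the stack. With levels, an abstraction costs nothing: its argument is simply the next
  stack entry after these values.\<close>

fun compile :: "nat \<Rightarrow> lam \<Rightarrow> 'm" where
  "compile n (LVar i) = proj_c n i"
| "compile n (LApp t u) = app (app (share_c n) (compile n t)) (compile n u)"
| "compile n (LAppV t i) = app (dup_c n i) (compile n t)"
| "compile n (LAbs t) = compile (Suc n) t"
| "compile n LB = const_c n (cB \<A>)"
| "compile n LCC = const_c n (cCC \<A>)"

definition clo :: "lam \<Rightarrow> 'm list \<Rightarrow> 'm" where
  "clo t us = foldl app (compile (length us) t) us"

definition run :: "lam \<Rightarrow> 'm list \<Rightarrow> 'm \<Rightarrow> bool" where
  "run t us p \<longleftrightarrow> pole (compile (length us) t \<star> pushs us p)"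

lemma qp_compile [simp]: "qp (compile n t)"
  by (induction t arbitrary: n) auto

lemma qp_clo: "\<forall>u\<in>set us. qp u \<Longrightarrow> qp (clo t us)"
proof -
  have "qp x \<Longrightarrow> \<forall>u\<in>set us. qp u \<Longrightarrow> qp (foldl app x us)" for x
    by (induction us arbitrary: x) auto
  then show "\<forall>u\<in>set us. qp u \<Longrightarrow> qp (clo t us)" unfolding clo_def by simp
qed

lemma lm_clo [simp]: "\<forall>u\<in>set us. lm u \<Longrightarrow> lm (clo t us)"
  by (simp add: clo_def)

lemma pole_clo: "\<forall>u\<in>set us. lm u \<Longrightarrow> st p \<Longrightarrow> run t us p \<Longrightarrow> pole (clo t us \<star> p)"
  unfolding clo_def run_def by (intro pole_foldl_app) simp_all

lemma run_rules:
  assumes "\<forall>u\<in>set us. lm u" "st p"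
  shows "i < length us \<Longrightarrow> pole (us ! i \<star> p) \<Longrightarrow> run (LVar i) us p"
    "run t us (clo u us \<cdot> p) \<Longrightarrow> run (LApp t u) us p"
    "i < length us \<Longrightarrow> run t us (us ! i \<cdot> p) \<Longrightarrow> run (LAppV t i) us p"
    "lm v \<Longrightarrow> run t (us @ [v]) p \<Longrightarrow> run (LAbs t) us (v \<cdot> p)"
    "pole (cB \<A> \<star> p) \<Longrightarrow> run LB us p"
    "pole (cCC \<A> \<star> p) \<Longrightarrow> run LCC us p"
proof -
  show "run (LVar i) us p" if "i < length us" "pole (us ! i \<star> p)"
    using that assms by (simp add: run_def pole_proj)
  show "run (LAbs t) us (v \<cdot> p)" if "lm v" "run t (us @ [v]) p"
    using that by (simp add: run_def)
  show "run LB us p" if "pole (cB \<A> \<star> p)" using that assms by (simp add: run_def pole_const)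
  show "run LCC us p" if "pole (cCC \<A> \<star> p)" using that assms by (simp add: run_def pole_const)
  show "run (LApp t u) us p" if "run t us (clo u us \<cdot> p)"
  proof -
    have "pole (share_c (length us) \<star> compile (length us) t \<cdot> compile (length us) u \<cdot> pushs us p)"
      using that assms by (intro pole_share) (simp_all add: run_def clo_def)
    then show ?thesis unfolding run_def using assms by (simp, intro pole_rules) simp_all
  qed
  show "run (LAppV t i) us p" if "i < length us" "run t us (us ! i \<cdot> p)"
  proof -
    have "pole (dup_c (length us) i \<star> compile (length us) t \<cdot> pushs us p)"
      using that assms by (intro pole_dup) (simp_all add: run_def)
    then show ?thesis unfolding run_def using assms by (simp, intro pole_rules) simp_all
  qed
qed

end

section \<open>Realizers\<close>

context realizability_algebra
begin

definition stacks :: "'m set \<Rightarrow> bool" where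
  "stacks F \<longleftrightarrow> (\<forall>p\<in>F. st p)"

definition realizes_in :: "lam \<Rightarrow> 'm list \<Rightarrow> 'm set \<Rightarrow> bool" where
  "realizes_in t us F \<longleftrightarrow> (\<forall>p\<in>F. run t us p)"

lemma forces_lm: "x \<tturnstile> F \<Longrightarrow> lm x"
  by (simp add: forces_def)

lemma stacks_simps [simp]:
  "stacks fbot" "stacks (not_eps a b)" "stacks (fneq a b)" "stacks G \<Longrightarrow> stacks (F \<^bold>\<longrightarrow> G)"
  "(\<And>a. stacks (H a)) \<Longrightarrow> stacks (fall H)"
  by (auto simp: stacks_def fbot_def not_eps_def fneq_def fimp_def fall_def forces_def)

lemma stacks_derived [simp]:
  "stacks (fnot F)" "stacks (F \<^bold>\<and> G)" "stacks (fex H)" "stacks (a \<^bold>\<in> b)" "stacks (a \<^bold>= b)"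
  "stacks (is_integer a)" "stacks (is_set_of_integers N)" "stacks (is_injection f X Y)"
  by (simp_all add: fnot_def fand_def fex_def eps_def feq_def is_integer_def is_set_of_integers_def is_injection_def)

lemma forces_clo: "\<forall>u\<in>set us. lm u \<Longrightarrow> stacks F \<Longrightarrow> realizes_in t us F \<Longrightarrow> clo t us \<tturnstile> F"
  unfolding forces_def realizes_in_def stacks_def by (auto intro: pole_clo)

lemma realizes_in_abs:
  assumes "\<forall>u\<in>set us. lm u" "stacks G" "\<And>x. x \<tturnstile> F \<Longrightarrow> realizes_in t (us @ [x]) G"
  shows "realizes_in (LAbs t) us (F \<^bold>\<longrightarrow> G)"
  unfolding realizes_in_def fimp_def
  using assms by (auto intro!: run_rules simp: stacks_def realizes_in_def forces_lm)

lemma realizes_in_all: "(\<And>a. realizes_in t us (F a)) \<Longrightarrow> realizes_in t us (fall F)"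
  unfolding realizes_in_def fall_def by auto

text \<open>Conjunction is encoded by negated implication, so a proof is \<lambda>x. x t u. Both
  components are compiled below the binder of \<open>x\<close>, hence the extra arbitrary entry in
  their environments.\<close>

lemma realizes_in_and:
  assumes us: "\<forall>u\<in>set us. lm u" and n: "n = length us" and F: "stacks F" "stacks G"
    and t: "\<And>x. lm x \<Longrightarrow> realizes_in t (us @ [x]) F" and u: "\<And>x. lm x \<Longrightarrow> realizes_in u (us @ [x]) G"
  shows "realizes_in (LAbs (LApp (LApp (LVar n) t) u)) us (F \<^bold>\<and> G)"
  unfolding fand_def fnot_def
proof (rule realizes_in_abs)
  fix x assume x: "x \<tturnstile> (F \<^bold>\<longrightarrow> G \<^bold>\<longrightarrow> fbot)"
  then have [simp]: "lm x" by (rule forces_lm)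
  have "clo t (us @ [x]) \<tturnstile> F" "clo u (us @ [x]) \<tturnstile> G"
    using us F t u by (auto intro!: forces_clo)
  then have "pole (x \<star> clo t (us @ [x]) \<cdot> clo u (us @ [x]) \<cdot> p)" if "st p" for p
    using x that unfolding forces_def[of x] fimp_def fbot_def by blast
  then show "realizes_in (LApp (LApp (LVar n) t) u) (us @ [x]) fbot"
    unfolding realizes_in_def fbot_def using us n by (auto intro!: run_rules)
qed (use us in simp_all)

lemma realizes_in_ex:
  assumes us: "\<forall>u\<in>set us. lm u" and n: "n = length us" and F: "stacks (F a)"
    and t: "\<And>x. lm x \<Longrightarrow> realizes_in t (us @ [x]) (F a)"
  shows "realizes_in (LAbs (LApp (LVar n) t)) us (fex F)"
  unfolding fex_def fnot_def
proof (rule realizes_in_abs)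
  fix x assume x: "x \<tturnstile> (\<^bold>\<forall>a. F a \<^bold>\<longrightarrow> fbot)"
  then have [simp]: "lm x" by (rule forces_lm)
  have "clo t (us @ [x]) \<tturnstile> F a"
    using us F t by (auto intro!: forces_clo)
  then have "pole (x \<star> clo t (us @ [x]) \<cdot> p)" if "st p" for p
    using x that unfolding forces_def[of x] fimp_def fbot_def fall_def by blast
  then show "realizes_in (LApp (LVar n) t) (us @ [x]) fbot"
    unfolding realizes_in_def fbot_def using us n by (auto intro!: run_rules)
qed (use us in simp_all)

lemma forces_eps_pole:
  assumes "q \<tturnstile> (a \<^bold>\<in> b)" "lm c" "st p" "\<And>r. r \<in> not_eps a b \<Longrightarrow> pole (c \<star> r)"
  shows "pole (q \<star> c \<cdot> p)"
proof -
  have "c \<tturnstile> not_eps a b" using assms unfolding forces_def by blast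
  then show ?thesis using assms(1,3) unfolding eps_def fnot_def fimp_def fbot_def forces_def[of q] by blast
qed

lemma mem_eps: "p \<in> (a \<^bold>\<in> b) \<longleftrightarrow> (\<exists>c r. p = c \<cdot> r \<and> c \<tturnstile> not_eps a b \<and> st r)"
  by (auto simp: eps_def fnot_def fimp_def fbot_def)

text \<open>Integers are represented by terms with \<open>0 z s = z\<close> and \<open>(n + 1) z s = s n (n z s)\<close>. Then
  \<open>n eq_zero eq_succ m w v\<close> reduces to \<open>w\<close> if \<open>m = n\<close> and to \<open>v\<close> otherwise.\<close>

definition num_zero :: 'm where
  "num_zero = clo (LAbs (LAbs (LVar 0))) []"

definition num_succ :: 'm where
  "num_succ = clo (LAbs (LAbs (LAbs (LApp (LAppV (LVar 2) 0) (LAppV (LAppV (LVar 0) 1) 2))))) []"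

definition eq_zero :: 'm where
  "eq_zero = clo (LAbs (LAbs (LAbs (LApp (LAppV (LVar 0) 1) (LAbs (LAbs (LVar 2))))))) []"

text \<open>In named form: \<lambda>n r m w v. m v (\<lambda>x y. r x w v). Here \<open>r\<close> is
  the comparison with \<open>n\<close>; a successor \<open>m\<close> hands over its predecessor
  \<open>x\<close>, on which \<open>r\<close> decides, while zero gives \<open>v\<close>.\<close>

definition eq_succ :: 'm where
  "eq_succ = clo (LAbs (LAbs (LAbs (LAbs (LAbs (LApp (LAppV (LVar 2) 4)
     (LAbs (LAbs (LAppV (LAppV (LAppV (LVar 1) 5) 3) 4))))))))) []"

lemma qp_num [simp]: "qp num_zero" "qp num_succ" "qp eq_zero" "qp eq_succ"
  unfolding num_zero_def num_succ_def eq_zero_def eq_succ_def by (simp_all add: qp_clo)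

lemma pole_num_zero: "lm z \<Longrightarrow> lm s \<Longrightarrow> st p \<Longrightarrow> pole (z \<star> p) \<Longrightarrow> pole (num_zero \<star> z \<cdot> s \<cdot> p)"
  unfolding num_zero_def by (auto intro!: pole_clo run_rules)

text \<open>The recursive result reaches \<open>s\<close> as a closure; \<open>r\<close> abstracts
  from it and retains only that it behaves like \<open>a\<close> applied to \<open>z\<close> and
  \<open>s\<close>.\<close>

lemma pole_num_succ:
  assumes [simp]: "lm a" "lm z" "lm s" "st p"
    and s: "\<And>r. lm r \<Longrightarrow> (\<And>q. st q \<Longrightarrow> pole (a \<star> z \<cdot> s \<cdot> q) \<Longrightarrow> pole (r \<star> q)) \<Longrightarrow> pole (s \<star> a \<cdot> r \<cdot> p)"
  shows "pole (app num_succ a \<star> z \<cdot> s \<cdot> p)"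
proof -
  have "pole (s \<star> a \<cdot> clo (LAppV (LAppV (LVar 0) 1) 2) [a, z, s] \<cdot> p)"
    by (rule s) (auto intro!: pole_clo run_rules)
  then have "pole (num_succ \<star> a \<cdot> z \<cdot> s \<cdot> p)"
    unfolding num_succ_def by (auto intro!: pole_clo run_rules)
  then show ?thesis by (auto intro!: pole_rules)
qed

lemma pole_eq_zero:
  assumes [simp]: "lm b" "lm w" "lm v" "st p"
    and b: "\<And>g. lm g \<Longrightarrow> (\<And>x y q. lm x \<Longrightarrow> lm y \<Longrightarrow> st q \<Longrightarrow> pole (v \<star> q) \<Longrightarrow> pole (g \<star> x \<cdot> y \<cdot> q)) \<Longrightarrow>
      pole (b \<star> w \<cdot> g \<cdot> p)"
  shows "pole (eq_zero \<star> b \<cdot> w \<cdot> v \<cdot> p)"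
proof -
  have "pole (b \<star> w \<cdot> clo (LAbs (LAbs (LVar 2))) [b, w, v] \<cdot> p)"
    by (rule b) (auto intro!: pole_clo run_rules)
  then show ?thesis
    unfolding eq_zero_def by (auto intro!: pole_clo run_rules)
qed

lemma pole_eq_succ:
  assumes [simp]: "lm n" "lm r" "lm b" "lm w" "lm v" "st p"
    and b: "\<And>g. lm g \<Longrightarrow> (\<And>x y q. lm x \<Longrightarrow> lm y \<Longrightarrow> st q \<Longrightarrow> pole (r \<star> x \<cdot> w \<cdot> v \<cdot> q) \<Longrightarrow> pole (g \<star> x \<cdot> y \<cdot> q)) \<Longrightarrow>
      pole (b \<star> v \<cdot> g \<cdot> p)"
  shows "pole (eq_succ \<star> n \<cdot> r \<cdot> b \<cdot> w \<cdot> v \<cdot> p)"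
proof -
  have "pole (b \<star> v \<cdot> clo (LAbs (LAbs (LAppV (LAppV (LAppV (LVar 1) 5) 3) 4))) [n, r, b, w, v] \<cdot> p)"
    by (rule b) (auto intro!: pole_clo run_rules simp: numeral_2_eq_2 numeral_3_eq_3)
  then show ?thesis
    unfolding eq_succ_def by (auto intro!: pole_clo run_rules)
qed

lemma fimpD: "x \<tturnstile> (F \<^bold>\<longrightarrow> G) \<Longrightarrow> y \<tturnstile> F \<Longrightarrow> p \<in> G \<Longrightarrow> pole (x \<star> y \<cdot> p)"
  unfolding forces_def[of x] fimp_def by blast

text \<open>Translates execution into definable terms and back, so that statements about the pole
  can be proved by induction inside the model.\<close>

lemma val_operations [simp]:
  "lm x \<Longrightarrow> lm y \<Longrightarrow> val (App \<A>) (pair x y) = app x y"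
  "lm x \<Longrightarrow> st p \<Longrightarrow> val (Push \<A>) (pair x p) = x \<cdot> p"
  "lm x \<Longrightarrow> st p \<Longrightarrow> val (Cut \<A>) (pair x p) = x \<star> p"
proof -
  have f: "func (App \<A>) (times (Lam \<A>) (Lam \<A>)) (Lam \<A>)" "func (Push \<A>) (times (Lam \<A>) (Stk \<A>)) (Stk \<A>)"
    "func (Cut \<A>) (times (Lam \<A>) (Stk \<A>)) (Prc \<A>)"
    using algebra unfolding is_algebra_def by blast+
  show "lm x \<Longrightarrow> lm y \<Longrightarrow> val (App \<A>) (pair x y) = app x y"
    "lm x \<Longrightarrow> st p \<Longrightarrow> val (Push \<A>) (pair x p) = x \<cdot> p"
    "lm x \<Longrightarrow> st p \<Longrightarrow> val (Cut \<A>) (pair x p) = x \<star> p"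
    unfolding app_def push_def cut_def by (rule func_ap_val[OF f(1), symmetric] func_ap_val[OF f(2), symmetric]
      func_ap_val[OF f(3), symmetric]; simp)+
qed

lemma definable_term_rsucc [definable_intros]: "definable_term s \<Longrightarrow> definable_term (\<lambda>e. rsucc (s e))"
  unfolding rsucc_def by (intro definable_intros)

text \<open>Coherence is used here. Without a stack, every \<open>rsucc x\<close> would be empty,
  and \<open>rsucc\<close> could be neither injective nor different from
  \<open>zero\<close>.\<close>

lemma ex_stack: "\<exists>p. st p"
  using coherence qp_combinators(3) unfolding coherent_def by blast

lemma rsucc_eq_iff [simp]: "rsucc x = rsucc y \<longleftrightarrow> x = y"
proof
  obtain p where p: "st p" using ex_stack by blast
  assume "rsucc x = rsucc y"
  moreover have "pair x p \<in>\<^sub>M rsucc x" using p by (simp add: rsucc_def)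
  ultimately show "x = y" by (simp add: rsucc_def)
qed simp

lemma rsucc_neq_zero [simp]: "rsucc x \<noteq> zero"
proof
  obtain p where p: "st p" using ex_stack by blast
  assume "rsucc x = zero"
  moreover have "pair x p \<in>\<^sub>M rsucc x" using p by (simp add: rsucc_def)
  ultimately show False by (simp add: zero_def)
qed

end

section \<open>Integers and the injection\<close>

text \<open>The table \<open>T\<close> lists, for every integer \<open>n\<close>, its copy \<open>x\<close> in the realizability model, the
  term \<open>a\<close> that represents it and an element \<open>y\<close> of \<open>E\<close>. The elements \<open>y\<close> are distinct.\<close>

locale integer_table = realizability_algebra mem "\<A>"
  for mem :: "'m \<Rightarrow> 'm \<Rightarrow> bool" (infix "\<in>\<^sub>M" 50) and \<A> :: "'m ralg" +
  fixes T y\<^sub>0 E :: 'm and h :: "'m \<Rightarrow> 'm"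
  assumes T_zero: "pair (pair zero num_zero) y\<^sub>0 \<in>\<^sub>M T"
    and T_succ: "pair (pair x a) y \<in>\<^sub>M T \<Longrightarrow> pair (pair (rsucc x) (app num_succ a)) (h y) \<in>\<^sub>M T"
    and T_induct: "definable (\<lambda>e. Q (e 0)) \<Longrightarrow> Q (pair (pair zero num_zero) y\<^sub>0) \<Longrightarrow>
      (\<And>x a y. pair (pair x a) y \<in>\<^sub>M T \<Longrightarrow> Q (pair (pair x a) y) \<Longrightarrow>
         Q (pair (pair (rsucc x) (app num_succ a)) (h y))) \<Longrightarrow> t \<in>\<^sub>M T \<Longrightarrow> Q t"
    and h_definable: "definable (\<lambda>e. e 0 = h (e 1))"
    and T_E: "pair (pair x a) y \<in>\<^sub>M T \<Longrightarrow> y \<in>\<^sub>M E"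
    and h_neq: "pair (pair x a) y \<in>\<^sub>M T \<Longrightarrow> h y \<noteq> y\<^sub>0"
    and h_inj: "pair (pair x a) y \<in>\<^sub>M T \<Longrightarrow> pair (pair x' a') y' \<in>\<^sub>M T \<Longrightarrow> h y = h y' \<Longrightarrow> y = y'"
begin

abbreviation row :: "'m \<Rightarrow> 'm \<Rightarrow> 'm \<Rightarrow> bool" where
  "row x a y \<equiv> pair (pair x a) y \<in>\<^sub>M T"

lemma row_induct [consumes 2, case_names zero succ]:
  assumes D: "definable (\<lambda>e. Q (e 0) (e 1) (e 2))" and "row x a y"
    and "Q zero num_zero y\<^sub>0" "\<And>x a y. row x a y \<Longrightarrow> Q x a y \<Longrightarrow> Q (rsucc x) (app num_succ a) (h y)"
  shows "Q x a y"
proof -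
  have "\<forall>x' a' y'. pair (pair x a) y = pair (pair x' a') y' \<longrightarrow> Q x' a' y'"
    using _ _ _ assms(2)
  proof (rule T_induct)
    show "definable (\<lambda>e. \<forall>x' a' y'. e 0 = pair (pair x' a') y' \<longrightarrow> Q x' a' y')"
      by (intro definable_intros definable_comp3[OF D])
  qed (use assms(3,4) in auto)
  then show ?thesis by blast
qed

lemma row_qp: "row x a y \<Longrightarrow> qp a"
proof (rule row_induct[where Q = "\<lambda>x a y. qp a"])
  show "definable (\<lambda>e. qp (e 1))" by (intro definable_intros)
qed simp_all

lemma row_lm [simp]: "row x a y \<Longrightarrow> lm a"
  using row_qp by simp

lemma row_cases:
  assumes "row x a y"
  obtains "x = zero" "a = num_zero" "y = y\<^sub>0"
    | x' a' y' where "row x' a' y'" "x = rsucc x'" "a = app num_succ a'" "y = h y'"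
proof -
  have "x = zero \<and> a = num_zero \<and> y = y\<^sub>0 \<or>
    (\<exists>x' a' y'. row x' a' y' \<and> x = rsucc x' \<and> a = val (App \<A>) (pair num_succ a') \<and> y = h y')"
    (is "?Q x a y")
  proof (rule row_induct[where Q = ?Q, OF _ assms])
    show "definable (\<lambda>e. ?Q (e 0) (e 1) (e 2))"
      by (intro definable_intros definable_term_comp1[OF h_definable])
    show "?Q (rsucc x) (app num_succ a) (h y)" if "row x a y" for x a y
    proof -
      have "app num_succ a = val (App \<A>) (pair num_succ a)" using that by simp
      then show ?thesis using that by blast
    qed
  qed simp
  then show thesis using that by auto
qed

lemma row_fun: "row x a y \<Longrightarrow> row x a' y' \<Longrightarrow> a' = a \<and> y' = y"
proof -
  assume row: "row x a y" and row': "row x a' y'"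
  have "\<forall>a' y'. row x a' y' \<longrightarrow> a' = a \<and> y' = y"
  proof (rule row_induct[where Q = "\<lambda>x a y. \<forall>a' y'. row x a' y' \<longrightarrow> a' = a \<and> y' = y", OF _ row])
    show "definable (\<lambda>e. \<forall>a' y'. row (e 0) a' y' \<longrightarrow> a' = e 1 \<and> y' = e 2)" by (intro definable_intros)
    show "\<forall>a' y'. row zero a' y' \<longrightarrow> a' = num_zero \<and> y' = y\<^sub>0"
      using rsucc_neq_zero by (metis row_cases)
    show "\<forall>a' y'. row (rsucc x) a' y' \<longrightarrow> a' = app num_succ a \<and> y' = h y"
      if "\<forall>a' y'. row x a' y' \<longrightarrow> a' = a \<and> y' = y" for x a y
      using that rsucc_neq_zero rsucc_eq_iff by (metis row_cases)
  qed
  then show ?thesis using row' by blast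
qed

text \<open>Induction on the first row, using that \<open>h\<close> is injective on the table and
  never returns to \<open>y\<^sub>0\<close>. This is the source of injectivity of the graph.\<close>

lemma row_inj: "row x a y \<Longrightarrow> row x' a' y \<Longrightarrow> x' = x"
proof -
  assume row: "row x a y" and row': "row x' a' y"
  have "\<forall>x' a'. row x' a' y \<longrightarrow> x' = x"
  proof (rule row_induct[where Q = "\<lambda>x a y. \<forall>x' a'. row x' a' y \<longrightarrow> x' = x", OF _ row])
    show "definable (\<lambda>e. \<forall>x' a'. row x' a' (e 2) \<longrightarrow> x' = e 0)" by (intro definable_intros)
    show "\<forall>x' a'. row x' a' y\<^sub>0 \<longrightarrow> x' = zero"
      using h_neq by (metis row_cases)
    show "\<forall>x' a'. row x' a' (h y) \<longrightarrow> x' = rsucc x"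
      if r: "row x a y" and IH: "\<forall>x' a'. row x' a' y \<longrightarrow> x' = x" for x a y
    proof (intro allI impI)
      fix x' a' assume "row x' a' (h y)"
      then show "x' = rsucc x"
      proof (cases rule: row_cases)
        case 1
        then show ?thesis using h_neq[OF r] by simp
      next
        case (2 x'' a'' y'')
        then have "x'' = x" using h_inj[OF r 2(1)] IH by blast
        then show ?thesis using 2(2) by simp
      qed
    qed
  qed
  then show ?thesis using row' by blast
qed

text \<open>Induction on the first row with the second one generalised, and a case distinction on
  the latter. The branches \<open>w\<close>, \<open>v\<close> and the stack \<open>p\<close> stay
  fixed during the recursion.\<close>

lemma pole_decide:
  assumes row: "row x a y" and row': "row x' a' y'" and [simp]: "lm w" "lm v" "st p"
    and eq: "x = x' \<Longrightarrow> pole (w \<star> p)" and neq: "x \<noteq> x' \<Longrightarrow> pole (v \<star> p)"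
  shows "pole (a \<star> eq_zero \<cdot> eq_succ \<cdot> a' \<cdot> w \<cdot> v \<cdot> p)"
proof -
  let ?P = "\<lambda>x p. val (Push \<A>) (pair x p)" and ?C = "\<lambda>x p. val (Cut \<A>) (pair x p)"
  have "\<forall>x' a' y'. row x' a' y' \<longrightarrow> (x = x' \<longrightarrow> pole (w \<star> p)) \<longrightarrow> (x \<noteq> x' \<longrightarrow> pole (v \<star> p)) \<longrightarrow>
    pole (?C a (?P eq_zero (?P eq_succ (?P a' (?P w (?P v p))))))" (is "?Q x a y")
  proof (rule row_induct[where Q = ?Q, OF _ row])
    show "definable (\<lambda>e. ?Q (e 0) (e 1) (e 2))" by (intro definable_intros definable_const)
    show "?Q zero num_zero y\<^sub>0"
    proof (intro allI impI)
      fix x' a' y' assume r: "row x' a' y'" and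
        eq: "zero = x' \<longrightarrow> pole (w \<star> p)" and neq: "zero \<noteq> x' \<longrightarrow> pole (v \<star> p)"
      have "pole (eq_zero \<star> a' \<cdot> w \<cdot> v \<cdot> p)"
      proof (rule pole_eq_zero)
        fix g assume [simp]: "lm g"
          and g: "\<And>x y q. lm x \<Longrightarrow> lm y \<Longrightarrow> st q \<Longrightarrow> pole (v \<star> q) \<Longrightarrow> pole (g \<star> x \<cdot> y \<cdot> q)"
        from r show "pole (a' \<star> w \<cdot> g \<cdot> p)"
        proof (cases rule: row_cases)
          case 1
          then show ?thesis using eq by (auto intro!: pole_num_zero)
        next
          case (2 x'' a'' y'')
          then have "pole (v \<star> p)" using neq rsucc_neq_zero[of x''] by metis
          then show ?thesis using 2(1) by (auto simp: 2(3) intro!: pole_num_succ g)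
        qed
      qed (use r in simp_all)
      then show "pole (?C num_zero (?P eq_zero (?P eq_succ (?P a' (?P w (?P v p))))))"
        using r by (auto intro!: pole_num_zero)
    qed
    show "?Q (rsucc x) (app num_succ a) (h y)" if row: "row x a y" and IH: "?Q x a y" for x a y
    proof (intro allI impI)
      fix x' a' y' assume r: "row x' a' y'" and
        eq: "rsucc x = x' \<longrightarrow> pole (w \<star> p)" and neq: "rsucc x \<noteq> x' \<longrightarrow> pole (v \<star> p)"
      have "pole (app num_succ a \<star> eq_zero \<cdot> eq_succ \<cdot> a' \<cdot> w \<cdot> v \<cdot> p)"
      proof (rule pole_num_succ)
        fix t assume [simp]: "lm t" and t: "\<And>q. st q \<Longrightarrow> pole (a \<star> eq_zero \<cdot> eq_succ \<cdot> q) \<Longrightarrow> pole (t \<star> q)"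
        show "pole (eq_succ \<star> a \<cdot> t \<cdot> a' \<cdot> w \<cdot> v \<cdot> p)"
        proof (rule pole_eq_succ)
          fix g assume [simp]: "lm g" and
            g: "\<And>x y q. lm x \<Longrightarrow> lm y \<Longrightarrow> st q \<Longrightarrow> pole (t \<star> x \<cdot> w \<cdot> v \<cdot> q) \<Longrightarrow> pole (g \<star> x \<cdot> y \<cdot> q)"
          from r show "pole (a' \<star> v \<cdot> g \<cdot> p)"
          proof (cases rule: row_cases)
            case 1
            then have "pole (v \<star> p)" using neq by simp
            then show ?thesis using 1 by (auto intro!: pole_num_zero)
          next
            case (2 x'' a'' y'')
            \<comment> \<open>Both integers are successors, so the question whether they are equal
              passes to their predecessors, where the induction hypothesis answers it.\<close>
            have "pole (?C a (?P eq_zero (?P eq_succ (?P a'' (?P w (?P v p))))))"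
              using IH 2(1) eq neq unfolding 2(2) rsucc_eq_iff by blast
            then have "pole (a \<star> eq_zero \<cdot> eq_succ \<cdot> a'' \<cdot> w \<cdot> v \<cdot> p)" using row 2(1) by simp
            then have "pole (t \<star> a'' \<cdot> w \<cdot> v \<cdot> p)" using 2(1) by (intro t) simp_all
            then show ?thesis using 2(1) by (auto simp: 2(3) intro!: pole_num_succ g)
          qed
        qed (use row r in simp_all)
      qed (use row r in simp_all)
      then show "pole (?C (app num_succ a) (?P eq_zero (?P eq_succ (?P a' (?P w (?P v p))))))"
        using row r by simp
    qed
  qed
  then have "pole (?C a (?P eq_zero (?P eq_succ (?P a' (?P w (?P v p))))))"
    using row' eq neq by blast
  then show ?thesis using row row' by simp
qed

text \<open>A numeral realizes its own induction principle: applied to realizers of the base case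
  and of the step, it realizes membership of \<open>x\<close> in \<open>X\<close>. The step
  \<open>s\<close> also receives the predecessor numeral \<open>b\<close>.\<close>

lemma pole_iterate:
  assumes row: "row x a y" and [simp]: "lm s" and z: "z \<tturnstile> (zero \<^bold>\<in> X)"
    and s: "\<And>x b w p. lm b \<Longrightarrow> w \<tturnstile> (x \<^bold>\<in> X) \<Longrightarrow> p \<in> (rsucc x \<^bold>\<in> X) \<Longrightarrow> pole (s \<star> b \<cdot> w \<cdot> p)"
    and p: "p \<in> (x \<^bold>\<in> X)"
  shows "pole (a \<star> z \<cdot> s \<cdot> p)"
proof -
  let ?P = "\<lambda>x p. val (Push \<A>) (pair x p)" and ?C = "\<lambda>x p. val (Cut \<A>) (pair x p)"
  have [simp]: "lm z" using z by (rule forces_lm)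
  have eps: "pole (u \<star> c \<cdot> r)" if "u \<tturnstile> (x \<^bold>\<in> X)" "c \<tturnstile> not_eps x X" "st r" for u x c r
    using that mem_eps unfolding forces_def by blast
  \<comment> \<open>Forcing of \<open>not_eps x X\<close> is spelled out by means of
    \<open>val\<close>, since the induction accepts definable predicates only.\<close>
  have "\<forall>c r. lm c \<and> st r \<and> (\<forall>q. st q \<and> pair x q \<in>\<^sub>M X \<longrightarrow> pole (?C c q)) \<longrightarrow>
    pole (?C a (?P z (?P s (?P c r))))" (is "?Q x a y")
  proof (rule row_induct[where Q = ?Q, OF _ row])
    show "definable (\<lambda>e. ?Q (e 0) (e 1) (e 2))" by (intro definable_intros)
    show "?Q zero num_zero y\<^sub>0"
    proof (intro allI impI)
      fix c r assume *: "lm c \<and> st r \<and> (\<forall>q. st q \<and> pair zero q \<in>\<^sub>M X \<longrightarrow> pole (?C c q))"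
      then have "c \<tturnstile> not_eps zero X" by (auto simp: forces_def not_eps_def)
      then have "pole (z \<star> c \<cdot> r)" using eps[OF z] * by blast
      then show "pole (?C num_zero (?P z (?P s (?P c r))))" using * by (simp add: pole_num_zero)
    qed
    show "?Q (rsucc x) (app num_succ a) (h y)" if row: "row x a y" and IH: "?Q x a y" for x a y
    proof (intro allI impI)
      fix c r assume *: "lm c \<and> st r \<and> (\<forall>q. st q \<and> pair (rsucc x) q \<in>\<^sub>M X \<longrightarrow> pole (?C c q))"
      then have "c \<tturnstile> not_eps (rsucc x) X" by (auto simp: forces_def not_eps_def)
      then have p: "c \<cdot> r \<in> (rsucc x \<^bold>\<in> X)" using * mem_eps by blast
      have "pole (app num_succ a \<star> z \<cdot> s \<cdot> c \<cdot> r)"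
      proof (rule pole_num_succ)
        fix w assume [simp]: "lm w" and w: "\<And>q. st q \<Longrightarrow> pole (a \<star> z \<cdot> s \<cdot> q) \<Longrightarrow> pole (w \<star> q)"
        have "w \<tturnstile> (x \<^bold>\<in> X)"
          unfolding forces_def
        proof (intro conjI ballI)
          fix q assume "q \<in> (x \<^bold>\<in> X)"
          then obtain d t where q: "q = d \<cdot> t" "d \<tturnstile> not_eps x X" "st t" unfolding mem_eps by blast
          then have d: "lm d" "\<forall>q. st q \<and> pair x q \<in>\<^sub>M X \<longrightarrow> pole (?C d q)"
            by (auto simp: forces_def not_eps_def)
          then have "pole (a \<star> z \<cdot> s \<cdot> d \<cdot> t)" using IH[rule_format, of d t] row q(3) by simp
          then show "pole (w \<star> q)" using w d q by simp
        qed simp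
        then show "pole (s \<star> a \<cdot> w \<cdot> c \<cdot> r)" using s p row by simp
      qed (use row * in simp_all)
      then show "pole (?C (app num_succ a) (?P z (?P s (?P c r))))" using * row by simp
    qed
  qed
  moreover obtain c r where c: "p = c \<cdot> r" "c \<tturnstile> not_eps x X" "st r" using p unfolding mem_eps by blast
  moreover have "lm c \<and> st r \<and> (\<forall>q. st q \<and> pair x q \<in>\<^sub>M X \<longrightarrow> pole (?C c q))"
    using c by (auto simp: forces_def not_eps_def)
  ultimately show ?thesis using row by auto
qed

definition integers :: 'm where
  "integers = cset (\<lambda>u. \<exists>x a y p. row x a y \<and> st p \<and> u = pair x (val (Push \<A>) (pair a p)))"

definition out :: "'m \<Rightarrow> 'm \<Rightarrow> 'm" where
  "out i y = (if i = zero then empty else y)"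

definition graph :: "'m \<Rightarrow> 'm" where
  "graph i = cset (\<lambda>u. \<exists>x a y p. row x a y \<and> st p \<and> u = pair (pair x (out i y)) (val (Push \<A>) (pair a p)))"

lemma definable_term_out: "definable_term s \<Longrightarrow> definable_term (\<lambda>e. out i (s e))"
  by (cases "i = zero") (simp_all add: out_def definable_term_const)

lemma row_bounds:
  assumes "row x a y"
  shows "x \<in>\<^sub>M bigcup (bigcup (bigcup (bigcup T)))" "y \<in>\<^sub>M bigcup (bigcup T)"
  using pair_in_bigcup(1)[OF pair_in_bigcup(1)[OF assms]] pair_in_bigcup(2)[OF assms] .

lemma not_eps_integers: "p \<in> not_eps x integers \<longleftrightarrow> (\<exists>a y q. row x a y \<and> st q \<and> p = a \<cdot> q)"
proof -
  have "u \<in>\<^sub>M integers \<longleftrightarrow> (\<exists>x a y p. row x a y \<and> st p \<and> u = pair x (val (Push \<A>) (pair a p)))" for u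
    unfolding integers_def
  proof (rule mem_cset_bounded)
    show "definable (\<lambda>e. \<exists>x a y p. row x a y \<and> st p \<and> e 0 = pair x (val (Push \<A>) (pair a p)))"
      by (intro definable_intros)
    show "u \<in>\<^sub>M times (bigcup (bigcup (bigcup (bigcup T)))) (Stk \<A>)"
      if u: "\<exists>x a y p. row x a y \<and> st p \<and> u = pair x (val (Push \<A>) (pair a p))" for u
    proof -
      obtain x a y p where "row x a y" "st p" "u = pair x (val (Push \<A>) (pair a p))" using u by blast
      then show ?thesis using row_bounds(1)[of x a y] unfolding mem_times by auto
    qed
  qed
  then show ?thesis unfolding not_eps_def by auto (metis row_lm val_operations(2))+
qed

lemma not_eps_graph:
  "p \<in> not_eps z (graph i) \<longleftrightarrow> (\<exists>x a y q. z = pair x (out i y) \<and> row x a y \<and> st q \<and> p = a \<cdot> q)"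
proof -
  have "u \<in>\<^sub>M graph i \<longleftrightarrow> (\<exists>x a y p. row x a y \<and> st p \<and> u = pair (pair x (out i y)) (val (Push \<A>) (pair a p)))" for u
    unfolding graph_def
  proof (rule mem_cset_bounded)
    show "definable (\<lambda>e. \<exists>x a y p. row x a y \<and> st p \<and> e 0 = pair (pair x (out i y)) (val (Push \<A>) (pair a p)))"
      by (intro definable_intros definable_term_out)
    show "u \<in>\<^sub>M times (times (bigcup (bigcup (bigcup (bigcup T)))) (cup (sing empty) (bigcup (bigcup T)))) (Stk \<A>)"
      if u: "\<exists>x a y p. row x a y \<and> st p \<and> u = pair (pair x (out i y)) (val (Push \<A>) (pair a p))" for u
    proof -
      obtain x a y p where *: "row x a y" "st p" "u = pair (pair x (out i y)) (val (Push \<A>) (pair a p))" using u by blast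
      moreover have "out i y \<in>\<^sub>M cup (sing empty) (bigcup (bigcup T))"
        using row_bounds(2)[OF *(1)] by (simp add: out_def)
      ultimately show ?thesis using row_bounds(1)[OF *(1)] unfolding mem_times by auto
    qed
  qed
  then show ?thesis unfolding not_eps_def by auto (metis row_lm val_operations(2))+
qed

text \<open>The numeral becomes the last entry of the environment, but execution resumes on an
  arbitrary stack \<open>r\<close> and \<open>p\<close> is lost. A caller whose conclusion is not
  bottom has to save its stack beforehand.\<close>

lemma pole_use_integer:
  assumes "q \<tturnstile> (x \<^bold>\<in> integers)" "\<forall>u\<in>set us. lm u" "st p"
    and "\<And>a y r. row x a y \<Longrightarrow> st r \<Longrightarrow> run t (us @ [a]) r"
  shows "pole (q \<star> clo (LAbs t) us \<cdot> p)"
proof (rule forces_eps_pole[OF assms(1)])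
  fix r assume "r \<in> not_eps x integers"
  then show "pole (clo (LAbs t) us \<star> r)"
    using assms unfolding not_eps_integers by (auto intro!: pole_clo run_rules)
qed (use assms in simp_all)

lemma pole_use_graph:
  assumes "q \<tturnstile> (z \<^bold>\<in> graph i)" "\<forall>u\<in>set us. lm u" "st p"
    and "\<And>x a y r. z = pair x (out i y) \<Longrightarrow> row x a y \<Longrightarrow> st r \<Longrightarrow> run t (us @ [a]) r"
  shows "pole (q \<star> clo (LAbs t) us \<cdot> p)"
proof (rule forces_eps_pole[OF assms(1)])
  fix r assume "r \<in> not_eps z (graph i)"
  then show "pole (clo (LAbs t) us \<star> r)"
    using assms unfolding not_eps_graph by (auto intro!: pole_clo run_rules)
qed (use assms in simp_all)

lemma pole_give_integer: "j \<tturnstile> not_eps x integers \<Longrightarrow> row x a y \<Longrightarrow> st p \<Longrightarrow> pole (j \<star> a \<cdot> p)"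
  unfolding forces_def using not_eps_integers by blast

lemma pole_give_graph: "j \<tturnstile> not_eps (pair x (out i y)) (graph i) \<Longrightarrow> row x a y \<Longrightarrow> st p \<Longrightarrow> pole (j \<star> a \<cdot> p)"
  unfolding forces_def using not_eps_graph by blast

text \<open>In named form: \<lambda>q z s. cc (\<lambda>k. q (\<lambda>a. k (a z (\<lambda>b. s)))).
  Eight variables are already bound, so these have levels from 8 on. The innermost abstraction
  discards the predecessor that a numeral passes to its step.\<close>

definition is_integer_term :: lam where
  "is_integer_term = LAbs (LAbs (LAbs (LApp LCC (LAbs (LApp (LVar 8) (LAbs (LApp (LVar 11)
      (LApp (LAppV (LVar 12) 9) (LAbs (LVar 10))))))))))"

lemma realizes_is_integer:
  assumes [simp]: "lm u\<^sub>0" "lm u\<^sub>1" "lm u\<^sub>2" "lm u\<^sub>3" "lm u\<^sub>4" "lm u\<^sub>5" "lm u\<^sub>6" "lm u\<^sub>7"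
  shows "realizes_in is_integer_term
    [u\<^sub>0, u\<^sub>1, u\<^sub>2, u\<^sub>3, u\<^sub>4, u\<^sub>5, u\<^sub>6, u\<^sub>7] (x \<^bold>\<in> integers \<^bold>\<longrightarrow> is_integer x)"
  unfolding is_integer_def is_integer_term_def
proof (intro realizes_in_abs realizes_in_all)
  fix q X z s
  assume q: "q \<tturnstile> (x \<^bold>\<in> integers)" and z: "z \<tturnstile> (zero \<^bold>\<in> X)"
    and s: "s \<tturnstile> (\<^bold>\<forall>y. y \<^bold>\<in> X \<^bold>\<longrightarrow> rsucc y \<^bold>\<in> X)"
  note [simp] = forces_lm[OF q] forces_lm[OF z] forces_lm[OF s]
  let ?us = "[u\<^sub>0, u\<^sub>1, u\<^sub>2, u\<^sub>3, u\<^sub>4, u\<^sub>5, u\<^sub>6, u\<^sub>7, q, z, s]"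
  let ?t' = "LApp (LVar 11) (LApp (LAppV (LVar 12) 9) (LAbs (LVar 10)))"
  let ?t = "LAbs (LApp (LVar 8) (LAbs ?t'))"
  have "run (LApp LCC ?t) ?us p"
    if p: "p \<in> (x \<^bold>\<in> X)" for p
  proof -
    have [simp]: "st p" using p stacks_derived(4) unfolding stacks_def by blast
    have "pole (q \<star> clo (LAbs ?t') (?us @ [cont p]) \<cdot> p)"
      using q
    proof (rule pole_use_integer)
      fix a y r assume row: "row x a y" and [simp]: "st r"
      have [simp]: "lm a" using row by simp
      let ?s = "clo (LAbs (LVar 10)) (?us @ [cont p] @ [a])"
      have s': "pole (?s \<star> b \<cdot> w \<cdot> p')" if [simp]: "lm b" and w: "w \<tturnstile> (x \<^bold>\<in> X)" and p': "p' \<in> (rsucc x \<^bold>\<in> X)" for b w p' x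
      proof -
        have [simp]: "st p'" using p' stacks_derived(4) unfolding stacks_def by blast
        have "s \<tturnstile> (x \<^bold>\<in> X \<^bold>\<longrightarrow> rsucc x \<^bold>\<in> X)"
          using s unfolding forces_def[of s] fall_def by blast
        then have "pole (s \<star> w \<cdot> p')" using w p' by (rule fimpD)
        then show ?thesis using forces_lm[OF w] by (auto intro!: pole_clo run_rules)
      qed
      have "lm ?s" by simp
      then have "pole (a \<star> z \<cdot> ?s \<cdot> p)"
        by (rule pole_iterate[OF row _ z s' p])
      then show "run ?t' ((?us @ [cont p]) @ [a]) r"
        by (auto intro!: pole_clo run_rules pole_rules(8))
    qed simp_all
    then show ?thesis by (auto intro!: pole_clo run_rules pole_rules(7))
  qed
  then show "realizes_in (LApp LCC ?t)
    ((([u\<^sub>0, u\<^sub>1, u\<^sub>2, u\<^sub>3, u\<^sub>4, u\<^sub>5, u\<^sub>6, u\<^sub>7] @ [q]) @ [z]) @ [s]) (x \<^bold>\<in> X)"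
    unfolding realizes_in_def by simp
qed (use forces_lm in auto)

text \<open>In named form: \<lambda>u. u (\<lambda>j. j num_zero) (\<lambda>w j. w (\<lambda>a. B j
  num_succ a)). The instruction \<open>B\<close> gives \<open>j\<close> exactly
  \<open>app num_succ a\<close>, the numeral of the table; a closure that reduces to it would not be
  in the falsity value.\<close>

definition mem_integers_term :: lam where
  "mem_integers_term = LAbs (LApp (LApp (LVar 8) (LAbs (LAppV (LVar 9) 1)))
      (LAbs (LAbs (LApp (LVar 9) (LAbs (LAppV (LAppV (LAppV LB 10) 0) 11))))))"

lemma realizes_mem_integers:
  assumes [simp]: "lm u\<^sub>2" "lm u\<^sub>3" "lm u\<^sub>4" "lm u\<^sub>5" "lm u\<^sub>6" "lm u\<^sub>7"
  shows "realizes_in mem_integers_term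
    [num_succ, num_zero, u\<^sub>2, u\<^sub>3, u\<^sub>4, u\<^sub>5, u\<^sub>6, u\<^sub>7] (is_integer x \<^bold>\<longrightarrow> x \<^bold>\<in> integers)"
  unfolding mem_integers_term_def
proof (rule realizes_in_abs)
  fix u assume u: "u \<tturnstile> is_integer x"
  note [simp] = forces_lm[OF u]
  let ?us = "[num_succ, num_zero, u\<^sub>2, u\<^sub>3, u\<^sub>4, u\<^sub>5, u\<^sub>6, u\<^sub>7, u]"
  let ?t = "LAbs (LAppV (LAppV (LAppV LB 10) 0) 11)"
  let ?s = "LAbs (LAbs (LApp (LVar 9) ?t))"
  let ?z = "clo (LAbs (LAppV (LVar 9) 1)) ?us"
  have z: "?z \<tturnstile> (zero \<^bold>\<in> integers)"
    unfolding eps_def fnot_def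
  proof (intro forces_clo realizes_in_abs)
    fix j assume j: "j \<tturnstile> not_eps zero integers"
    have "pole (j \<star> num_zero \<cdot> p)" if "st p" for p
      using pole_give_integer[OF j T_zero that] .
    then show "realizes_in (LAppV (LVar 9) 1) (?us @ [j]) fbot"
      using forces_lm[OF j] unfolding realizes_in_def fbot_def by (auto intro!: run_rules)
  qed simp_all
  have s: "clo ?s ?us \<tturnstile> (\<^bold>\<forall>y. y \<^bold>\<in> integers \<^bold>\<longrightarrow> rsucc y \<^bold>\<in> integers)"
    unfolding eps_def[of "rsucc _"] fnot_def
  proof (intro forces_clo realizes_in_abs realizes_in_all)
    fix y w j assume w: "w \<tturnstile> (y \<^bold>\<in> integers)" and j: "j \<tturnstile> not_eps (rsucc y) integers"
    note [simp] = forces_lm[OF w] forces_lm[OF j]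
    have "pole (w \<star> clo ?t (?us @ [w, j]) \<cdot> p)" if "st p" for p
      using w
    proof (rule pole_use_integer)
      fix a v r assume row: "row y a v" and [simp]: "st r"
      have [simp]: "lm a" using row by simp
      have "pole (j \<star> app num_succ a \<cdot> r)" using pole_give_integer[OF j T_succ[OF row]] by simp
      then show "run (LAppV (LAppV (LAppV LB 10) 0) 11) ((?us @ [w, j]) @ [a]) r"
        by (auto intro!: run_rules pole_rules)
    qed (use that in simp_all)
    then show "realizes_in (LApp (LVar 9) ?t) ((?us @ [w]) @ [j]) fbot"
      unfolding realizes_in_def fbot_def by (auto intro!: run_rules)
  qed (use forces_lm in auto)
  have "u \<tturnstile> (zero \<^bold>\<in> integers \<^bold>\<longrightarrow> (\<^bold>\<forall>y. y \<^bold>\<in> integers \<^bold>\<longrightarrow> rsucc y \<^bold>\<in> integers) \<^bold>\<longrightarrow> x \<^bold>\<in> integers)"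
    using u unfolding is_integer_def forces_def[of u] fall_def by blast
  then have "pole (u \<star> ?z \<cdot> clo ?s ?us \<cdot> p)" if "p \<in> (x \<^bold>\<in> integers)" for p
    by (rule fimpD[OF _ z]) (use s that in \<open>auto simp: fimp_def\<close>)
  moreover have "st p" if "p \<in> (x \<^bold>\<in> integers)" for p
    using that stacks_derived(4) unfolding stacks_def by blast
  ultimately show "realizes_in (LApp (LApp (LVar 8) (LAbs (LAppV (LVar 9) 1))) ?s)
    ([num_succ, num_zero, u\<^sub>2, u\<^sub>3, u\<^sub>4, u\<^sub>5, u\<^sub>6, u\<^sub>7] @ [u]) (x \<^bold>\<in> integers)"
    unfolding realizes_in_def by (auto intro!: run_rules)
qed simp_all

end

context realizability_algebra
begin

lemma realizes_in_var:
  "\<forall>u\<in>set us. lm u \<Longrightarrow> stacks F \<Longrightarrow> i < length us \<Longrightarrow> us ! i \<tturnstile> F \<Longrightarrow> realizes_in (LVar i) us F"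
  unfolding realizes_in_def stacks_def forces_def by (auto intro!: run_rules)

lemma realizes_in_fbotI: "(\<And>p. st p \<Longrightarrow> run t us p) \<Longrightarrow> realizes_in t us fbot"
  unfolding realizes_in_def fbot_def by simp

lemma realizes_in_not_forall:
  "\<forall>u\<in>set us. lm u \<Longrightarrow> (\<And>k p. k \<tturnstile> (\<^bold>\<forall>a. fnot (F a)) \<Longrightarrow> st p \<Longrightarrow> run t (us @ [k]) p) \<Longrightarrow>
    realizes_in (LAbs t) us (fex F)"
  unfolding fex_def fnot_def[of "fall _"] by (intro realizes_in_abs realizes_in_fbotI) simp_all

lemma pole_give_witness: "k \<tturnstile> (\<^bold>\<forall>a. fnot (F a)) \<Longrightarrow> c \<tturnstile> F a \<Longrightarrow> st p \<Longrightarrow> pole (k \<star> c \<cdot> p)"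
  by (rule fimpD[where F = "F a" and G = fbot]) (auto simp: forces_def[of k] fall_def fnot_def fbot_def)

end

section \<open>The four clauses stating that the graph is an injection\<close>

context integer_table
begin

text \<open>In named form: \<lambda>q k. q (\<lambda>a. k (\<lambda>c. c (\<lambda>d. d (\<lambda>j.
  j a) (\<lambda>f. f (\<lambda>x. x) (\<lambda>x. x))))). The identity realizes the last two
  conjuncts: nonmembership in the target has falsity value \<open>fbot\<close>, and the equation
  holds between identical individuals.\<close>

definition range_term :: lam where
  "range_term = LAbs (LAbs (LApp (LVar 9) (LAbs (LApp (LVar 10) (LAbs (LApp (LVar 12)
     (LAbs (LApp (LApp (LVar 13) (LAbs (LAppV (LVar 14) 11))) (LAbs (LApp (LApp (LVar 14) (LAbs (LVar 15))) (LAbs (LVar 15))))))))))))"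

text \<open>In named form: \<lambda>q k. q (\<lambda>a. k (\<lambda>j. j a)). The numeral of
  \<open>x\<close> also serves for its entry in the graph.\<close>

definition total_term :: lam where
  "total_term = LAbs (LAbs (LApp (LVar 10) (LAbs (LApp (LVar 11) (LAbs (LAppV (LVar 13) 12))))))"

text \<open>In named form: \<lambda>q q' w. cc (\<lambda>k. q (\<lambda>a. q' (\<lambda>a'. k w))).
  The numerals are discarded; the memberships are run only because they exclude pairs outside the
  graph.\<close>

definition functional_term :: lam where
  "functional_term = LAbs (LAbs (LAbs (LApp LCC (LAbs (LApp (LVar 11) (LAbs (LApp (LVar 12)
     (LAbs (LApp (LVar 14) (LVar 13))))))))))"

text \<open>In named form: \<lambda>q q' w. cc (\<lambda>k. q (\<lambda>a. q' (\<lambda>a'. k (a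
  eq_zero eq_succ a' w v)))), where \<open>v\<close> at level 4 is the realizer of the assumption
  that \<open>i\<close> is not zero.\<close>

definition injective_term :: lam where
  "injective_term = LAbs (LAbs (LAbs (LApp LCC (LAbs (LApp (LVar 11) (LAbs (LApp (LVar 12)
     (LAbs (LApp (LVar 14) (LAppV (LAppV (LAppV (LAppV (LAppV (LVar 15) 2) 3) 16) 13) 4))))))))))"

lemma not_eps_out:
  assumes "empty \<in>\<^sub>M E" "row x a y"
  shows "not_eps (out i y) (gimel_ix i E) = fbot"
  using T_E[OF assms(2)] by (auto simp: not_eps_def gimel_ix_def gimel_def out_def fbot_def)

lemma realizes_range:
  assumes us: "\<forall>u\<in>set us. lm u" "length us = 9" and E: "empty \<in>\<^sub>M E"
  shows "realizes_in range_term us (\<^bold>\<forall>z. z \<^bold>\<in> graph i \<^bold>\<longrightarrow>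
    (\<^bold>\<exists>x. \<^bold>\<exists>y. x \<^bold>\<in> integers \<^bold>\<and> y \<^bold>\<in> gimel_ix i E \<^bold>\<and> z \<^bold>= pair x y))"
  unfolding range_term_def
proof (intro realizes_in_all realizes_in_abs realizes_in_not_forall)
  fix z q k p
  assume q: "q \<tturnstile> (z \<^bold>\<in> graph i)" and [simp]: "st p"
    and k: "k \<tturnstile> (\<^bold>\<forall>x. fnot (\<^bold>\<exists>y. x \<^bold>\<in> integers \<^bold>\<and> y \<^bold>\<in> gimel_ix i E \<^bold>\<and> z \<^bold>= pair x y))"
  note [simp] = forces_lm[OF q] forces_lm[OF k] us
  let ?t = "LAbs (LApp (LVar 12) (LAbs (LApp (LApp (LVar 13) (LAbs (LAppV (LVar 14) 11)))
    (LAbs (LApp (LApp (LVar 14) (LAbs (LVar 15))) (LAbs (LVar 15)))))))"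
  have "pole (q \<star> clo (LAbs (LApp (LVar 10) ?t)) (us @ [q, k]) \<cdot> p)"
    using q
  proof (rule pole_use_graph)
    fix x a y r assume z: "z = pair x (out i y)" and row: "row x a y" and [simp]: "st r"
    have [simp]: "lm a" using row by simp
    have "clo ?t (us @ [q, k, a]) \<tturnstile> (\<^bold>\<exists>y. x \<^bold>\<in> integers \<^bold>\<and> y \<^bold>\<in> gimel_ix i E \<^bold>\<and> z \<^bold>= pair x y)"
    proof (intro forces_clo realizes_in_ex[where a = "out i y"] realizes_in_and)
      fix c d assume [simp]: "lm c" "lm d"
      show "realizes_in (LAbs (LAppV (LVar 14) 11)) (((us @ [q, k, a]) @ [c]) @ [d]) (x \<^bold>\<in> integers)"
        unfolding eps_def fnot_def
      proof (intro realizes_in_abs realizes_in_fbotI)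
        fix j p assume j: "j \<tturnstile> not_eps x integers" and [simp]: "st p"
        note [simp] = forces_lm[OF j]
        have "pole (j \<star> a \<cdot> p)" using pole_give_integer[OF j row] by simp
        then show "run (LAppV (LVar 14) 11) ((((us @ [q, k, a]) @ [c]) @ [d]) @ [j]) p"
          by (auto intro!: run_rules simp: nth_append)
      qed simp_all
      fix f assume [simp]: "lm f"
      show "realizes_in (LAbs (LVar 15)) ((((us @ [q, k, a]) @ [c]) @ [d]) @ [f]) (out i y \<^bold>\<in> gimel_ix i E)"
        unfolding eps_def fnot_def not_eps_out[OF E row]
        by (intro realizes_in_abs realizes_in_var) (auto simp: forces_lm nth_append)
      show "realizes_in (LAbs (LVar 15)) ((((us @ [q, k, a]) @ [c]) @ [d]) @ [f]) (z \<^bold>= pair x (out i y))"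
        unfolding feq_def z
        by (intro realizes_in_all realizes_in_abs realizes_in_var) (auto simp: forces_lm nth_append)
    qed simp_all
    then have "pole (k \<star> clo ?t (us @ [q, k, a]) \<cdot> r)" by (rule pole_give_witness[OF k]) simp
    then show "run (LApp (LVar 10) ?t) ((us @ [q, k]) @ [a]) r"
      by (auto intro!: run_rules simp: nth_append)
  qed simp_all
  then show "run (LApp (LVar 9) (LAbs (LApp (LVar 10) ?t))) ((us @ [q]) @ [k]) p"
    by (auto intro!: run_rules simp: nth_append)
qed (use us forces_lm in auto)

lemma realizes_total:
  assumes us: "\<forall>u\<in>set us. lm u" "length us = 10"
  shows "realizes_in total_term us (\<^bold>\<forall>x. x \<^bold>\<in> integers \<^bold>\<longrightarrow> (\<^bold>\<exists>y. pair x y \<^bold>\<in> graph i))"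
  unfolding total_term_def
proof (intro realizes_in_all realizes_in_abs realizes_in_not_forall)
  fix x q k p
  assume q: "q \<tturnstile> (x \<^bold>\<in> integers)" and [simp]: "st p"
    and k: "k \<tturnstile> (\<^bold>\<forall>y. fnot (pair x y \<^bold>\<in> graph i))"
  note [simp] = forces_lm[OF q] forces_lm[OF k] us
  let ?t = "LAbs (LAppV (LVar 13) 12)"
  have "pole (q \<star> clo (LAbs (LApp (LVar 11) ?t)) (us @ [q, k]) \<cdot> p)"
    using q
  proof (rule pole_use_integer)
    fix a y r assume row: "row x a y" and [simp]: "st r"
    have [simp]: "lm a" using row by simp
    have "clo ?t (us @ [q, k, a]) \<tturnstile> (pair x (out i y) \<^bold>\<in> graph i)"
      unfolding eps_def fnot_def
    proof (intro forces_clo realizes_in_abs realizes_in_fbotI)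
      fix j p assume j: "j \<tturnstile> not_eps (pair x (out i y)) (graph i)" and [simp]: "st p"
      note [simp] = forces_lm[OF j]
      have "pole (j \<star> a \<cdot> p)" using pole_give_graph[OF j row] by simp
      then show "run (LAppV (LVar 13) 12) ((us @ [q, k, a]) @ [j]) p"
        by (auto intro!: run_rules simp: nth_append)
    qed simp_all
    then have "pole (k \<star> clo ?t (us @ [q, k, a]) \<cdot> r)" by (rule pole_give_witness[OF k]) simp
    then show "run (LApp (LVar 11) ?t) ((us @ [q, k]) @ [a]) r"
      by (auto intro!: run_rules simp: nth_append)
  qed simp_all
  then show "run (LApp (LVar 10) (LAbs (LApp (LVar 11) ?t))) ((us @ [q]) @ [k]) p"
    by (auto intro!: run_rules simp: nth_append)
qed (use us forces_lm in auto)

text \<open>Common skeleton of functionality and injectivity. The two memberships are used one after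
  the other, each resuming on an unknown stack, so \<open>t\<close> must cope with any
  \<open>r\<close> and finds the original stack as \<open>cont p\<close>.\<close>

lemma realizes_from_graph:
  assumes us: "\<forall>u\<in>set us. lm u" "length us = 11"
    and t: "\<And>q q' w k p x a y x' a' y' r. lm q \<Longrightarrow> lm q' \<Longrightarrow> w \<tturnstile> F \<Longrightarrow> p \<in> G \<Longrightarrow> st r \<Longrightarrow>
      z = pair x (out i y) \<Longrightarrow> row x a y \<Longrightarrow> z' = pair x' (out i y') \<Longrightarrow> row x' a' y' \<Longrightarrow>
      run t (us @ [q, q', w, cont p, a, a']) r"
    and G: "stacks G"
  shows "realizes_in (LAbs (LAbs (LAbs (LApp LCC (LAbs (LApp (LVar 11) (LAbs (LApp (LVar 12) (LAbs t)))))))))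
    us (z \<^bold>\<in> graph i \<^bold>\<longrightarrow> z' \<^bold>\<in> graph i \<^bold>\<longrightarrow> F \<^bold>\<longrightarrow> G)"
proof (intro realizes_in_abs)
  fix q q' w
  assume q: "q \<tturnstile> (z \<^bold>\<in> graph i)" and q': "q' \<tturnstile> (z' \<^bold>\<in> graph i)" and w: "w \<tturnstile> F"
  note [simp] = forces_lm[OF q] forces_lm[OF q'] forces_lm[OF w] us
  have "run (LApp LCC (LAbs (LApp (LVar 11) (LAbs (LApp (LVar 12) (LAbs t)))))) (us @ [q, q', w]) p"
    if p: "p \<in> G" for p
  proof -
    have [simp]: "st p" using p G unfolding stacks_def by blast
    have "pole (q \<star> clo (LAbs (LApp (LVar 12) (LAbs t))) (us @ [q, q', w, cont p]) \<cdot> p)"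
      using q
    proof (rule pole_use_graph)
      fix x a y r assume z: "z = pair x (out i y)" "row x a y" and [simp]: "st r"
      have [simp]: "lm a" using z(2) by simp
      have "pole (q' \<star> clo (LAbs t) (us @ [q, q', w, cont p, a]) \<cdot> r)"
        using q'
      proof (rule pole_use_graph)
        fix x' a' y' s assume z': "z' = pair x' (out i y')" "row x' a' y'" and "st s"
        then show "run t ((us @ [q, q', w, cont p, a]) @ [a']) s"
          using t[OF _ _ w p \<open>st s\<close> z z'] by simp
      qed simp_all
      then show "run (LApp (LVar 12) (LAbs t)) ((us @ [q, q', w, cont p]) @ [a]) r"
        by (auto intro!: run_rules simp: nth_append)
    qed simp_all
    then show ?thesis by (auto intro!: pole_clo run_rules pole_rules(7) simp: nth_append)
  qed
  then show "realizes_in (LApp LCC (LAbs (LApp (LVar 11) (LAbs (LApp (LVar 12) (LAbs t))))))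
      (((us @ [q]) @ [q']) @ [w]) G"
    unfolding realizes_in_def by simp
qed (use us G forces_lm in auto)

lemma realizes_functional:
  assumes us: "\<forall>u\<in>set us. lm u" "length us = 11"
  shows "realizes_in functional_term us
    (\<^bold>\<forall>x. \<^bold>\<forall>y. \<^bold>\<forall>y'. pair x y \<^bold>\<in> graph i \<^bold>\<longrightarrow> pair x y' \<^bold>\<in> graph i \<^bold>\<longrightarrow> y \<^bold>= y')"
  unfolding functional_term_def
proof (intro realizes_in_all)
  fix x v v'
  let ?t = "LAbs (LAbs (LAbs (LApp LCC (LAbs (LApp (LVar 11) (LAbs (LApp (LVar 12)
     (LAbs (LApp (LVar 14) (LVar 13))))))))))"
  have "realizes_in ?t us (pair x v \<^bold>\<in> graph i \<^bold>\<longrightarrow> pair x v' \<^bold>\<in> graph i \<^bold>\<longrightarrow> not_eps v z \<^bold>\<longrightarrow> not_eps v' z)" for z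
    using us
  proof (rule realizes_from_graph)
    fix q q' w k p x\<^sub>1 a y\<^sub>1 x\<^sub>2 a' y\<^sub>2 r
    assume [simp]: "lm q" "lm q'" "st r" and w: "w \<tturnstile> not_eps v z" and p: "p \<in> not_eps v' z"
      and eq: "pair x v = pair x\<^sub>1 (out i y\<^sub>1)" "pair x v' = pair x\<^sub>2 (out i y\<^sub>2)"
      and row: "row x\<^sub>1 a y\<^sub>1" "row x\<^sub>2 a' y\<^sub>2"
    have [simp]: "lm a" "lm a'" "lm w" "st p" using row forces_lm[OF w] p by (auto simp: not_eps_def)
    \<comment> \<open>The first column determines the row, so the two values are the same individual
      and \<open>w\<close> already answers.\<close>
    have "v = v'" using eq row_fun[of x a y\<^sub>1 a' y\<^sub>2] row by auto
    then have "pole (w \<star> p)" using w p unfolding forces_def by blast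
    then show "run (LApp (LVar 14) (LVar 13)) (us @ [q, q', w, cont p, a, a']) r"
      using us by (auto intro!: pole_clo run_rules pole_rules(8) simp: nth_append)
  qed simp
  then show "realizes_in ?t us (pair x v \<^bold>\<in> graph i \<^bold>\<longrightarrow> pair x v' \<^bold>\<in> graph i \<^bold>\<longrightarrow> v \<^bold>= v')"
    unfolding feq_def realizes_in_def fimp_def fall_def by blast
qed

lemma realizes_injective:
  assumes us: "\<forall>u\<in>set us. lm u" "length us = 11" "us ! 2 = eq_zero" "us ! 3 = eq_succ"
    and i: "us ! 4 \<tturnstile> fneq i zero"
  shows "realizes_in injective_term us
    (\<^bold>\<forall>x. \<^bold>\<forall>x'. \<^bold>\<forall>y. pair x y \<^bold>\<in> graph i \<^bold>\<longrightarrow> pair x' y \<^bold>\<in> graph i \<^bold>\<longrightarrow> x \<^bold>= x')"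
  unfolding injective_term_def
proof (intro realizes_in_all)
  fix x x' v
  let ?t = "LAbs (LAbs (LAbs (LApp LCC (LAbs (LApp (LVar 11) (LAbs (LApp (LVar 12)
     (LAbs (LApp (LVar 14) (LAppV (LAppV (LAppV (LAppV (LAppV (LVar 15) 2) 3) 16) 13) 4))))))))))"
  have "realizes_in ?t us (pair x v \<^bold>\<in> graph i \<^bold>\<longrightarrow> pair x' v \<^bold>\<in> graph i \<^bold>\<longrightarrow> not_eps x z \<^bold>\<longrightarrow> not_eps x' z)" for z
    using us(1,2)
  proof (rule realizes_from_graph)
    fix q q' w k p x\<^sub>1 a y\<^sub>1 x\<^sub>2 a' y\<^sub>2 r
    assume [simp]: "lm q" "lm q'" "st r" and w: "w \<tturnstile> not_eps x z" and p: "p \<in> not_eps x' z"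
      and eq: "pair x v = pair x\<^sub>1 (out i y\<^sub>1)" "pair x' v = pair x\<^sub>2 (out i y\<^sub>2)"
      and row: "row x\<^sub>1 a y\<^sub>1" "row x\<^sub>2 a' y\<^sub>2"
    have [simp]: "lm a" "lm a'" "lm w" "st p" using row forces_lm[OF w] p by (auto simp: not_eps_def)
    note [simp] = forces_lm[OF i]
    have "pole (w \<star> p)" if "x\<^sub>1 = x\<^sub>2" using w p that eq unfolding forces_def by auto
    moreover have "pole (us ! 4 \<star> p)" if "x\<^sub>1 \<noteq> x\<^sub>2"
    proof -
      \<comment> \<open>For any other \<open>i\<close> the graph contains the \<open>y\<close> of
        the row itself, and equal \<open>y\<close> force equal integers by
        \<open>row_inj\<close>.\<close>
      have "i = zero" using that row_inj[of x\<^sub>1 a y\<^sub>1 x\<^sub>2 a'] row eq by (auto simp: out_def split: if_splits)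
      then show ?thesis using i by (auto simp: fneq_def fbot_def forces_def)
    qed
    ultimately have "pole (a \<star> eq_zero \<cdot> eq_succ \<cdot> a' \<cdot> w \<cdot> us ! 4 \<cdot> p)"
      by (intro pole_decide[OF row]) simp_all
    then show "run (LApp (LVar 14) (LAppV (LAppV (LAppV (LAppV (LAppV (LVar 15) 2) 3) 16) 13) 4))
        (us @ [q, q', w, cont p, a, a']) r"
      using us by (auto intro!: pole_clo run_rules pole_rules(8) simp: nth_append)
  qed simp
  then show "realizes_in ?t us (pair x v \<^bold>\<in> graph i \<^bold>\<longrightarrow> pair x' v \<^bold>\<in> graph i \<^bold>\<longrightarrow> x \<^bold>= x')"
    unfolding feq_def realizes_in_def fimp_def fall_def by blast
qed

text \<open>Levels 0 to 3 hold the four numeral terms and level 4 the realizer \<open>v\<close>.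
  Each existential quantifier and each conjunction on the way binds one more variable, which fixes
  the indices inside the component terms.\<close>

definition injection_term :: lam where
  "injection_term = LAbs (LAbs (LApp (LVar 5) (LAbs (LApp (LApp (LVar 6)
     (LAbs (LApp (LApp (LVar 7) is_integer_term) mem_integers_term)))
     (LAbs (LApp (LVar 7) (LAbs (LApp (LApp (LVar 8) range_term)
       (LAbs (LApp (LApp (LVar 9) total_term) (LAbs (LApp (LApp (LVar 10) functional_term) injective_term))))))))))))"

lemma realizes_injection:
  assumes E: "empty \<in>\<^sub>M E"
  shows "realizes_in injection_term [num_succ, num_zero, eq_zero, eq_succ]
    (fneq i zero \<^bold>\<longrightarrow> injection_from_integers_into (gimel_ix i E))"
  unfolding injection_term_def injection_from_integers_into_def
proof (rule realizes_in_abs)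
  fix v assume v: "v \<tturnstile> fneq i zero"
  note [simp] = forces_lm[OF v]
  let ?us = "[num_succ, num_zero, eq_zero, eq_succ, v]"
  let ?N = "LAbs (LApp (LApp (LVar 7) is_integer_term) mem_integers_term)"
  let ?f = "LAbs (LApp (LApp (LVar 8) range_term)
       (LAbs (LApp (LApp (LVar 9) total_term) (LAbs (LApp (LApp (LVar 10) functional_term) injective_term)))))"
  let ?p = "LAbs (LApp (LApp (LVar 6) ?N) (LAbs (LApp (LVar 7) ?f)))"
  have "realizes_in ?N (?us @ [k, p]) (is_set_of_integers integers)"
    if [simp]: "lm k" "lm p" for k p
    unfolding is_set_of_integers_def
    by (intro realizes_in_all realizes_in_and)
      (simp_all add: realizes_is_integer realizes_mem_integers)
  moreover have "realizes_in ?f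
     (?us @ [k, p, k']) (is_injection (graph i) integers (gimel_ix i E))"
    if [simp]: "lm k" "lm p" "lm k'" for k p k'
    unfolding is_injection_def
    by (intro realizes_in_and realizes_range realizes_total realizes_functional realizes_injective)
      (simp_all add: E v)
  ultimately have "realizes_in ?p
     (?us @ [k]) (is_set_of_integers integers \<^bold>\<and> (\<^bold>\<exists>f. is_injection f integers (gimel_ix i E)))"
    if [simp]: "lm k" for k
    by (intro realizes_in_and realizes_in_ex[where a = "graph i"]) simp_all
  then show "realizes_in (LAbs (LApp (LVar 5) ?p))
     ([num_succ, num_zero, eq_zero, eq_succ] @ [v])
     (\<^bold>\<exists>N. is_set_of_integers N \<^bold>\<and> (\<^bold>\<exists>f. is_injection f N (gimel_ix i E)))"
    by (intro realizes_in_ex[where a = integers]) simp_all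
qed simp_all

lemma realized_injection:
  assumes E: "empty \<in>\<^sub>M E"
  shows "realized (fall_gimel two (\<lambda>i. fneq i zero \<^bold>\<longrightarrow> injection_from_integers_into (gimel_ix i E)))"
proof -
  let ?us = "[num_succ, num_zero, eq_zero, eq_succ]"
  have "clo injection_term ?us \<tturnstile> (fneq i zero \<^bold>\<longrightarrow> injection_from_integers_into (gimel_ix i E))" for i
    using realizes_injection[OF E]
    by (intro forces_clo) (simp_all add: injection_from_integers_into_def)
  then have "clo injection_term ?us \<tturnstile> fall_gimel two (\<lambda>i. fneq i zero \<^bold>\<longrightarrow> injection_from_integers_into (gimel_ix i E))"
    unfolding forces_def fall_gimel_def by blast
  moreover have "qp (clo injection_term ?us)" by (rule qp_clo) simp
  ultimately show ?thesis unfolding realized_def by blast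
qed

end

lemma (in realizability_algebra) integer_table_exists:
  assumes "ground_model mem" and E: "infinite_set E"
  obtains T y\<^sub>0 h where "integer_table mem \<A> T y\<^sub>0 E h"
proof -
  interpret ground_model mem by fact
  \<comment> \<open>Total and definable, as the iteration requires; in the table \<open>a\<close> is
    always a term, and there \<open>val\<close> agrees with \<open>app\<close>.\<close>
  define G where "G p = (if \<exists>x a. p = pair x a
    then THE q. \<exists>x a. p = pair x a \<and> q = pair (rsucc x) (val (App \<A>) (pair num_succ a)) else p)" for p
  have G_pair: "G (pair x a) = pair (rsucc x) (val (App \<A>) (pair num_succ a))" for x a
    unfolding G_def by auto
  have DG: "definable (\<lambda>e. e 0 = G (e 1))"
  proof (rule definable_iff_eq)
    show "definable (\<lambda>e. (\<exists>x a. e 1 = pair x a \<and> e 0 = pair (rsucc x) (val (App \<A>) (pair num_succ a))) \<or>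
        \<not> (\<exists>x a. e 1 = pair x a) \<and> e 0 = e 1)"
      by (intro definable_intros)
    show "(\<exists>x a. e 1 = pair x a \<and> e 0 = pair (rsucc x) (val (App \<A>) (pair num_succ a))) \<or>
        \<not> (\<exists>x a. e 1 = pair x a) \<and> e 0 = e 1 \<longleftrightarrow> e 0 = G (e 1)" for e
      by (cases "\<exists>x a. e 1 = pair x a") (auto simp: G_pair, auto simp: G_def)
  qed
  obtain T y\<^sub>0 h where T: "pair (pair zero num_zero) y\<^sub>0 \<in>\<^sub>M T"
    "\<And>p y. pair p y \<in>\<^sub>M T \<Longrightarrow> pair (G p) (h y) \<in>\<^sub>M T"
    and ind: "\<And>Q z. definable (\<lambda>e. Q (e 0)) \<Longrightarrow> Q (pair (pair zero num_zero) y\<^sub>0) \<Longrightarrow>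
       (\<And>p y. pair p y \<in>\<^sub>M T \<Longrightarrow> Q (pair p y) \<Longrightarrow> Q (pair (G p) (h y))) \<Longrightarrow> z \<in>\<^sub>M T \<Longrightarrow> Q z"
    and h: "\<And>p y. pair p y \<in>\<^sub>M T \<Longrightarrow> y \<in>\<^sub>M E \<and> h y \<noteq> y\<^sub>0"
    "\<And>p y p' y'. pair p y \<in>\<^sub>M T \<Longrightarrow> pair p' y' \<in>\<^sub>M T \<Longrightarrow> h y = h y' \<Longrightarrow> y = y'"
    and Dh: "definable (\<lambda>e. e 0 = h (e 1))"
  proof (rule infinite_iteration[OF DG E, where b = "pair zero num_zero"], goal_cases)
    case (1 T y\<^sub>0 h)
    show thesis by (rule that) (fact 1)+
  qed
  have rows: "\<exists>x a y. t = pair (pair x a) y \<and> lm a" if "t \<in>\<^sub>M T" for t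
    using _ _ _ that
  proof (rule ind)
    show "definable (\<lambda>e. \<exists>x a y. e 0 = pair (pair x a) y \<and> lm a)" by (intro definable_intros)
  qed (auto simp: G_pair)
  have G_row: "G (pair x a) = pair (rsucc x) (app num_succ a)" if "pair (pair x a) y \<in>\<^sub>M T" for x a y
    using rows[OF that] by (auto simp: G_pair)
  have "integer_table mem \<A> T y\<^sub>0 E h"
  proof
    show "pair (pair (rsucc x) (app num_succ a)) (h y) \<in>\<^sub>M T" if "pair (pair x a) y \<in>\<^sub>M T" for x a y
      using T(2)[OF that] G_row[OF that] by simp
    show "Q t" if "definable (\<lambda>e. Q (e 0))" "Q (pair (pair zero num_zero) y\<^sub>0)"
      "\<And>x a y. pair (pair x a) y \<in>\<^sub>M T \<Longrightarrow> Q (pair (pair x a) y) \<Longrightarrow>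
         Q (pair (pair (rsucc x) (app num_succ a)) (h y))" "t \<in>\<^sub>M T" for Q t
      using that(1,2) _ that(4)
    proof (rule ind)
      fix p y assume p: "pair p y \<in>\<^sub>M T" "Q (pair p y)"
      then obtain x a where "p = pair x a" using rows by fastforce
      then show "Q (pair (G p) (h y))" using that(3) p G_row by metis
    qed
    show "y \<in>\<^sub>M E" "h y \<noteq> y\<^sub>0" if "pair (pair x a) y \<in>\<^sub>M T" for x a y
      using h(1)[OF that] by blast+
    show "y = y'" if "pair (pair x a) y \<in>\<^sub>M T" "pair (pair x' a') y' \<in>\<^sub>M T" "h y = h y'" for x a y x' a' y'
      using h(2)[OF that] .
  qed (rule T Dh)+
  then show thesis using that by blast
qed

theorem theorem25:
  fixes mem :: "'m \<Rightarrow> 'm \<Rightarrow> bool" and \<A> :: "'m ralg" and E :: 'm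
  assumes "ground_model mem"
    and "realizability_frame.is_algebra mem \<A>"
    and "realizability_frame.coherent mem \<A>"
    and "universe.infinite_set mem E"
    and "mem (universe.empty mem) E"
  shows "realizability_frame.realized mem \<A>
    (realizability_frame.fall_gimel mem (universe.two mem)
      (\<lambda>i. realizability_frame.fimp mem \<A>
        (realizability_frame.fneq mem \<A> i (universe.zero mem))
        (realizability_frame.injection_from_integers_into mem \<A>
          (realizability_frame.gimel_ix mem \<A> i E))))"
proof -
  interpret ground_model mem by fact
  interpret realizability_algebra mem "\<A>" by unfold_locales (fact assms)+
  obtain T y\<^sub>0 h where "integer_table mem \<A> T y\<^sub>0 E h"
    using integer_table_exists assms(1,4) by blast
  then interpret integer_table mem "\<A>" T y\<^sub>0 E h .
  show ?thesis using realized_injection[OF assms(5)] .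
qed

end
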